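(* Let $\Lambda$ be a rank-$r$ graph and $\mathsf{H}$ a Hilbert space. There is a one-to-one correspondence between (completely contractive covariant) representations $(\sigma,T^{(1)},\ldots,T^{(r)})$ of the product system $\mathbb{E}(\Lambda)$ on $\mathsf{H}$ and $\Lambda$-contractions $\{V_\lambda:\lambda\in\Lambda\}$ in $B(\mathsf{H})$. The correspondence is given by $$\sigma(\delta_a)=V_a,\quad a\in\Lambda^0,\qquad\qquad T^{(j)}(\delta_\lambda)=V_\lambda,\quad j\in\{1,\ldots,r\},\ \lambda\in\Lambda^{e_j}.$$
   Context: A rank-$r$ graph $\Lambda$ ($r\in\mathbb{N}$) is a small category with object set $\Lambda^0$ (objects are identified with their identity morphisms), range and source maps $r,s:\Lambda\to\Lambda^0$, and a shape functor $d:\Lambda\to\mathbb{N}_0^r$ with the factorisation property: for $m,n\in\mathbb{N}_0^r$ every $\lambda\in\Lambda$ with $d(\lambda)=m+n$ is a unique product $\lambda=\mu\nu$ with $d(\mu)=m$, $d(\nu)=n$, $s(\mu)=r(\nu)$. Write $\Lambda^n=\{\lambda:d(\lambda)=n\}$, $\Lambda^n_a=\{\lambda\in\Lambda^n:s(\lambda)=a\}$; $e_1,\ldots,e_r$ is the canonical basis of $\mathbb{N}_0^r$. A $\Lambda$-contraction on $\mathsf{H}$ is a family $\{V_\lambda:\lambda\in\Lambda\}\subset B(\mathsf{H})$ such that: (i) $V_\lambda V_\mu=0$ if $s(\lambda)\ne r(\mu)$; (ii) $V_\lambda V_\mu=V_{\lambda\mu}$ if $s(\lambda)=r(\mu)$;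 (iii) $\sum_{\lambda\in\Lambda^n}V_\lambda V_\lambda^*\le I$ for all $n\in\mathbb{N}_0^r$; (iv) each $V_a$ ($a\in\Lambda^0$) is an orthogonal projection. Infinite sums are understood in the strong operator topology. The product system $\mathbb{E}(\Lambda)$: let $\mathsf{A}_0=C_0(\Lambda^0)$ ($\Lambda^0$ discrete). For $j\in\{1,\ldots,r\}$ let $E_j(\Lambda)$ be the space of functions $x:\Lambda^{e_j}\to\mathbb{C}$ such that $x_a:=\sum_{\lambda\in\Lambda^{e_j}_a}|x(\lambda)|^2<\infty$ for each $a\in\Lambda^0$ and $a\mapsto x_a$ vanishes at infinity. It is a $C^*$-correspondence over $\mathsf{A}_0$ (a Hilbert $C^*$-module with left action) via $(x\cdot f)(\lambda)=x(\lambda)f(s(\lambda))$, $(f\cdot x)(\lambda)=f(r(\lambda))x(\lambda)$, $\langle x,y\rangle(a)=\sum_{\lambda\in\Lambda^{e_j}_a}\overline{x(\lambda)}y(\lambda)$. Its operator space structure is the one of a corner in its linking algebra, i.e. $$\|(x_{ij})_{i,j=1}^n\|=\sup_{a\in\Lambda^0}\Big\|\Big(\sum_{l=1}^n\sum_{\lambda\in\Lambda^{e_j}_a}\overline{x_{li}(\lambda)}x_{lk}(\lambda)\Big)_{i,k=1}^n\Big\|_{M_n}$$ (here the $j$ in $\Lambda^{e_j}_a$ is the fixed index of $E_j(\Lambda)$). For $n=e_i+e_j$, the internal tensor product $E_i(\Lambda)\otimes E_j(\Lambda)$ is identified with the analogous space of functions on $\Lambda^{e_i+e_j}$ by $(x\otimes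 y)(\nu)=x(\lambda)y(\mu)$ where $\nu=\lambda\mu$, $\lambda\in\Lambda^{e_i}$, $\mu\in\Lambda^{e_j}$. The unitary isomorphisms $t_{i,j}:E_i(\Lambda)\otimes E_j(\Lambda)\to E_j(\Lambda)\otimes E_i(\Lambda)$ are those corresponding to the identity map on functions on $\Lambda^{e_i+e_j}=\Lambda^{e_j+e_i}$; equivalently $t_{i,j}(\delta_\lambda\otimes\delta_\mu)=\delta_{\mu'}\otimes\delta_{\lambda'}$ where $\lambda\mu=\mu'\lambda'$ with $\mu'\in\Lambda^{e_j}$, $\lambda'\in\Lambda^{e_i}$ (for $s(\lambda)=r(\mu)$). $\delta_a\in\mathsf{A}_0$ and $\delta_\lambda\in E_j(\Lambda)$ ($\lambda\in\Lambda^{e_j}$) are Dirac functions. A representation of $\mathbb{E}(\Lambda)$ on $\mathsf{H}$ is a tuple $(\sigma,T^{(1)},\ldots,T^{(r)})$ where $\sigma:\mathsf{A}_0\to B(\mathsf{H})$ is a $*$-homomorphism, each $T^{(j)}:E_j(\Lambda)\to B(\mathsf{H})$ is linear and completely contractive with $T^{(j)}(f\cdot x\cdot g)=\sigma(f)T^{(j)}(x)\sigma(g)$ for $f,g\in\mathsf{A}_0$, and $\widetilde{T}^{(i)}(I_{E_i}\otimes\widetilde{T}^{(j)})=\widetilde{T}^{(j)}(I_{E_j}\otimes\widetilde{T}^{(i)})(t_{i,j}\otimes I_{\mathsf{H}})$ for all $i,j$, where $\widetilde{T}^{(j)}:E_j(\Lambda)\otimes_\sigma\mathsf{H}\to\mathsf{H}$,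 $\widetilde{T}^{(j)}(x\otimes h)=T^{(j)}(x)h$.
   Formalization: The matrix norm on E_j(Λ) is taken as the square root of the supremum of the Gram matrix norms (the norm of a corner of the linking algebra); the displayed formula omits the square root, is not homogeneous, and would force every completely contractive T^{(j)} to vanish. *)

theory Defs
  imports "HOL-Analysis.Analysis"
begin

section \<open>Complex Hilbert spaces and their bounded operators\<close>

text \<open>The inner product is conjugate-linear in the first variable.\<close>

class chilbert_space = banach +
  fixes scaleC :: "complex \<Rightarrow> 'a \<Rightarrow> 'a" (infixr "*\<^sub>C" 75)
    and cinner :: "'a \<Rightarrow> 'a \<Rightarrow> complex"
  assumes scaleC_add_right: "c *\<^sub>C (x + y) = c *\<^sub>C x + c *\<^sub>C y"
    and scaleC_add_left: "(b + c) *\<^sub>C x = b *\<^sub>C x + c *\<^sub>C x"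
    and scaleC_scaleC: "b *\<^sub>C (c *\<^sub>C x) = (b * c) *\<^sub>C x"
    and scaleR_scaleC: "r *\<^sub>R x = complex_of_real r *\<^sub>C x"
    and cinner_commute: "cinner x y = cnj (cinner y x)"
    and cinner_add_right: "cinner x (y + z) = cinner x y + cinner x z"
    and cinner_scaleC_right: "cinner x (c *\<^sub>C y) = c * cinner x y"
    and cinner_ge_zero: "0 \<le> Re (cinner x x)"
    and norm_eq_sqrt_cinner: "norm x = sqrt (Re (cinner x x))"

text \<open>\<open>B(H)\<close>: the complex-linear ones among the bounded real-linear operators. The norm is the same.\<close>

definition BH :: "('h::chilbert_space \<Rightarrow>\<^sub>L 'h) set" where
  "BH = {A. \<forall>c h. blinfun_apply A (c *\<^sub>C h) = c *\<^sub>C blinfun_apply A h}"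

definition cadj :: "('h::chilbert_space \<Rightarrow>\<^sub>L 'h) \<Rightarrow> ('h \<Rightarrow>\<^sub>L 'h)" where
  "cadj A = (THE B. B \<in> BH \<and> (\<forall>h k. cinner (blinfun_apply A h) k = cinner h (blinfun_apply B k)))"

definition is_proj_op :: "('h::chilbert_space \<Rightarrow>\<^sub>L 'h) \<Rightarrow> bool" where
  "is_proj_op P \<longleftrightarrow> P \<in> BH \<and> P o\<^sub>L P = P \<and> cadj P = P"

definition op_le :: "('h::chilbert_space \<Rightarrow>\<^sub>L 'h) \<Rightarrow> ('h \<Rightarrow>\<^sub>L 'h) \<Rightarrow> bool" where
  "op_le A B \<longleftrightarrow> (\<forall>h. cinner h (blinfun_apply (B - A) h) \<in> \<real> \<and>
                        0 \<le> Re (cinner h (blinfun_apply (B - A) h)))"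

text \<open>Unconditional sum in the strong operator topology.\<close>

definition has_sot_sum :: "('i \<Rightarrow> ('h::chilbert_space \<Rightarrow>\<^sub>L 'h)) \<Rightarrow> ('h \<Rightarrow>\<^sub>L 'h) \<Rightarrow> 'i set \<Rightarrow> bool" where
  "has_sot_sum A S I \<longleftrightarrow> (\<forall>h. ((\<lambda>i. blinfun_apply (A i) h) has_sum blinfun_apply S h) I)"

text \<open>The operator norm, on the \<open>n\<close>-fold Hilbert space sum, of an \<open>n \<times> n\<close> matrix of bounded linear maps.\<close>

definition matrix_opnorm :: "nat \<Rightarrow> (nat \<Rightarrow> nat \<Rightarrow> 'v::real_normed_vector \<Rightarrow> 'v) \<Rightarrow> real" where
  "matrix_opnorm n A =
     Sup {L2_set (\<lambda>i. norm (\<Sum>k<n. A i k (h k))) {..<n} | h. L2_set (\<lambda>k. norm (h k)) {..<n} \<le> 1}"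


section \<open>Higher-rank graphs\<close>

text \<open>Objects are identified with their identity morphisms, so \<open>obj\<close> is a subset of \<open>mor\<close>;
  \<open>cmp l m\<close> is meaningful if \<open>src l = rng m\<close>. The rank is \<open>CARD('r)\<close>.\<close>

record ('l, 'r::finite) hrgraph =
  mor :: "'l set"
  obj :: "'l set"
  rng :: "'l \<Rightarrow> 'l"
  src :: "'l \<Rightarrow> 'l"
  cmp :: "'l \<Rightarrow> 'l \<Rightarrow> 'l"
  deg :: "'l \<Rightarrow> nat ^ 'r"

definition mors :: "('l, 'r::finite) hrgraph \<Rightarrow> nat ^ 'r \<Rightarrow> 'l set" where
  "mors L n = {l \<in> mor L. deg L l = n}"

definition mors_from :: "('l, 'r::finite) hrgraph \<Rightarrow> nat ^ 'r \<Rightarrow> 'l \<Rightarrow> 'l set" where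
  "mors_from L n a = {l \<in> mors L n. src L l = a}"

definition is_factor :: "('l, 'r::finite) hrgraph \<Rightarrow> nat ^ 'r \<Rightarrow> nat ^ 'r \<Rightarrow> 'l \<Rightarrow> 'l \<times> 'l \<Rightarrow> bool" where
  "is_factor L m n l p \<longleftrightarrow>
     fst p \<in> mors L m \<and> snd p \<in> mors L n \<and> src L (fst p) = rng L (snd p) \<and> l = cmp L (fst p) (snd p)"

locale higher_rank_graph =
  fixes L :: "('l, 'r::finite) hrgraph"
  assumes obj_mor: "obj L \<subseteq> mor L"
    and rng_obj: "l \<in> mor L \<Longrightarrow> rng L l \<in> obj L"
    and src_obj: "l \<in> mor L \<Longrightarrow> src L l \<in> obj L"
    and rng_id: "a \<in> obj L \<Longrightarrow> rng L a = a"
    and src_id: "a \<in> obj L \<Longrightarrow> src L a = a"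
    and cmp_mor: "l \<in> mor L \<Longrightarrow> m \<in> mor L \<Longrightarrow> src L l = rng L m \<Longrightarrow> cmp L l m \<in> mor L"
    and rng_cmp: "l \<in> mor L \<Longrightarrow> m \<in> mor L \<Longrightarrow> src L l = rng L m \<Longrightarrow> rng L (cmp L l m) = rng L l"
    and src_cmp: "l \<in> mor L \<Longrightarrow> m \<in> mor L \<Longrightarrow> src L l = rng L m \<Longrightarrow> src L (cmp L l m) = src L m"
    and cmp_assoc: "l \<in> mor L \<Longrightarrow> m \<in> mor L \<Longrightarrow> n \<in> mor L \<Longrightarrow> src L l = rng L m \<Longrightarrow>
           src L m = rng L n \<Longrightarrow> cmp L (cmp L l m) n = cmp L l (cmp L m n)"
    and id_left: "l \<in> mor L \<Longrightarrow> cmp L (rng L l) l = l"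
    and id_right: "l \<in> mor L \<Longrightarrow> cmp L l (src L l) = l"
    and deg_id: "a \<in> obj L \<Longrightarrow> deg L a = 0"
    and deg_cmp: "l \<in> mor L \<Longrightarrow> m \<in> mor L \<Longrightarrow> src L l = rng L m \<Longrightarrow>
           deg L (cmp L l m) = deg L l + deg L m"
    and factorisation: "l \<in> mor L \<Longrightarrow> deg L l = d + e \<Longrightarrow> \<exists>!p. is_factor L d e l p"

abbreviation unit_deg :: "'r::finite \<Rightarrow> nat ^ 'r" where
  "unit_deg j \<equiv> axis j 1"

text \<open>A family indexed by the morphisms is a function on \<open>mor L\<close>, made extensional by \<open>\<rightarrow>\<^sub>E\<close>.\<close>

definition graph_contraction ::
  "('l, 'r::finite) hrgraph \<Rightarrow> ('l \<Rightarrow> ('h::chilbert_space \<Rightarrow>\<^sub>L 'h)) \<Rightarrow> bool" where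
  "graph_contraction L V \<longleftrightarrow>
     V \<in> mor L \<rightarrow>\<^sub>E BH \<and>
     (\<forall>l\<in>mor L. \<forall>m\<in>mor L. src L l \<noteq> rng L m \<longrightarrow> V l o\<^sub>L V m = 0) \<and>
     (\<forall>l\<in>mor L. \<forall>m\<in>mor L. src L l = rng L m \<longrightarrow> V l o\<^sub>L V m = V (cmp L l m)) \<and>
     (\<forall>n. \<exists>S\<in>BH. has_sot_sum (\<lambda>l. V l o\<^sub>L cadj (V l)) S (mors L n) \<and> op_le S id_blinfun) \<and>
     (\<forall>a\<in>obj L. is_proj_op (V a))"


section \<open>The product system of a higher-rank graph\<close>

definition dirac :: "'l \<Rightarrow> 'l \<Rightarrow> complex" where
  "dirac l = (\<lambda>m. if m = l then 1 else 0)"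

text \<open>Functions on \<open>obj L\<close> and on \<open>mors L n\<close> are extended by zero. Along \<open>cofinite\<close>, convergence to
  zero is vanishing at infinity on a discrete space.\<close>

definition A0 :: "('l, 'r::finite) hrgraph \<Rightarrow> ('l \<Rightarrow> complex) set" where
  "A0 L = {f. (\<forall>a. a \<notin> obj L \<longrightarrow> f a = 0) \<and> (f \<longlongrightarrow> 0) cofinite}"

definition E :: "('l, 'r::finite) hrgraph \<Rightarrow> nat ^ 'r \<Rightarrow> ('l \<Rightarrow> complex) set" where
  "E L n = {x. (\<forall>l. l \<notin> mors L n \<longrightarrow> x l = 0) \<and>
               (\<forall>a\<in>obj L. (\<lambda>l. (cmod (x l))\<^sup>2) summable_on mors_from L n a) \<and>
               ((\<lambda>a. \<Sum>\<^sub>\<infinity>l\<in>mors_from L n a. (cmod (x l))\<^sup>2) \<longlongrightarrow> 0) cofinite}"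

definition left_act :: "('l, 'r::finite) hrgraph \<Rightarrow> ('l \<Rightarrow> complex) \<Rightarrow> ('l \<Rightarrow> complex) \<Rightarrow> 'l \<Rightarrow> complex" where
  "left_act L f x = (\<lambda>l. f (rng L l) * x l)"

definition right_act :: "('l, 'r::finite) hrgraph \<Rightarrow> ('l \<Rightarrow> complex) \<Rightarrow> ('l \<Rightarrow> complex) \<Rightarrow> 'l \<Rightarrow> complex" where
  "right_act L x f = (\<lambda>l. x l * f (src L l))"

definition E_inner ::
  "('l, 'r::finite) hrgraph \<Rightarrow> nat ^ 'r \<Rightarrow> ('l \<Rightarrow> complex) \<Rightarrow> ('l \<Rightarrow> complex) \<Rightarrow> 'l \<Rightarrow> complex" where
  "E_inner L n x y = (\<lambda>a. if a \<in> obj L then \<Sum>\<^sub>\<infinity>l\<in>mors_from L n a. cnj (x l) * y l else 0)"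

text \<open>The operator space norm of an \<open>N \<times> N\<close> matrix over \<open>E L n\<close>, as a corner of the linking algebra:
  the square root of the norm of the \<open>A0\<close>-valued Gram matrix. Inserting \<open>0\<close> only matters if there are
  no objects.\<close>

definition E_matrix_norm ::
  "('l, 'r::finite) hrgraph \<Rightarrow> nat ^ 'r \<Rightarrow> nat \<Rightarrow> (nat \<Rightarrow> nat \<Rightarrow> 'l \<Rightarrow> complex) \<Rightarrow> real" where
  "E_matrix_norm L n N x =
     sqrt (Sup (insert 0 ((\<lambda>a. matrix_opnorm N (\<lambda>i k z. (\<Sum>l<N. E_inner L n (x l i) (x l k) a) * z)) ` obj L)))"

text \<open>The element \<open>x \<otimes> y\<close> for \<open>x\<close> in \<open>E L m\<close> and \<open>y\<close> in \<open>E L n\<close>, as a function on \<open>mors L (m + n)\<close>.\<close>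

definition E_tensor ::
  "('l, 'r::finite) hrgraph \<Rightarrow> nat ^ 'r \<Rightarrow> nat ^ 'r \<Rightarrow> ('l \<Rightarrow> complex) \<Rightarrow> ('l \<Rightarrow> complex) \<Rightarrow> 'l \<Rightarrow> complex" where
  "E_tensor L m n x y = (\<lambda>v. if v \<in> mors L (m + n)
     then (let p = (THE p. is_factor L m n v p) in x (fst p) * y (snd p)) else 0)"


section \<open>Hilbert spaces spanned by generators with prescribed inner products\<close>

text \<open>Given generators \<open>G\<close> with inner products \<open>K\<close> (a positive semidefinite kernel), a list of generators
  stands for the formal sum of its entries. The Hilbert space spanned by \<open>G\<close> is the completion of the
  formal sums: Cauchy sequences modulo sequences of distance tending to zero. This also divides out
  the vectors of length zero.\<close>

definition ksum_inner :: "('g \<Rightarrow> 'g \<Rightarrow> complex) \<Rightarrow> 'g list \<Rightarrow> 'g list \<Rightarrow> complex" where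
  "ksum_inner K u v = (\<Sum>g\<leftarrow>u. \<Sum>g'\<leftarrow>v. K g g')"

definition ksum_dist :: "('g \<Rightarrow> 'g \<Rightarrow> complex) \<Rightarrow> 'g list \<Rightarrow> 'g list \<Rightarrow> real" where
  "ksum_dist K u v =
     sqrt (Re (ksum_inner K u u - ksum_inner K u v - ksum_inner K v u + ksum_inner K v v))"

definition kcauchy :: "'g set \<Rightarrow> ('g \<Rightarrow> 'g \<Rightarrow> complex) \<Rightarrow> (nat \<Rightarrow> 'g list) set" where
  "kcauchy G K = {X. (\<forall>p. set (X p) \<subseteq> G) \<and>
                     (\<forall>\<epsilon>>0. \<exists>M. \<forall>p\<ge>M. \<forall>q\<ge>M. ksum_dist K (X p) (X q) < \<epsilon>)}"

definition kequiv :: "'g set \<Rightarrow> ('g \<Rightarrow> 'g \<Rightarrow> complex) \<Rightarrow> ((nat \<Rightarrow> 'g list) \<times> (nat \<Rightarrow> 'g list)) set" where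
  "kequiv G K = {(X, Y). X \<in> kcauchy G K \<and> Y \<in> kcauchy G K \<and>
                         (\<lambda>p. ksum_dist K (X p) (Y p)) \<longlonglongrightarrow> 0}"

definition kcompletion :: "'g set \<Rightarrow> ('g \<Rightarrow> 'g \<Rightarrow> complex) \<Rightarrow> (nat \<Rightarrow> 'g list) set set" where
  "kcompletion G K = kcauchy G K // kequiv G K"


section \<open>Completely contractive covariant representations of the product system\<close>

text \<open>Generators and inner products of \<open>E L n \<otimes>\<^sub>\<sigma> H\<close>, and of \<open>E L m \<otimes> E L n \<otimes>\<^sub>\<sigma> H\<close> where the first
  two factors are put together in \<open>E L (m + n)\<close>. Complex multiples of \<open>x \<otimes> h\<close> are generators again.\<close>

definition gens1 :: "('l, 'r::finite) hrgraph \<Rightarrow> nat ^ 'r \<Rightarrow> (('l \<Rightarrow> complex) \<times> 'h::chilbert_space) set" where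
  "gens1 L n = E L n \<times> UNIV"

definition gens2 :: "('l, 'r::finite) hrgraph \<Rightarrow> nat ^ 'r \<Rightarrow> nat ^ 'r \<Rightarrow>
    (('l \<Rightarrow> complex) \<times> ('l \<Rightarrow> complex) \<times> 'h::chilbert_space) set" where
  "gens2 L m n = E L m \<times> E L n \<times> UNIV"

definition ker1 :: "('l, 'r::finite) hrgraph \<Rightarrow> (('l \<Rightarrow> complex) \<Rightarrow> ('h::chilbert_space \<Rightarrow>\<^sub>L 'h)) \<Rightarrow> nat ^ 'r \<Rightarrow>
    ('l \<Rightarrow> complex) \<times> 'h \<Rightarrow> ('l \<Rightarrow> complex) \<times> 'h \<Rightarrow> complex" where
  "ker1 L \<sigma> n = (\<lambda>(x, h) (y, k). cinner h (blinfun_apply (\<sigma> (E_inner L n x y)) k))"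

definition merge2 :: "('l, 'r::finite) hrgraph \<Rightarrow> nat ^ 'r \<Rightarrow> nat ^ 'r \<Rightarrow>
    ('l \<Rightarrow> complex) \<times> ('l \<Rightarrow> complex) \<times> 'h \<Rightarrow> ('l \<Rightarrow> complex) \<times> 'h" where
  "merge2 L m n = (\<lambda>(x, y, h). (E_tensor L m n x y, h))"

definition ker2 :: "('l, 'r::finite) hrgraph \<Rightarrow> (('l \<Rightarrow> complex) \<Rightarrow> ('h::chilbert_space \<Rightarrow>\<^sub>L 'h)) \<Rightarrow>
    nat ^ 'r \<Rightarrow> nat ^ 'r \<Rightarrow>
    ('l \<Rightarrow> complex) \<times> ('l \<Rightarrow> complex) \<times> 'h \<Rightarrow> ('l \<Rightarrow> complex) \<times> ('l \<Rightarrow> complex) \<times> 'h \<Rightarrow> complex" where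
  "ker2 L \<sigma> m n = (\<lambda>g g'. ker1 L \<sigma> (m + n) (merge2 L m n g) (merge2 L m n g'))"

text \<open>The operator \<open>x \<otimes> h \<mapsto> T x h\<close> from \<open>E L n \<otimes>\<^sub>\<sigma> H\<close> to \<open>H\<close>, extended by continuity.\<close>

definition T_tilde :: "(('l \<Rightarrow> complex) \<Rightarrow> ('h::chilbert_space \<Rightarrow>\<^sub>L 'h)) \<Rightarrow>
    (nat \<Rightarrow> (('l \<Rightarrow> complex) \<times> 'h) list) set \<Rightarrow> 'h" where
  "T_tilde T C = (THE v. \<forall>X\<in>C. (\<lambda>p. \<Sum>(x, h)\<leftarrow>X p. blinfun_apply (T x) h) \<longlonglongrightarrow> v)"

text \<open>The operator \<open>x \<otimes> (y \<otimes> h) \<mapsto> x \<otimes> T y h\<close> from \<open>E L m \<otimes> E L n \<otimes>\<^sub>\<sigma> H\<close> to \<open>E L m \<otimes>\<^sub>\<sigma> H\<close>. The image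
  under \<open>kequiv\<close> is the class of the termwise images.\<close>

definition id_tensor_T_tilde :: "('l, 'r::finite) hrgraph \<Rightarrow> (('l \<Rightarrow> complex) \<Rightarrow> ('h::chilbert_space \<Rightarrow>\<^sub>L 'h)) \<Rightarrow>
    nat ^ 'r \<Rightarrow> (('l \<Rightarrow> complex) \<Rightarrow> ('h \<Rightarrow>\<^sub>L 'h)) \<Rightarrow>
    (nat \<Rightarrow> (('l \<Rightarrow> complex) \<times> ('l \<Rightarrow> complex) \<times> 'h) list) set \<Rightarrow>
    (nat \<Rightarrow> (('l \<Rightarrow> complex) \<times> 'h) list) set" where
  "id_tensor_T_tilde L \<sigma> m T C =
     kequiv (gens1 L m) (ker1 L \<sigma> m) `` ((\<lambda>X p. map (\<lambda>(x, y, h). (x, blinfun_apply (T y) h)) (X p)) ` C)"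

text \<open>The unitary \<open>t \<otimes> I\<close> from \<open>E L m \<otimes> E L n \<otimes>\<^sub>\<sigma> H\<close> to \<open>E L n \<otimes> E L m \<otimes>\<^sub>\<sigma> H\<close> induced by the identity of
  the functions on \<open>mors L (m + n) = mors L (n + m)\<close>: distances between the two sides are taken in
  \<open>E L (m + n) \<otimes>\<^sub>\<sigma> H\<close>.\<close>

definition flip_tensor_id :: "('l, 'r::finite) hrgraph \<Rightarrow> (('l \<Rightarrow> complex) \<Rightarrow> ('h::chilbert_space \<Rightarrow>\<^sub>L 'h)) \<Rightarrow>
    nat ^ 'r \<Rightarrow> nat ^ 'r \<Rightarrow>
    (nat \<Rightarrow> (('l \<Rightarrow> complex) \<times> ('l \<Rightarrow> complex) \<times> 'h) list) set \<Rightarrow>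
    (nat \<Rightarrow> (('l \<Rightarrow> complex) \<times> ('l \<Rightarrow> complex) \<times> 'h) list) set" where
  "flip_tensor_id L \<sigma> m n C =
     {Y \<in> kcauchy (gens2 L n m) (ker2 L \<sigma> n m). \<forall>X\<in>C.
        (\<lambda>p. ksum_dist (ker1 L \<sigma> (m + n)) (map (merge2 L m n) (X p)) (map (merge2 L n m) (Y p))) \<longlonglongrightarrow> 0}"

definition star_hom :: "('l, 'r::finite) hrgraph \<Rightarrow> (('l \<Rightarrow> complex) \<Rightarrow> ('h::chilbert_space \<Rightarrow>\<^sub>L 'h)) \<Rightarrow> bool" where
  "star_hom L \<sigma> \<longleftrightarrow>
     \<sigma> \<in> A0 L \<rightarrow>\<^sub>E BH \<and>
     (\<forall>f\<in>A0 L. \<forall>g\<in>A0 L. \<forall>b c h. blinfun_apply (\<sigma> (\<lambda>a. b * f a + c * g a)) h =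
         b *\<^sub>C blinfun_apply (\<sigma> f) h + c *\<^sub>C blinfun_apply (\<sigma> g) h) \<and>
     (\<forall>f\<in>A0 L. \<forall>g\<in>A0 L. \<sigma> (\<lambda>a. f a * g a) = \<sigma> f o\<^sub>L \<sigma> g) \<and>
     (\<forall>f\<in>A0 L. \<sigma> (\<lambda>a. cnj (f a)) = cadj (\<sigma> f))"

definition E_linear :: "('l, 'r::finite) hrgraph \<Rightarrow> nat ^ 'r \<Rightarrow>
    (('l \<Rightarrow> complex) \<Rightarrow> ('h::chilbert_space \<Rightarrow>\<^sub>L 'h)) \<Rightarrow> bool" where
  "E_linear L n T \<longleftrightarrow>
     T \<in> E L n \<rightarrow>\<^sub>E BH \<and>
     (\<forall>x\<in>E L n. \<forall>y\<in>E L n. \<forall>b c h. blinfun_apply (T (\<lambda>l. b * x l + c * y l)) h =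
         b *\<^sub>C blinfun_apply (T x) h + c *\<^sub>C blinfun_apply (T y) h)"

definition completely_contractive :: "('l, 'r::finite) hrgraph \<Rightarrow> nat ^ 'r \<Rightarrow>
    (('l \<Rightarrow> complex) \<Rightarrow> ('h::chilbert_space \<Rightarrow>\<^sub>L 'h)) \<Rightarrow> bool" where
  "completely_contractive L n T \<longleftrightarrow>
     (\<forall>N x. (\<forall>i<N. \<forall>k<N. x i k \<in> E L n) \<longrightarrow>
        matrix_opnorm N (\<lambda>i k. blinfun_apply (T (x i k))) \<le> E_matrix_norm L n N x)"

definition product_system_rep :: "('l, 'r::finite) hrgraph \<Rightarrow>
    (('l \<Rightarrow> complex) \<Rightarrow> ('h::chilbert_space \<Rightarrow>\<^sub>L 'h)) \<Rightarrow>
    ('r \<Rightarrow> ('l \<Rightarrow> complex) \<Rightarrow> ('h \<Rightarrow>\<^sub>L 'h)) \<Rightarrow> bool" where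
  "product_system_rep L \<sigma> T \<longleftrightarrow>
     star_hom L \<sigma> \<and>
     (\<forall>j. E_linear L (unit_deg j) (T j) \<and> completely_contractive L (unit_deg j) (T j) \<and>
        (\<forall>f\<in>A0 L. \<forall>g\<in>A0 L. \<forall>x\<in>E L (unit_deg j).
           T j (right_act L (left_act L f x) g) = \<sigma> f o\<^sub>L T j x o\<^sub>L \<sigma> g)) \<and>
     (\<forall>i j. \<forall>C\<in>kcompletion (gens2 L (unit_deg i) (unit_deg j)) (ker2 L \<sigma> (unit_deg i) (unit_deg j)).
        T_tilde (T i) (id_tensor_T_tilde L \<sigma> (unit_deg i) (T j) C) =
        T_tilde (T j) (id_tensor_T_tilde L \<sigma> (unit_deg j) (T i)
          (flip_tensor_id L \<sigma> (unit_deg i) (unit_deg j) C)))"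

end

theory Submission
  imports Defs
begin

text \<open>Property (iii) of a contraction says that each row \<open>(V l)\<close>, \<open>l\<close> of degree \<open>n\<close>, is a contraction from a
  direct sum of copies of \<open>H\<close> to \<open>H\<close>. Such a row acts on \<open>E L n \<otimes>\<^sub>\<sigma> H\<close>, realised as the square-summable
  families \<open>l \<mapsto> x l *\<^sub>C V (src L l) h\<close>, and \<open>T x = \<Sum> x l *\<^sub>C V l\<close> is the resulting completely contractive
  bimodule map. Conversely, complete contractivity applied to a row of Dirac functions gives a row
  contraction, and density of the finitely supported functions recovers \<open>T\<close> from it. Under this
  dictionary the commutation relation of the product system is the commutation of the edge operators
  around squares, which is exactly what is needed to extend them consistently to all paths; products
  of row contractions are row contractions.\<close>

section \<open>Hilbert spaces\<close>

text \<open>The interior tensor products are given only as completions of formal sums, and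
  \<open>T_tilde\<close> as a definite description over representatives. They are never built as
  Hilbert spaces here. Sending a generator to its coordinate family preserves inner products
  (\<open>l2_kernel\<close>), so distances become \<open>l2n\<close> distances and every convergence
  follows from contractivity of rows. In these coordinates both tensor orders are families over the
  same paths of degree \<open>m + n\<close>, so the flip becomes the identity and the two sides of
  the commutation relation are limits of two row operators along one sequence.

  The obstacle in passing from edges to paths is that a path has many decompositions into edges,
  depending on the order of the colours. No order is preferred: \<open>path_op\<close> admits all of
  them, and uniqueness is a confluence argument whose local diamonds are the squares.

  \<open>A0 L\<close> is the correspondence of degree zero (\<open>A0_eq_E\<close>). Hence
  \<open>\<sigma>\<close> is treated as one more map given by a row, namely the row of projections,
  and multiplicativity and the two module actions become cases of composing rows.\<close>

lemma cinner_add_left: "cinner (x + y) z = cinner x z + cinner y z"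
  by (metis cinner_add_right cinner_commute complex_cnj_add)

lemma cinner_scaleC_left: "cinner (c *\<^sub>C x) y = cnj c * cinner x y"
  by (metis cinner_scaleC_right cinner_commute complex_cnj_mult complex_cnj_cnj)

lemma cinner_self: "cinner x x = of_real ((norm x)\<^sup>2)"
proof -
  have "Im (cinner x x) = 0"
    using cinner_commute[of x x] by (metis complex_cnj complex.sel(2) add.inverse_unique complex_eq_iff
        add_cancel_right_right cnj.sel(2) equal_neg_zero)
  moreover have "Re (cinner x x) = (norm x)\<^sup>2"
    by (simp add: norm_eq_sqrt_cinner cinner_ge_zero)
  ultimately show ?thesis by (simp add: complex_eq_iff)
qed

lemma norm_scaleC: "norm (c *\<^sub>C x) = cmod c * norm x"
proof -
  have "complex_of_real ((norm (c *\<^sub>C x))\<^sup>2) = of_real ((cmod c * norm x)\<^sup>2)"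
    unfolding cinner_self[symmetric] cinner_scaleC_left cinner_scaleC_right
    by (simp add: cinner_self power_mult_distrib mult.assoc[symmetric] complex_norm_square flip: of_real_power)
  then show ?thesis
    by (metis of_real_eq_iff abs_norm_cancel norm_ge_zero power2_eq_iff_nonneg mult_nonneg_nonneg)
qed

lemma scaleR_scaleC_commute: "r *\<^sub>R (c *\<^sub>C x) = c *\<^sub>C (r *\<^sub>R x)" for x :: "'h::chilbert_space"
  by (simp add: scaleR_scaleC scaleC_scaleC mult.commute)

lemma scaleC_one [simp]: "1 *\<^sub>C x = (x::'h::chilbert_space)"
  using scaleR_scaleC[of 1 x] by simp

lemma bounded_bilinear_scaleC:
  "bounded_bilinear (scaleC :: complex \<Rightarrow> 'h::chilbert_space \<Rightarrow> 'h)"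
proof
  show "\<exists>K. \<forall>a (b::'h). norm (a *\<^sub>C b) \<le> norm a * norm b * K"
    by (rule exI[of _ 1]) (simp add: norm_scaleC)
qed (simp_all add: scaleC_add_left scaleC_add_right scaleR_scaleC_commute,
     simp add: scaleR_scaleC scaleC_scaleC scaleR_conv_of_real mult.commute)

interpretation scaleC: bounded_bilinear "scaleC :: complex \<Rightarrow> 'h::chilbert_space \<Rightarrow> 'h"
  by (rule bounded_bilinear_scaleC)

lemma cinner_zero_right [simp]: "cinner x 0 = 0"
  using cinner_add_right[of x 0 0] by simp

lemma cinner_zero_left [simp]: "cinner 0 x = 0"
  using cinner_add_left[of 0 0 x] by simp

lemma cinner_minus_right: "cinner x (- y) = - cinner x y"
  using cinner_add_right[of x y "- y"] by (simp add: eq_neg_iff_add_eq_0 add.commute)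

lemma cinner_minus_left: "cinner (- x) y = - cinner x y"
  using cinner_add_left[of x "- x" y] by (simp add: eq_neg_iff_add_eq_0 add.commute)

lemma cinner_diff_right: "cinner x (y - z) = cinner x y - cinner x z"
  using cinner_add_right[of x y "- z"] by (simp add: cinner_minus_right)

lemma cinner_diff_left: "cinner (x - y) z = cinner x z - cinner y z"
  using cinner_add_left[of x "- y" z] by (simp add: cinner_minus_left)

lemma Re_cinner_commute: "Re (cinner x y) = Re (cinner y x)"
  by (metis cinner_commute complex_cnj cnj.sel(1))

lemma norm_add_square: "(norm (x + y))\<^sup>2 = (norm x)\<^sup>2 + (norm y)\<^sup>2 + 2 * Re (cinner x y)"
  for x y :: "'h::chilbert_space"
proof -
  have "(norm (x + y))\<^sup>2 = Re (cinner (x + y) (x + y))" by (simp add: cinner_self)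
  also have "\<dots> = Re (cinner x x) + Re (cinner y y) + Re (cinner x y) + Re (cinner y x)"
    by (simp add: cinner_add_left cinner_add_right)
  finally show ?thesis using Re_cinner_commute[of y x] by (simp add: cinner_self)
qed

lemma norm_diff_square: "(norm (x - y))\<^sup>2 = (norm x)\<^sup>2 + (norm y)\<^sup>2 - 2 * Re (cinner x y)"
  for x y :: "'h::chilbert_space"
  using norm_add_square[of x "- y"] by (simp add: cinner_minus_right)

text \<open>The coefficient is that of the orthogonal projection of \<open>x\<close> onto
  \<open>y\<close>. Nonnegativity of the left side gives the Cauchy-Schwarz inequality; minimality
  of \<open>norm x\<close> gives orthogonality in the proof of the Riesz theorem.\<close>

lemma norm_diff_projection:
  fixes x y :: "'h::chilbert_space"
  assumes "y \<noteq> 0"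
  shows "(norm (x - (cinner y x / of_real ((norm y)\<^sup>2)) *\<^sub>C y))\<^sup>2 = (norm x)\<^sup>2 - (cmod (cinner x y))\<^sup>2 / (norm y)\<^sup>2"
proof -
  define c where "c = cinner y x / of_real ((norm y)\<^sup>2)"
  have "(norm (x - c *\<^sub>C y))\<^sup>2 = (norm x)\<^sup>2 + (cmod c * norm y)\<^sup>2 - 2 * Re (c * cinner x y)"
    by (simp add: norm_diff_square norm_scaleC cinner_scaleC_right)
  also have "c * cinner x y = of_real ((cmod (cinner x y))\<^sup>2 / (norm y)\<^sup>2)"
    unfolding c_def by (subst cinner_commute[of y x]) (simp add: complex_norm_square mult.commute flip: of_real_power)
  also have "(cmod c * norm y)\<^sup>2 = (cmod (cinner x y))\<^sup>2 / (norm y)\<^sup>2"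
    using assms unfolding c_def
    by (subst cinner_commute[of y x]) (simp add: norm_divide norm_mult norm_power field_simps power2_eq_square)
  finally show ?thesis by (simp add: c_def)
qed

lemma cmod_cinner_le: "cmod (cinner x y) \<le> norm x * norm y"
proof (cases "y = 0")
  case False
  have "(cmod (cinner x y))\<^sup>2 / (norm y)\<^sup>2 \<le> (norm x)\<^sup>2"
    using norm_diff_projection[OF False, of x] by (metis diff_ge_0_iff_ge zero_le_power2)
  then have "(cmod (cinner x y))\<^sup>2 \<le> (norm x * norm y)\<^sup>2"
    using False by (simp add: divide_simps power_mult_distrib)
  then show ?thesis by (rule power2_le_imp_le) simp
qed simp

lemma bounded_bilinear_cinner:
  "bounded_bilinear (cinner :: 'h::chilbert_space \<Rightarrow> 'h \<Rightarrow> complex)"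
proof
  show "\<exists>K. \<forall>a b :: 'h. norm (cinner a b) \<le> norm a * norm b * K"
    by (rule exI[of _ 1]) (simp add: cmod_cinner_le)
qed (simp_all add: cinner_add_left cinner_add_right scaleR_scaleC cinner_scaleC_left
     cinner_scaleC_right scaleR_conv_of_real)

interpretation cinner: bounded_bilinear "cinner :: 'h::chilbert_space \<Rightarrow> 'h \<Rightarrow> complex"
  by (rule bounded_bilinear_cinner)

lemma cinner_eqI:
  assumes "\<And>z. cinner z x = cinner z y" shows "x = (y::'h::chilbert_space)"
proof -
  have "complex_of_real ((norm (x - y))\<^sup>2) = 0"
    unfolding cinner_self[symmetric] using assms by (simp add: cinner_diff_right)
  then show ?thesis by simp
qed

lemma norm_le_cinnerI:
  assumes "\<And>k. cmod (cinner k x) \<le> c * norm k" "c \<ge> 0" shows "norm (x::'h::chilbert_space) \<le> c"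
proof (cases "x = 0")
  case False
  have "norm x * norm x \<le> c * norm x"
    using assms(1)[of x] by (simp add: cinner_self power2_eq_square norm_mult)
  then show ?thesis using False by simp
qed (use assms in simp)

lemma parallelogram_law:
  "(norm (x + y))\<^sup>2 + (norm (x - y))\<^sup>2 = 2 * (norm x)\<^sup>2 + 2 * (norm y)\<^sup>2"
  for x y :: "'h::chilbert_space"
  by (simp add: norm_add_square norm_diff_square)

text \<open>The representing vector is a multiple of the vector of least norm in the hyperplane \<open>f = 1\<close>.\<close>

lemma riesz_representation:
  fixes f :: "'h::chilbert_space \<Rightarrow> complex"
  assumes bl: "bounded_linear f" and sc: "\<And>c h. f (c *\<^sub>C h) = c * f h"
  shows "\<exists>y. \<forall>h. f h = cinner y h"
proof (cases "\<forall>h. f h = 0")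
  case True
  then show ?thesis by (intro exI[of _ 0]) simp
next
  case False
  interpret f: bounded_linear f by fact
  from False obtain h0 where h0: "f h0 \<noteq> 0" by blast
  define M where "M = {h. f h = 1}"
  define d where "d = Inf (norm ` M)"
  have M0: "(1 / f h0) *\<^sub>C h0 \<in> M" using h0 by (simp add: M_def sc)
  have dle: "d \<le> norm h" if "h \<in> M" for h
    unfolding d_def using that by (intro cInf_lower bdd_belowI[of _ 0]) auto
  have d0: "0 \<le> d" unfolding d_def using M0 by (intro cInf_greatest) auto
  have "\<exists>h\<in>M. norm h < d + 1 / real (Suc n)" for n
  proof -
    have "Inf (norm ` M) < d + 1 / real (Suc n)" unfolding d_def by simp
    then show ?thesis using M0 by (subst (asm) cInf_less_iff) (auto intro: bdd_belowI[of _ 0])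
  qed
  then obtain X where X: "\<And>n. X n \<in> M" "\<And>n. norm (X n) < d + 1 / real (Suc n)" by metis
  \<comment> \<open>The midpoint of \<open>X m\<close> and \<open>X n\<close> stays in the
    hyperplane \<open>M\<close>, so its norm is at least \<open>d\<close>; the parallelogram law
    then forces two nearly minimal vectors to be close.\<close>
  have X_dist: "(norm (X m - X n))\<^sup>2 \<le> 2 * (norm (X m))\<^sup>2 + 2 * (norm (X n))\<^sup>2 - 4 * d\<^sup>2" for m n
  proof -
    have "(1/2) *\<^sub>R (X m + X n) \<in> M"
      using X(1) by (simp add: M_def f.scaleR f.add scaleR_conv_of_real)
    then have "d \<le> norm (X m + X n) / 2" using dle by fastforce
    then have "(2 * d)\<^sup>2 \<le> (norm (X m + X n))\<^sup>2" using d0 by (intro power_mono) auto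
    then show ?thesis using parallelogram_law[of "X m" "X n"] by (simp add: power_mult_distrib)
  qed
  have normX: "(\<lambda>n. norm (X n)) \<longlonglongrightarrow> d"
  proof (rule tendsto_sandwich)
    show "\<forall>\<^sub>F n in sequentially. d \<le> norm (X n)" using X dle by simp
    show "\<forall>\<^sub>F n in sequentially. norm (X n) \<le> d + 1 / real (Suc n)"
      using X(2) by (intro always_eventually allI less_imp_le)
    show "(\<lambda>n. d + 1 / real (Suc n)) \<longlonglongrightarrow> d"
      using tendsto_add[OF tendsto_const[of d] LIMSEQ_inverse_real_of_nat]
      by (simp add: inverse_eq_divide)
  qed simp
  have "Cauchy X"
  proof (rule metric_CauchyI)
    fix e :: real assume e: "e > 0"
    have "(\<lambda>n. (norm (X n))\<^sup>2) \<longlonglongrightarrow> d\<^sup>2" by (intro tendsto_intros normX)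
    then have "\<forall>\<^sub>F n in sequentially. (norm (X n))\<^sup>2 < d\<^sup>2 + e\<^sup>2 / 4"
      using e by (intro order_tendstoD(2)) auto
    then obtain N where N: "\<And>n. n \<ge> N \<Longrightarrow> (norm (X n))\<^sup>2 < d\<^sup>2 + e\<^sup>2 / 4"
      by (auto simp: eventually_sequentially)
    have "dist (X m) (X n) < e" if "m \<ge> N" "n \<ge> N" for m n
    proof -
      have "(norm (X m - X n))\<^sup>2 < e\<^sup>2" using X_dist[of m n] N[OF that(1)] N[OF that(2)] by linarith
      then show ?thesis using e by (metis dist_norm power2_less_imp_less less_imp_le)
    qed
    then show "\<exists>M. \<forall>m\<ge>M. \<forall>n\<ge>M. dist (X m) (X n) < e" by blast
  qed
  then obtain z where z: "X \<longlonglongrightarrow> z" using Cauchy_convergent_iff convergent_def by blast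
  have "(\<lambda>n. f (X n)) \<longlonglongrightarrow> f z" by (rule f.tendsto[OF z])
  then have fz: "f z = 1" using X(1) by (simp add: M_def LIMSEQ_const_iff)
  have nz: "norm z = d" using LIMSEQ_unique[OF tendsto_norm[OF z] normX] .
  have z0: "z \<noteq> 0" using fz f.zero by auto
  \<comment> \<open>Since \<open>f x = 0\<close>, the vector \<open>z - c *\<^sub>C x\<close>
    competes with \<open>z\<close> inside \<open>M\<close>. For the projection coefficient
    \<open>c\<close> its squared norm is smaller by a multiple of the square of
    \<open>cmod (cinner z x)\<close>, which minimality forces to vanish.\<close>
  have orth: "cinner z x = 0" if "f x = 0" for x
  proof (cases "x = 0")
    case x0: False
    define c where "c = cinner x z / of_real ((norm x)\<^sup>2)"
    have "f (z - c *\<^sub>C x) = 1" using that fz by (simp add: f.diff sc)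
    then have "(norm z)\<^sup>2 \<le> (norm (z - c *\<^sub>C x))\<^sup>2"
      using dle nz d0 by (intro power_mono) (auto simp: M_def)
    also have "\<dots> = (norm z)\<^sup>2 - (cmod (cinner z x))\<^sup>2 / (norm x)\<^sup>2"
      unfolding c_def by (rule norm_diff_projection[OF x0])
    finally show ?thesis using x0 by (simp add: divide_le_0_iff)
  qed simp
  have "f h = cinner ((1 / of_real ((norm z)\<^sup>2)) *\<^sub>C z) h" for h
  proof -
    have "f (h - f h *\<^sub>C z) = 0" by (simp add: f.diff sc fz)
    then have "cinner z h = f h * of_real ((norm z)\<^sup>2)"
      using orth[of "h - f h *\<^sub>C z"] by (simp add: cinner_diff_right cinner_scaleC_right cinner_self)
    then show ?thesis using z0 by (simp add: cinner_scaleC_left)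
  qed
  then show ?thesis by blast
qed


section \<open>Complex-linear operators and their adjoints\<close>

lemma BH_scaleC: "A \<in> BH \<Longrightarrow> blinfun_apply A (c *\<^sub>C h) = c *\<^sub>C blinfun_apply A h"
  by (simp add: BH_def)

lemma BH_compose: "A \<in> BH \<Longrightarrow> B \<in> BH \<Longrightarrow> A o\<^sub>L B \<in> BH"
  by (simp add: BH_def)

lemma BH_zero [simp]: "0 \<in> BH"
  by (simp add: BH_def scaleC.zero_right)

lemma BH_I:
  assumes "\<And>h k. f (h + k) = f h + f k" "\<And>c h. f (c *\<^sub>C h) = c *\<^sub>C f h"
    and "\<And>h. norm (f h) \<le> norm h * K"
  shows "\<exists>A\<in>BH. blinfun_apply A = (f :: 'h::chilbert_space \<Rightarrow> 'h)"
proof -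
  have "bounded_linear f"
    by (rule bounded_linear_intro[of f K]) (use assms in \<open>auto simp: scaleR_scaleC\<close>)
  then show ?thesis using assms(2) by (intro bexI[of _ "Blinfun f"]) (auto simp: BH_def bounded_linear_Blinfun_apply)
qed

text \<open>Riesz represents the functional \<open>h \<mapsto> cinner k (A h)\<close> for each
  \<open>k\<close>. Linearity in \<open>k\<close> of the representing vector and its norm bound are
  both tested weakly, against all vectors.\<close>

lemma adjoint_exists:
  assumes A: "A \<in> BH"
  shows "\<exists>B\<in>BH. \<forall>h k. cinner (blinfun_apply A h) k = cinner h (blinfun_apply B k)"
proof -
  have "\<exists>y. \<forall>h. cinner k (blinfun_apply A h) = cinner y h" for k
  proof (rule riesz_representation)
    show "bounded_linear (\<lambda>h. cinner k (blinfun_apply A h))"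
      by (intro bounded_linear_compose[OF cinner.bounded_linear_right] blinfun.bounded_linear_right)
  qed (simp add: BH_scaleC[OF A] cinner_scaleC_right)
  then obtain g where g: "\<And>k h. cinner k (blinfun_apply A h) = cinner (g k) h" by metis
  have g': "cinner (blinfun_apply A h) k = cinner h (g k)" for h k
    by (metis g cinner_commute)
  have "\<exists>B\<in>BH. blinfun_apply B = g"
  proof (rule BH_I)
    show "g (h + k) = g h + g k" for h k
      by (rule cinner_eqI) (simp add: cinner_add_right flip: g')
    show "g (c *\<^sub>C h) = c *\<^sub>C g h" for c h
      by (rule cinner_eqI) (simp add: cinner_scaleC_right flip: g')
    show "norm (g h) \<le> norm h * norm A" for h
    proof (rule norm_le_cinnerI)
      fix k
      have "cmod (cinner k (g h)) \<le> norm (blinfun_apply A k) * norm h"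
        unfolding g'[symmetric] by (rule cmod_cinner_le)
      also have "\<dots> \<le> (norm A * norm k) * norm h" by (intro mult_right_mono norm_blinfun) simp
      finally show "cmod (cinner k (g h)) \<le> norm h * norm A * norm k" by (simp add: ac_simps)
    qed simp
  qed
  then show ?thesis using g' by auto
qed

lemma cadj_unique:
  assumes "B \<in> BH" "\<And>h k. cinner (blinfun_apply A h) k = cinner h (blinfun_apply B k)"
  shows "cadj A = B"
  unfolding cadj_def
proof (rule the_equality)
  fix B' assume B': "B' \<in> BH \<and> (\<forall>h k. cinner (blinfun_apply A h) k = cinner h (blinfun_apply B' k))"
  show "B' = B" by (rule blinfun_eqI, rule cinner_eqI) (metis B' assms(2))
qed (use assms in blast)

lemma cadj_in_BH: "A \<in> BH \<Longrightarrow> cadj A \<in> BH"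
  by (metis adjoint_exists cadj_unique)

lemma cinner_cadj_right:
  "A \<in> BH \<Longrightarrow> cinner h (cadj A k) = cinner (blinfun_apply A h) k"
  by (metis adjoint_exists cadj_unique)

lemma cinner_cadj_left:
  "A \<in> BH \<Longrightarrow> cinner (cadj A h) k = cinner h (blinfun_apply A k)"
  by (metis cinner_cadj_right cinner_commute)

section \<open>Square-summable families\<close>

text \<open>Partial sums over two finite sets containing \<open>F0\<close> differ by two sums over
  sets disjoint from \<open>F0\<close>, so small sums off \<open>F0\<close> make the net of partial
  sums Cauchy. This suits series that converge unconditionally but perhaps not absolutely.\<close>

lemma summable_on_CauchyI:
  fixes f :: "'i \<Rightarrow> 'b::banach"
  assumes "\<And>e. e > 0 \<Longrightarrow> \<exists>F0. finite F0 \<and> F0 \<subseteq> I \<and>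
             (\<forall>F. finite F \<longrightarrow> F \<subseteq> I - F0 \<longrightarrow> norm (sum f F) < e)"
  shows "f summable_on I"
proof -
  have "cauchy_filter (filtermap (sum f) (finite_subsets_at_top I))"
    unfolding cauchy_filter_metric_filtermap
  proof (intro allI impI)
    fix e :: real assume "e > 0"
    then obtain F0 where F0: "finite F0" "F0 \<subseteq> I"
      and le: "\<And>F. finite F \<Longrightarrow> F \<subseteq> I - F0 \<Longrightarrow> norm (sum f F) < e / 2"
      using assms[of "e / 2"] by auto
    have "dist (sum f F) (sum f F') < e"
      if "finite F" "F0 \<subseteq> F" "F \<subseteq> I" "finite F'" "F0 \<subseteq> F'" "F' \<subseteq> I" for F F'
    proof -
      have "sum f F - sum f F' = sum f (F - F0) - sum f (F' - F0)"
        using that by (simp add: sum_diff)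
      then have "dist (sum f F) (sum f F') \<le> norm (sum f (F - F0)) + norm (sum f (F' - F0))"
        by (simp add: dist_norm norm_triangle_ineq4)
      also have "\<dots> < e" using le[of "F - F0"] le[of "F' - F0"] that by fastforce
      finally show ?thesis .
    qed
    then show "\<exists>P. eventually P (finite_subsets_at_top I) \<and>
                 (\<forall>x y. P x \<and> P y \<longrightarrow> dist (sum f x) (sum f y) < e)"
      using F0 by (intro exI[of _ "\<lambda>F. finite F \<and> F0 \<subseteq> F \<and> F \<subseteq> I"])
        (auto simp: eventually_finite_subsets_at_top)
  qed
  moreover have "complete (UNIV :: 'b set)"
    by (meson Cauchy_convergent UNIV_I complete_def convergent_def)
  ultimately obtain S where "(sum f \<longlongrightarrow> S) (finite_subsets_at_top I)"
    using complete_uniform[where S = "UNIV :: 'b set"] by (force simp add: filterlim_def)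
  then show ?thesis using summable_on_def has_sum_def by blast
qed

lemma has_sum_diff:
  fixes f g :: "'i \<Rightarrow> 'b::real_normed_vector"
  assumes "(f has_sum a) I" "(g has_sum b) I"
  shows "((\<lambda>i. f i - g i) has_sum a - b) I"
  using has_sum_add[OF assms(1), of "\<lambda>i. - g i" "- b"] assms(2) by (simp add: has_sum_uminus)

lemma summable_on_small_tail:
  fixes g :: "'i \<Rightarrow> real"
  assumes g: "g summable_on I" and nn: "\<And>i. i \<in> I \<Longrightarrow> g i \<ge> 0" and e: "e > 0"
  shows "\<exists>F0. finite F0 \<and> F0 \<subseteq> I \<and> infsum g (I - F0) < e"
proof -
  have "(g has_sum infsum g I) I" using g by simp
  then obtain F0 where F0: "finite F0" "F0 \<subseteq> I" "dist (sum g F0) (infsum g I) \<le> e / 2"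
    using has_sum_finite_approximation[of g I "infsum g I" "e / 2"] e by auto
  have "infsum g (I - F0) = infsum g I - infsum g F0"
    using F0 g by (intro infsum_Diff) auto
  also have "\<dots> < e" using F0(1,3) e unfolding dist_real_def infsum_finite[OF F0(1)] by linarith
  finally show ?thesis using F0 by blast
qed

lemma summable_on_nonneg_boundI:
  fixes g :: "'i \<Rightarrow> real"
  assumes "\<And>i. i \<in> I \<Longrightarrow> g i \<ge> 0" "\<And>F. finite F \<Longrightarrow> F \<subseteq> I \<Longrightarrow> sum g F \<le> c"
  shows "g summable_on I" "infsum g I \<le> c"
proof -
  show "g summable_on I"
    by (rule nonneg_bdd_above_summable_on) (use assms in \<open>auto intro!: bdd_aboveI[of _ c]\<close>)
  then show "infsum g I \<le> c" using assms(2) by (rule infsum_le_finite_sums)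
qed

text \<open>The direct sum of copies of the Hilbert space is kept as a predicate and a seminorm on
  all functions: values off \<open>I\<close> are ignored, and no quotient is formed.\<close>

definition l2 :: "'i set \<Rightarrow> ('i \<Rightarrow> 'h::chilbert_space) \<Rightarrow> bool" where
  "l2 I f \<longleftrightarrow> (\<lambda>i. (norm (f i))\<^sup>2) summable_on I"

definition l2n :: "'i set \<Rightarrow> ('i \<Rightarrow> 'h::chilbert_space) \<Rightarrow> real" where
  "l2n I f = sqrt (\<Sum>\<^sub>\<infinity>i\<in>I. (norm (f i))\<^sup>2)"

lemma l2n_square: "(l2n I f)\<^sup>2 = (\<Sum>\<^sub>\<infinity>i\<in>I. (norm (f i))\<^sup>2)"
  by (simp add: l2n_def infsum_nonneg)

lemma l2n_nonneg [simp]: "0 \<le> l2n I f"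
  by (simp add: l2n_def infsum_nonneg)

lemma l2_boundI:
  assumes "\<And>F. finite F \<Longrightarrow> F \<subseteq> I \<Longrightarrow> L2_set (\<lambda>i. norm (f i)) F \<le> c" "0 \<le> c"
  shows "l2 I f" "l2n I f \<le> c"
proof -
  have le: "(\<Sum>i\<in>F. (norm (f i))\<^sup>2) \<le> c\<^sup>2" if "finite F" "F \<subseteq> I" for F
  proof -
    have "(L2_set (\<lambda>i. norm (f i)) F)\<^sup>2 \<le> c\<^sup>2" using assms that by (intro power_mono) auto
    then show ?thesis by (simp add: L2_set_def sum_nonneg)
  qed
  note * = summable_on_nonneg_boundI[OF _ le]
  show "l2 I f" unfolding l2_def by (rule *(1)) auto
  have "infsum (\<lambda>i. (norm (f i))\<^sup>2) I \<le> c\<^sup>2" by (rule *(2)) auto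
  then show "l2n I f \<le> c" unfolding l2n_def using assms(2) by (simp add: real_le_lsqrt)
qed

lemma L2_set_le_l2n:
  assumes "l2 I f" "finite F" "F \<subseteq> I"
  shows "L2_set (\<lambda>i. norm (f i)) F \<le> l2n I f"
  unfolding L2_set_def l2n_def real_sqrt_le_iff
  using assms by (intro finite_sum_le_infsum) (auto simp: l2_def)

lemma l2_add:
  assumes "l2 I f" "l2 I g"
  shows "l2 I (\<lambda>i. f i + g i)" "l2n I (\<lambda>i. f i + g i) \<le> l2n I f + l2n I g"
proof -
  have "L2_set (\<lambda>i. norm (f i + g i)) F \<le> l2n I f + l2n I g" if "finite F" "F \<subseteq> I" for F
  proof -
    have "L2_set (\<lambda>i. norm (f i + g i)) F \<le> L2_set (\<lambda>i. norm (f i) + norm (g i)) F"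
      by (intro L2_set_mono norm_triangle_ineq) auto
    also have "\<dots> \<le> L2_set (\<lambda>i. norm (f i)) F + L2_set (\<lambda>i. norm (g i)) F"
      by (rule L2_set_triangle_ineq)
    also have "\<dots> \<le> l2n I f + l2n I g"
      using assms that by (intro add_mono L2_set_le_l2n)
    finally show ?thesis .
  qed
  then show "l2 I (\<lambda>i. f i + g i)" "l2n I (\<lambda>i. f i + g i) \<le> l2n I f + l2n I g"
    by (rule l2_boundI; simp)+
qed

lemma l2_uminus: "l2 I (\<lambda>i. - f i) \<longleftrightarrow> l2 I f" "l2n I (\<lambda>i. - f i) = l2n I f"
  by (simp_all add: l2_def l2n_def)

lemma l2_diff:
  assumes "l2 I f" "l2 I g"
  shows "l2 I (\<lambda>i. f i - g i)" "l2n I (\<lambda>i. f i - g i) \<le> l2n I f + l2n I g"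
  using l2_add[OF assms(1) l2_uminus(1)[THEN iffD2, OF assms(2)]] by (simp_all add: l2_uminus)

lemma l2n_commute: "l2n I (\<lambda>i. f i - g i) = l2n I (\<lambda>i. g i - f i)"
  by (simp add: l2n_def norm_minus_commute)

lemma l2n_triangle:
  assumes "l2 I f" "l2 I g" "l2 I h"
  shows "l2n I (\<lambda>i. f i - h i) \<le> l2n I (\<lambda>i. f i - g i) + l2n I (\<lambda>i. g i - h i)"
  using l2_add(2)[OF l2_diff(1)[OF assms(1,2)] l2_diff(1)[OF assms(2,3)]] by simp

lemma l2_zero [simp]: "l2 I (\<lambda>i. 0)" "l2n I (\<lambda>i. 0) = 0"
  by (simp_all add: l2_def l2n_def)

lemma l2_subset: "l2 I f \<Longrightarrow> J \<subseteq> I \<Longrightarrow> l2 J f"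
  unfolding l2_def by (rule summable_on_subset_banach)

lemma l2_sum: "(\<And>k. k \<in> A \<Longrightarrow> l2 I (f k)) \<Longrightarrow> l2 I (\<lambda>i. \<Sum>k\<in>A. f k i)"
  by (induction A rule: infinite_finite_induct) (auto intro: l2_add(1))

lemma mult_le_sum_squares: "0 \<le> a \<Longrightarrow> 0 \<le> b \<Longrightarrow> a * b \<le> a\<^sup>2 + b\<^sup>2" for a b :: real
  using sum_squares_bound[of a b] mult_nonneg_nonneg[of a b] by linarith

lemma l2_cinner_summable:
  assumes "l2 I f" "l2 I g"
  shows "(\<lambda>i. norm (cinner (f i) (g i))) summable_on I"
proof (rule summable_on_comparison_test)
  show "(\<lambda>i. (norm (f i))\<^sup>2 + (norm (g i))\<^sup>2) summable_on I"
    using assms by (intro summable_on_add) (auto simp: l2_def)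
  show "norm (cinner (f i) (g i)) \<le> (norm (f i))\<^sup>2 + (norm (g i))\<^sup>2" for i
    by (rule order.trans[OF cmod_cinner_le mult_le_sum_squares]) simp_all
qed simp

lemma l2_cinner_has_sum:
  "l2 I f \<Longrightarrow> l2 I g \<Longrightarrow> ((\<lambda>i. cinner (f i) (g i)) has_sum (\<Sum>\<^sub>\<infinity>i\<in>I. cinner (f i) (g i))) I"
  using Infinite_Sum.abs_summable_summable[OF l2_cinner_summable] by (rule has_sum_infsum)

lemma l2n_square_cinner:
  assumes "l2 I f"
  shows "(\<Sum>\<^sub>\<infinity>i\<in>I. cinner (f i) (f i)) = of_real ((l2n I f)\<^sup>2)"
proof -
  have "((\<lambda>i. (norm (f i))\<^sup>2) has_sum (l2n I f)\<^sup>2) I"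
    unfolding l2n_square using assms by (simp add: l2_def)
  then have "((\<lambda>i. cinner (f i) (f i)) has_sum of_real ((l2n I f)\<^sup>2)) I"
    unfolding cinner_self by (rule has_sum_of_real)
  then show ?thesis by (rule infsumI)
qed


section \<open>Row contractions\<close>

text \<open>The finite form of contractivity of a row, free of adjoints and of infinite sums. In
  this form it passes to subsets and to products; \<open>row_contraction_iff_sot_sum\<close>
  translates it to and from the condition on the strong sum.\<close>

definition row_contraction :: "'i set \<Rightarrow> ('i \<Rightarrow> ('h::chilbert_space \<Rightarrow>\<^sub>L 'h)) \<Rightarrow> bool" where
  "row_contraction I W \<longleftrightarrow> (\<forall>i\<in>I. W i \<in> BH) \<and>
     (\<forall>F h. finite F \<longrightarrow> F \<subseteq> I \<longrightarrow>
        norm (\<Sum>i\<in>F. W i (h i)) \<le> L2_set (\<lambda>i. norm (h i)) F)"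

definition rowop :: "'i set \<Rightarrow> ('i \<Rightarrow> ('h::chilbert_space \<Rightarrow>\<^sub>L 'h)) \<Rightarrow> ('i \<Rightarrow> 'h) \<Rightarrow> 'h" where
  "rowop I W f = (\<Sum>\<^sub>\<infinity>i\<in>I. W i (f i))"

lemma row_contractionD:
  "row_contraction I W \<Longrightarrow> finite F \<Longrightarrow> F \<subseteq> I \<Longrightarrow>
     norm (\<Sum>i\<in>F. W i (h i)) \<le> L2_set (\<lambda>i. norm (h i)) F"
  by (simp add: row_contraction_def)

lemma row_contraction_BH: "row_contraction I W \<Longrightarrow> i \<in> I \<Longrightarrow> W i \<in> BH"
  by (simp add: row_contraction_def)

lemma row_contraction_subset: "row_contraction I W \<Longrightarrow> J \<subseteq> I \<Longrightarrow> row_contraction J W"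
  by (auto simp: row_contraction_def)

text \<open>The finite estimate bounds each block of the series by the corresponding block of the
  square-summable family, whose tails are small.\<close>

lemma rowop_has_sum:
  assumes W: "row_contraction I W" and f: "l2 I f"
  shows "((\<lambda>i. W i (f i)) has_sum rowop I W f) I"
proof -
  have "(\<lambda>i. W i (f i)) summable_on I"
  proof (rule summable_on_CauchyI)
    fix e :: real assume e: "e > 0"
    obtain F0 where F0: "finite F0" "F0 \<subseteq> I"
      and tail: "(\<Sum>\<^sub>\<infinity>i\<in>I - F0. (norm (f i))\<^sup>2) < e\<^sup>2"
      using summable_on_small_tail[of "\<lambda>i. (norm (f i))\<^sup>2" I "e\<^sup>2"] f e by (auto simp: l2_def)
    have "norm (\<Sum>i\<in>F. W i (f i)) < e" if "finite F" "F \<subseteq> I - F0" for F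
    proof -
      have "norm (\<Sum>i\<in>F. W i (f i)) \<le> L2_set (\<lambda>i. norm (f i)) F"
        using that by (intro row_contractionD[OF W]) auto
      also have "\<dots> \<le> l2n (I - F0) f"
        using that l2_subset[OF f, of "I - F0"] by (intro L2_set_le_l2n) auto
      also have "\<dots> < e" unfolding l2n_def using tail e
        by (metis real_sqrt_less_mono real_sqrt_abs abs_of_pos)
      finally show ?thesis .
    qed
    then show "\<exists>F0. finite F0 \<and> F0 \<subseteq> I \<and> (\<forall>F. finite F \<longrightarrow> F \<subseteq> I - F0 \<longrightarrow>
                 norm (\<Sum>i\<in>F. W i (f i)) < e)"
      using F0 by blast
  qed
  then show ?thesis unfolding rowop_def by simp
qed

lemma norm_rowop_le:
  assumes "row_contraction I W" "l2 I f"
  shows "norm (rowop I W f) \<le> l2n I f"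
proof -
  have "((\<lambda>F. \<Sum>i\<in>F. W i (f i)) \<longlongrightarrow> rowop I W f) (finite_subsets_at_top I)"
    using rowop_has_sum[OF assms] by (simp add: has_sum_def)
  then have lim: "((\<lambda>F. norm (\<Sum>i\<in>F. W i (f i))) \<longlongrightarrow> norm (rowop I W f)) (finite_subsets_at_top I)"
    by (rule tendsto_norm)
  show ?thesis
    by (rule tendsto_upperbound[OF lim])
      (auto intro!: eventually_finite_subsets_at_top_weakI
        order.trans[OF row_contractionD[OF assms(1)] L2_set_le_l2n[OF assms(2)]])
qed

lemma rowop_add:
  assumes "row_contraction I W" "l2 I f" "l2 I g"
  shows "rowop I W (\<lambda>i. f i + g i) = rowop I W f + rowop I W g"
  unfolding rowop_def[of _ _ "\<lambda>i. f i + g i"]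
  by (rule infsumI) (simp add: blinfun.add_right has_sum_add rowop_has_sum assms)

lemma rowop_diff:
  assumes "row_contraction I W" "l2 I f" "l2 I g"
  shows "rowop I W (\<lambda>i. f i - g i) = rowop I W f - rowop I W g"
  using rowop_add[OF assms(1) l2_diff(1)[OF assms(2,3)] assms(3)] by (simp add: algebra_simps)

lemma rowop_scaleC:
  assumes "row_contraction I W" "l2 I f"
  shows "rowop I W (\<lambda>i. c *\<^sub>C f i) = c *\<^sub>C rowop I W f"
  unfolding rowop_def[of _ _ "\<lambda>i. c *\<^sub>C f i"]
proof (rule infsumI)
  have "((\<lambda>i. c *\<^sub>C W i (f i)) has_sum c *\<^sub>C rowop I W f) I"
    by (rule has_sum_bounded_linear[OF scaleC.bounded_linear_right rowop_has_sum[OF assms]])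
  then show "((\<lambda>i. W i (c *\<^sub>C f i)) has_sum c *\<^sub>C rowop I W f) I"
    by (subst has_sum_cong[where g = "\<lambda>i. c *\<^sub>C W i (f i)"])
      (simp_all add: BH_scaleC row_contraction_BH[OF assms(1)])
qed

lemma rowop_sum:
  assumes W: "row_contraction I W"
  shows "finite A \<Longrightarrow> (\<And>k. k \<in> A \<Longrightarrow> l2 I (f k)) \<Longrightarrow>
    rowop I W (\<lambda>i. \<Sum>k\<in>A. f k i) = (\<Sum>k\<in>A. rowop I W (f k))"
proof (induction A rule: finite_induct)
  case empty
  then show ?case by (simp add: rowop_def blinfun.zero_right)
next
  case (insert a A)
  then show ?case by (simp add: rowop_add[OF W] l2_sum)
qed

text \<open>The adjoint of a contraction is a contraction: if \<open>s\<close> is the left side,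
  then \<open>s\<^sup>2\<close> is the inner product of \<open>h\<close> with the row applied to its
  own adjoint coordinates, hence at most \<open>norm h * s\<close>.\<close>

lemma row_contraction_adjoint_le:
  assumes W: "row_contraction I W" and F: "finite F" "F \<subseteq> I"
  shows "L2_set (\<lambda>i. norm (cadj (W i) h)) F \<le> norm h"
proof -
  define f where "f i = cadj (W i) h" for i
  define s where "s = L2_set (\<lambda>i. norm (f i)) F"
  have "complex_of_real (s\<^sup>2) = (\<Sum>i\<in>F. cinner (f i) (f i))"
    by (simp add: s_def L2_set_def sum_nonneg cinner_self)
  also have "\<dots> = (\<Sum>i\<in>F. cinner h (W i (f i)))"
    using F by (intro sum.cong refl) (auto simp: f_def cinner_cadj_left row_contraction_BH[OF W])
  also have "\<dots> = cinner h (\<Sum>i\<in>F. W i (f i))"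
    by (simp add: cinner.sum_right)
  finally have "cmod (complex_of_real (s\<^sup>2)) \<le> norm h * norm (\<Sum>i\<in>F. W i (f i))"
    using cmod_cinner_le by metis
  also have "\<dots> \<le> norm h * s"
    unfolding s_def by (intro mult_left_mono row_contractionD[OF W F]) simp
  finally have "s * s \<le> norm h * s" by (simp add: power2_eq_square norm_mult)
  moreover have "s \<ge> 0" by (simp add: s_def)
  ultimately have "s \<le> norm h" by (cases "s = 0") auto
  then show ?thesis by (simp add: s_def f_def)
qed

text \<open>Writing R for the row operator, this says that R is a contraction exactly if R R* is at
  most I. In one direction S is R R*, and \<open>cinner h (S h)\<close> is the squared norm of R* h.
  In the other, testing the strong sum against \<open>k\<close> bounds the adjoint coordinates by
  \<open>norm k\<close>, and Cauchy-Schwarz carries the bound back to R.\<close>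

lemma row_contraction_iff_sot_sum:
  assumes BH: "\<And>i. i \<in> I \<Longrightarrow> W i \<in> BH"
  shows "row_contraction I W \<longleftrightarrow>
    (\<exists>S\<in>BH. has_sot_sum (\<lambda>i. W i o\<^sub>L cadj (W i)) S I \<and> op_le S id_blinfun)" (is "_ \<longleftrightarrow> ?R")
proof
  assume W: "row_contraction I W"
  define f where "f h i = cadj (W i) h" for h i
  have f: "l2 I (f h)" "l2n I (f h) \<le> norm h" for h
    using l2_boundI[of I "f h" "norm h"] row_contraction_adjoint_le[OF W, of _ h] by (auto simp: f_def)
  have "\<exists>S\<in>BH. blinfun_apply S = (\<lambda>h. rowop I W (f h))"
  proof (rule BH_I)
    show "rowop I W (f (h + k)) = rowop I W (f h) + rowop I W (f k)" for h k
    proof -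
      have "f (h + k) = (\<lambda>i. f h i + f k i)" by (simp add: f_def fun_eq_iff blinfun.add_right)
      then show ?thesis using rowop_add[OF W f(1)[of h] f(1)[of k]] by simp
    qed
    show "rowop I W (f (c *\<^sub>C h)) = c *\<^sub>C rowop I W (f h)" for c h
    proof -
      have "rowop I W (f (c *\<^sub>C h)) = rowop I W (\<lambda>i. c *\<^sub>C f h i)"
        unfolding rowop_def by (rule infsum_cong) (simp add: f_def BH_scaleC cadj_in_BH BH)
      then show ?thesis using rowop_scaleC[OF W f(1)[of h]] by simp
    qed
    show "norm (rowop I W (f h)) \<le> norm h * 1" for h
      using norm_rowop_le[OF W f(1)[of h]] f(2)[of h] by simp
  qed
  then obtain S where S: "S \<in> BH" "blinfun_apply S = (\<lambda>h. rowop I W (f h))" by blast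
  have "has_sot_sum (\<lambda>i. W i o\<^sub>L cadj (W i)) S I"
    using rowop_has_sum[OF W f(1)] by (simp add: has_sot_sum_def S f_def)
  moreover have "op_le S id_blinfun"
    unfolding op_le_def
  proof (intro allI)
    fix h
    have "((\<lambda>i. cinner h (W i (f h i))) has_sum cinner h (rowop I W (f h))) I"
      by (rule has_sum_bounded_linear[OF cinner.bounded_linear_right rowop_has_sum[OF W f(1)]])
    then have "((\<lambda>i. cinner (f h i) (f h i)) has_sum cinner h (rowop I W (f h))) I"
      by (subst has_sum_cong[where g = "\<lambda>i. cinner h (W i (f h i))"])
        (simp_all add: f_def cinner_cadj_left BH)
    then have "cinner h (rowop I W (f h)) = of_real ((l2n I (f h))\<^sup>2)"
      using l2n_square_cinner[OF f(1)[of h]] by (metis infsumI)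
    then have "cinner h (blinfun_apply (id_blinfun - S) h) = of_real ((norm h)\<^sup>2 - (l2n I (f h))\<^sup>2)"
      by (simp add: blinfun.diff_left S cinner_diff_right cinner_self)
    moreover have "(l2n I (f h))\<^sup>2 \<le> (norm h)\<^sup>2" using f(2)[of h] by (intro power_mono) auto
    ultimately show "cinner h (blinfun_apply (id_blinfun - S) h) \<in> \<real> \<and>
        0 \<le> Re (cinner h (blinfun_apply (id_blinfun - S) h))"
      by simp
  qed
  ultimately show ?R using S(1) by blast
next
  assume ?R
  then obtain S where S: "S \<in> BH" "has_sot_sum (\<lambda>i. W i o\<^sub>L cadj (W i)) S I" "op_le S id_blinfun"
    by blast
  have adj: "L2_set (\<lambda>i. norm (cadj (W i) k)) F \<le> norm k"
    if F: "finite F" "F \<subseteq> I" for F k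
  proof -
    have "((\<lambda>i. Re (cinner k (W i (cadj (W i) k)))) has_sum
        Re (cinner k (blinfun_apply S k))) I"
      using S(2) has_sum_bounded_linear[OF cinner.bounded_linear_right] by (force simp: has_sot_sum_def intro!: has_sum_Re)
    then have "((\<lambda>i. (norm (cadj (W i) k))\<^sup>2) has_sum Re (cinner k (blinfun_apply S k))) I"
      by (subst has_sum_cong[where g = "\<lambda>i. Re (cinner k (W i (cadj (W i) k)))"])
        (simp_all add: BH cinner_self flip: cinner_cadj_left)
    then have "(\<Sum>i\<in>F. (norm (cadj (W i) k))\<^sup>2) \<le> Re (cinner k (blinfun_apply S k))"
      using F by (intro finite_sum_le_has_sum) auto
    also have "\<dots> \<le> (norm k)\<^sup>2"
      using S(3) by (auto simp: op_le_def blinfun.diff_left cinner_diff_right cinner_self)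
    finally show ?thesis by (simp add: L2_set_def real_le_lsqrt)
  qed
  have "norm (\<Sum>i\<in>F. W i (h i)) \<le> L2_set (\<lambda>i. norm (h i)) F"
    if F: "finite F" "F \<subseteq> I" for F h
  proof (rule norm_le_cinnerI)
    fix k
    have "cmod (cinner k (\<Sum>i\<in>F. W i (h i))) =
        cmod (\<Sum>i\<in>F. cinner (cadj (W i) k) (h i))"
      unfolding cinner.sum_right using F
      by (intro arg_cong[where f = cmod] sum.cong) (auto simp: cinner_cadj_left BH)
    also have "\<dots> \<le> (\<Sum>i\<in>F. \<bar>norm (cadj (W i) k)\<bar> * \<bar>norm (h i)\<bar>)"
      by (rule order.trans[OF norm_sum]) (auto intro!: sum_mono cmod_cinner_le)
    also have "\<dots> \<le> L2_set (\<lambda>i. norm (cadj (W i) k)) F * L2_set (\<lambda>i. norm (h i)) F"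
      by (rule L2_set_mult_ineq)
    also have "\<dots> \<le> norm k * L2_set (\<lambda>i. norm (h i)) F"
      by (intro mult_right_mono adj F) simp
    finally show "cmod (cinner k (\<Sum>i\<in>F. W i (h i))) \<le> L2_set (\<lambda>i. norm (h i)) F * norm k"
      by (simp add: mult.commute)
  qed simp
  then show "row_contraction I W" using BH by (simp add: row_contraction_def)
qed


section \<open>Kernels given by square-summable families\<close>

definition lsum :: "('g \<Rightarrow> 'i \<Rightarrow> 'h::comm_monoid_add) \<Rightarrow> 'g list \<Rightarrow> 'i \<Rightarrow> 'h" where
  "lsum \<phi> u i = (\<Sum>g\<leftarrow>u. \<phi> g i)"

lemma lsum_simps [simp]: "lsum \<phi> [] i = 0" "lsum \<phi> (g # u) i = \<phi> g i + lsum \<phi> u i"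
  "lsum \<phi> (u @ v) i = lsum \<phi> u i + lsum \<phi> v i"
  by (simp_all add: lsum_def)

text \<open>A realisation of the positive semidefinite kernel \<open>K\<close> as a Gram kernel of
  square-summable families. The map from formal sums to families preserves inner products and
  identifies vectors at distance zero, so statements about \<open>kcompletion\<close> reduce to
  statements about families, whether or not the image is dense.\<close>

locale l2_kernel =
  fixes G :: "'g set" and K :: "'g \<Rightarrow> 'g \<Rightarrow> complex" and I :: "'i set"
    and \<phi> :: "'g \<Rightarrow> 'i \<Rightarrow> 'h::chilbert_space"
  assumes l2_gen: "g \<in> G \<Longrightarrow> l2 I (\<phi> g)"
    and kernel: "g \<in> G \<Longrightarrow> g' \<in> G \<Longrightarrow> K g g' = (\<Sum>\<^sub>\<infinity>i\<in>I. cinner (\<phi> g i) (\<phi> g' i))"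
begin

lemma l2_lsum: "set u \<subseteq> G \<Longrightarrow> l2 I (lsum \<phi> u)"
proof (induction u)
  case Nil
  then show ?case by (simp add: lsum_def[abs_def])
next
  case (Cons g u)
  then have "l2 I (\<lambda>i. \<phi> g i + lsum \<phi> u i)" by (intro l2_add(1)) (auto intro: l2_gen)
  then show ?case by (simp add: fun_eq_iff l2_def)
qed

lemma ksum_inner_eq:
  assumes "set u \<subseteq> G" "set v \<subseteq> G"
  shows "ksum_inner K u v = (\<Sum>\<^sub>\<infinity>i\<in>I. cinner (lsum \<phi> u i) (lsum \<phi> v i))"
proof -
  have 1: "(\<Sum>g'\<leftarrow>v. K g g') = (\<Sum>\<^sub>\<infinity>i\<in>I. cinner (\<phi> g i) (lsum \<phi> v i))"
    if "g \<in> G" "set v \<subseteq> G" for g v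
    using that
  proof (induction v)
    case (Cons g' v)
    have "((\<lambda>i. cinner (\<phi> g i) (\<phi> g' i) + cinner (\<phi> g i) (lsum \<phi> v i)) has_sum
        (\<Sum>\<^sub>\<infinity>i\<in>I. cinner (\<phi> g i) (\<phi> g' i)) + (\<Sum>\<^sub>\<infinity>i\<in>I. cinner (\<phi> g i) (lsum \<phi> v i))) I"
      using Cons.prems by (intro has_sum_add l2_cinner_has_sum l2_gen l2_lsum) auto
    then show ?case using Cons by (simp add: cinner_add_right kernel infsumI)
  qed simp
  show ?thesis using assms(1)
  proof (induction u)
    case (Cons g u)
    have "((\<lambda>i. cinner (\<phi> g i) (lsum \<phi> v i) + cinner (lsum \<phi> u i) (lsum \<phi> v i)) has_sum
        (\<Sum>\<^sub>\<infinity>i\<in>I. cinner (\<phi> g i) (lsum \<phi> v i)) + (\<Sum>\<^sub>\<infinity>i\<in>I. cinner (lsum \<phi> u i) (lsum \<phi> v i))) I"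
      using Cons.prems assms(2) by (intro has_sum_add l2_cinner_has_sum l2_gen l2_lsum) auto
    then show ?case using Cons assms(2)
      by (simp add: cinner_add_left ksum_inner_def 1 infsumI)
  qed (simp add: ksum_inner_def)
qed

lemma ksum_dist_eq:
  assumes "set u \<subseteq> G" "set v \<subseteq> G"
  shows "ksum_dist K u v = l2n I (\<lambda>i. lsum \<phi> u i - lsum \<phi> v i)"
proof -
  let ?u = "lsum \<phi> u" and ?v = "lsum \<phi> v"
  note l2 = l2_lsum[OF assms(1)] l2_lsum[OF assms(2)]
  have "((\<lambda>i. cinner (?u i) (?u i) - cinner (?u i) (?v i) - cinner (?v i) (?u i) + cinner (?v i) (?v i))
      has_sum (ksum_inner K u u - ksum_inner K u v - ksum_inner K v u + ksum_inner K v v)) I"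
    unfolding ksum_inner_eq[OF assms(1) assms(1)] ksum_inner_eq[OF assms(1) assms(2)]
      ksum_inner_eq[OF assms(2) assms(1)] ksum_inner_eq[OF assms(2) assms(2)]
    by (rule has_sum_add[OF has_sum_diff[OF has_sum_diff]]; rule l2_cinner_has_sum[OF l2(1) l2(1)]
        l2_cinner_has_sum[OF l2(1) l2(2)] l2_cinner_has_sum[OF l2(2) l2(1)] l2_cinner_has_sum[OF l2(2) l2(2)])
  then have "((\<lambda>i. cinner (?u i - ?v i) (?u i - ?v i))
      has_sum (ksum_inner K u u - ksum_inner K u v - ksum_inner K v u + ksum_inner K v v)) I"
    by (simp add: cinner_diff_left cinner_diff_right algebra_simps)
  from infsumI[OF this]
  have "ksum_inner K u u - ksum_inner K u v - ksum_inner K v u + ksum_inner K v v =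
      of_real ((l2n I (\<lambda>i. ?u i - ?v i))\<^sup>2)"
    unfolding l2n_square_cinner[OF l2_diff(1)[OF l2]] by (rule sym)
  then show ?thesis by (simp only: ksum_dist_def Re_complex_of_real real_sqrt_abs abs_of_nonneg l2n_nonneg)
qed

lemma ksum_dist_self: "set u \<subseteq> G \<Longrightarrow> ksum_dist K u u = 0"
  by (simp add: ksum_dist_eq)

lemma ksum_dist_nonneg: "set u \<subseteq> G \<Longrightarrow> set v \<subseteq> G \<Longrightarrow> 0 \<le> ksum_dist K u v"
  by (simp add: ksum_dist_eq)

lemma ksum_dist_commute: "set u \<subseteq> G \<Longrightarrow> set v \<subseteq> G \<Longrightarrow> ksum_dist K u v = ksum_dist K v u"
  using l2n_commute[of I "lsum \<phi> u" "lsum \<phi> v"] by (simp add: ksum_dist_eq)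

lemma ksum_dist_triangle:
  "set u \<subseteq> G \<Longrightarrow> set v \<subseteq> G \<Longrightarrow> set w \<subseteq> G \<Longrightarrow>
     ksum_dist K u w \<le> ksum_dist K u v + ksum_dist K v w"
  using l2n_triangle[OF l2_lsum l2_lsum l2_lsum, of u v w] by (simp add: ksum_dist_eq)

lemma kequiv_refl: "X \<in> kcauchy G K \<Longrightarrow> (X, X) \<in> kequiv G K"
  by (simp add: kequiv_def kcauchy_def ksum_dist_self)

lemma kcauchy_const: "set u \<subseteq> G \<Longrightarrow> (\<lambda>p. u) \<in> kcauchy G K"
  by (simp add: kcauchy_def ksum_dist_self)

lemma kcauchy_set: "X \<in> kcauchy G K \<Longrightarrow> set (X p) \<subseteq> G"
  by (simp add: kcauchy_def)

lemma ksum_dist_tendsto_trans: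
  assumes set: "\<And>p. set (X p) \<subseteq> G" "\<And>p. set (Y p) \<subseteq> G" "\<And>p. set (Z p) \<subseteq> G"
    and XY: "(\<lambda>p. ksum_dist K (X p) (Y p)) \<longlonglongrightarrow> 0" and XZ: "(\<lambda>p. ksum_dist K (X p) (Z p)) \<longlonglongrightarrow> 0"
  shows "(\<lambda>p. ksum_dist K (Y p) (Z p)) \<longlonglongrightarrow> 0"
proof (rule tendsto_sandwich[OF _ _ tendsto_const])
  show "\<forall>\<^sub>F p in sequentially. ksum_dist K (Y p) (Z p) \<le> ksum_dist K (X p) (Y p) + ksum_dist K (X p) (Z p)"
    using ksum_dist_triangle[OF set(2,1,3)] ksum_dist_commute[OF set(2,1)] by simp
  show "(\<lambda>p. ksum_dist K (X p) (Y p) + ksum_dist K (X p) (Z p)) \<longlonglongrightarrow> 0"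
    using tendsto_add[OF XY XZ] by simp
qed (simp add: ksum_dist_nonneg[OF set(2,3)])

lemma kcompletion_nonempty: "C \<in> kcompletion G K \<Longrightarrow> \<exists>X. X \<in> C"
  using kequiv_refl by (auto simp: kcompletion_def quotient_def Image_def)

lemma kcompletion_dist:
  assumes C: "C \<in> kcompletion G K" "Y \<in> C" "Z \<in> C"
  shows "Y \<in> kcauchy G K" "(\<lambda>p. ksum_dist K (Y p) (Z p)) \<longlonglongrightarrow> 0"
proof -
  obtain X where X: "X \<in> kcauchy G K" "C = kequiv G K `` {X}"
    using C(1) by (auto simp: kcompletion_def quotient_def)
  show Y: "Y \<in> kcauchy G K" using X C(2) by (simp add: kequiv_def)
  have "Z \<in> kcauchy G K" using X C(3) by (simp add: kequiv_def)
  then show "(\<lambda>p. ksum_dist K (Y p) (Z p)) \<longlonglongrightarrow> 0"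
    using X(2) C(2,3) by (intro ksum_dist_tendsto_trans[OF kcauchy_set[OF X(1)] kcauchy_set[OF Y] kcauchy_set])
      (simp_all add: kequiv_def)
qed

lemma kcauchy_approx:
  assumes X: "X \<in> kcauchy G K" and Y: "\<And>p. set (Y p) \<subseteq> G"
    and lim: "(\<lambda>p. ksum_dist K (X p) (Y p)) \<longlonglongrightarrow> 0"
  shows "Y \<in> kcauchy G K"
  unfolding kcauchy_def
proof (intro CollectI conjI allI impI)
  fix e :: real assume e: "e > 0"
  have "\<forall>\<epsilon>>0. \<exists>M. \<forall>p\<ge>M. \<forall>q\<ge>M. ksum_dist K (X p) (X q) < \<epsilon>"
    using X by (simp add: kcauchy_def)
  from this[rule_format, of "e / 3"] e
  obtain M1 where M1: "\<And>p q. p \<ge> M1 \<Longrightarrow> q \<ge> M1 \<Longrightarrow> ksum_dist K (X p) (X q) < e / 3"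
    by auto
  have "\<forall>\<^sub>F p in sequentially. ksum_dist K (X p) (Y p) < e / 3"
    using lim e by (intro order_tendstoD(2)) auto
  then obtain M2 where M2: "\<And>p. p \<ge> M2 \<Longrightarrow> ksum_dist K (X p) (Y p) < e / 3"
    by (auto simp: eventually_sequentially)
  have "ksum_dist K (Y p) (Y q) < e" if "p \<ge> max M1 M2" "q \<ge> max M1 M2" for p q
  proof -
    note s = Y[of p] Y[of q] kcauchy_set[OF X, of p] kcauchy_set[OF X, of q]
    have "ksum_dist K (Y p) (Y q) \<le> ksum_dist K (Y p) (X p) + (ksum_dist K (X p) (X q) + ksum_dist K (X q) (Y q))"
      using ksum_dist_triangle[of "Y p" "X p" "Y q"] ksum_dist_triangle[of "X p" "X q" "Y q"] s by linarith
    also have "ksum_dist K (Y p) (X p) = ksum_dist K (X p) (Y p)" using s by (intro ksum_dist_commute)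
    finally show ?thesis using M1[of p q] M2[of p] M2[of q] that by simp
  qed
  then show "\<exists>M. \<forall>p\<ge>M. \<forall>q\<ge>M. ksum_dist K (Y p) (Y q) < e" by blast
qed (use Y in auto)

end

lemma tendsto_norm_diff_le:
  fixes a b :: "nat \<Rightarrow> 'b::real_normed_vector"
  assumes "a \<longlonglongrightarrow> v" "c \<longlonglongrightarrow> 0" "\<And>p. norm (a p - b p) \<le> c p"
  shows "b \<longlonglongrightarrow> v"
proof -
  have "(\<lambda>p. a p - b p) \<longlonglongrightarrow> 0"
    by (rule Lim_null_comparison[OF _ assms(2)]) (use assms(3) in auto)
  from tendsto_diff[OF assms(1) this] show ?thesis by simp
qed

text \<open>Nonemptiness makes the description definite: on the empty set every vector would satisfy
  it.\<close>

lemma T_tilde_eqI: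
  assumes "C \<noteq> {}" "\<And>X. X \<in> C \<Longrightarrow> (\<lambda>p. \<Sum>(x, h)\<leftarrow>X p. blinfun_apply (T x) h) \<longlonglongrightarrow> v"
  shows "T_tilde T C = v"
  unfolding T_tilde_def
proof (rule the_equality)
  fix w assume "\<forall>X\<in>C. (\<lambda>p. \<Sum>(x, h)\<leftarrow>X p. blinfun_apply (T x) h) \<longlonglongrightarrow> w"
  then show "w = v" using assms by (metis LIMSEQ_unique all_not_in_conv)
qed (use assms(2) in blast)


section \<open>Operator norms of matrices\<close>

text \<open>A real \<open>Sup\<close> dominates its members only for a set bounded above. The crude
  sum of bounds for the entries is enough.\<close>

lemma matrix_opnorm_bdd:
  fixes n :: nat
  assumes "\<And>i k. i < n \<Longrightarrow> k < n \<Longrightarrow> bounded_linear (A i k)"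
  shows "bdd_above {L2_set (\<lambda>i. norm (\<Sum>k<n. A i k (h k))) {..<n} | h. L2_set (\<lambda>k. norm (h k)) {..<n} \<le> 1}"
proof -
  have "\<exists>B. \<forall>h. norm (A i k h) \<le> norm h * B \<and> 0 \<le> B" if "i < n" "k < n" for i k
    using bounded_linear.nonneg_bounded[OF assms[OF that]] by blast
  then obtain B where B: "\<And>i k h. i < n \<Longrightarrow> k < n \<Longrightarrow> norm (A i k h) \<le> norm h * B i k"
      "\<And>i k. i < n \<Longrightarrow> k < n \<Longrightarrow> 0 \<le> B i k" by metis
  have "L2_set (\<lambda>i. norm (\<Sum>k<n. A i k (h k))) {..<n} \<le> (\<Sum>i<n. \<Sum>k<n. B i k)"
    if "L2_set (\<lambda>k. norm (h k)) {..<n} \<le> 1" for h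
  proof -
    have h: "norm (h k) \<le> 1" if "k < n" for k
      by (rule order.trans[OF member_le_L2_set[of "{..<n}"] \<open>L2_set (\<lambda>k. norm (h k)) {..<n} \<le> 1\<close>])
        (use that in auto)
    have "norm (A i k (h k)) \<le> B i k" if "i < n" "k < n" for i k
      using B(1)[OF that, of "h k"] mult_right_mono[OF h[OF that(2)] B(2)[OF that]] by simp
    then have "(\<Sum>i<n. norm (\<Sum>k<n. A i k (h k))) \<le> (\<Sum>i<n. \<Sum>k<n. B i k)"
      by (intro sum_mono order.trans[OF norm_sum] sum_mono) auto
    then show ?thesis using L2_set_le_sum[of "{..<n}" "\<lambda>i. norm (\<Sum>k<n. A i k (h k))"] by simp
  qed
  then show ?thesis by (intro bdd_aboveI) blast
qed

lemma matrix_opnorm_le: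
  assumes "\<And>h. L2_set (\<lambda>k. norm (h k)) {..<n} \<le> 1 \<Longrightarrow>
             L2_set (\<lambda>i. norm (\<Sum>k<n. A i k (h k))) {..<n} \<le> c"
  shows "matrix_opnorm n A \<le> c"
  unfolding matrix_opnorm_def
proof (rule cSup_least)
  show "{L2_set (\<lambda>i. norm (\<Sum>k<n. A i k (h k))) {..<n} | h. L2_set (\<lambda>k. norm (h k)) {..<n} \<le> 1} \<noteq> {}"
    by (auto intro!: exI[of _ "\<lambda>_. 0"] simp: L2_set_def)
qed (use assms in auto)

lemma matrix_opnorm_bound:
  assumes A: "\<And>i k. i < n \<Longrightarrow> k < n \<Longrightarrow> bounded_linear (A i k)"
  shows "L2_set (\<lambda>i. norm (\<Sum>k<n. A i k (h k))) {..<n} \<le> matrix_opnorm n A * L2_set (\<lambda>k. norm (h k)) {..<n}"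
proof (cases "L2_set (\<lambda>k. norm (h k)) {..<n} = 0")
  case True
  then have "h k = 0" if "k < n" for k using that by (simp add: L2_set_eq_0_iff)
  then have "(\<Sum>k<n. A i k (h k)) = 0" if "i < n" for i
    using linear_0[OF bounded_linear.linear[OF A[OF that]]] by simp
  then show ?thesis using True by (simp add: L2_set_0')
next
  case False
  define s where "s = L2_set (\<lambda>k. norm (h k)) {..<n}"
  have s: "s > 0" using False by (simp add: s_def less_le)
  have 1: "L2_set (\<lambda>k. norm ((1 / s) *\<^sub>R h k)) {..<n} \<le> 1"
    using s by (simp add: s_def[symmetric] flip: L2_set_right_distrib)
      (simp add: s_def L2_set_left_distrib[symmetric] divide_inverse)
  have "L2_set (\<lambda>i. norm (\<Sum>k<n. A i k ((1 / s) *\<^sub>R h k))) {..<n} \<le> matrix_opnorm n A"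
    unfolding matrix_opnorm_def by (rule cSup_upper[OF _ matrix_opnorm_bdd])
      (use 1 A in \<open>auto intro!: exI[of _ "\<lambda>k. (1 / s) *\<^sub>R h k"]\<close>)
  also have "L2_set (\<lambda>i. norm (\<Sum>k<n. A i k ((1 / s) *\<^sub>R h k))) {..<n} =
      L2_set (\<lambda>i. (1 / s) * norm (\<Sum>k<n. A i k (h k))) {..<n}"
  proof (rule L2_set_cong)
    fix i assume i: "i \<in> {..<n}"
    have "(\<Sum>k<n. A i k ((1 / s) *\<^sub>R h k)) = (1 / s) *\<^sub>R (\<Sum>k<n. A i k (h k))"
      unfolding scaleR_right.sum using i A by (intro sum.cong) (auto simp: linear_scale bounded_linear.linear)
    then show "norm (\<Sum>k<n. A i k ((1 / s) *\<^sub>R h k)) = (1 / s) * norm (\<Sum>k<n. A i k (h k))"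
      using s by simp
  qed simp
  also have "\<dots> = (1 / s) * L2_set (\<lambda>i. norm (\<Sum>k<n. A i k (h k))) {..<n}"
    using s by (subst L2_set_right_distrib) auto
  finally show ?thesis using s by (simp add: divide_simps s_def)
qed

text \<open>One Gram--Schmidt step splits off the direction of the last vector.\<close>

lemma gram_decomposition:
  fixes v :: "nat \<Rightarrow> 'h::chilbert_space"
  shows "\<exists>(c :: nat \<Rightarrow> nat \<Rightarrow> complex). \<forall>k<n. \<forall>k'<n. cinner (v k) (v k') = (\<Sum>j<n. cnj (c j k) * c j k')"
proof (induction n arbitrary: v)
  case (Suc n)
  \<comment> \<open>If \<open>v n = 0\<close>, division by zero gives \<open>e = 0\<close>, and the
    splitting below degenerates to \<open>w = v\<close>.\<close>
  define e where "e = (1 / of_real (norm (v n))) *\<^sub>C v n"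
  define w where "w k = v k - cinner e (v k) *\<^sub>C e" for k
  have wn: "w n = 0"
  proof (cases "v n = 0")
    case False
    then have "cinner e (v n) *\<^sub>C e = v n"
      by (simp add: e_def cinner_scaleC_left cinner_self scaleC_scaleC power2_eq_square)
    then show ?thesis by (simp add: w_def)
  qed (simp add: w_def e_def scaleC.zero_right)
  have ee: "v n = 0 \<or> cinner e e = 1"
    by (simp add: e_def cinner_self norm_scaleC norm_divide)
  have split: "cinner (v k) (v k') = cnj (cinner e (v k)) * cinner e (v k') + cinner (w k) (w k')" for k k'
  proof (cases "v n = 0")
    case True
    then show ?thesis by (simp add: w_def e_def scaleC.zero_right)
  next
    case False
    then have "cinner e e = 1" using ee by simp
    then show ?thesis
      by (simp add: w_def cinner_diff_left cinner_diff_right cinner_scaleC_left cinner_scaleC_right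
          cinner_commute[of "v k" e])
  qed
  obtain c where c: "\<forall>k<n. \<forall>k'<n. cinner (w k) (w k') = (\<Sum>j<n. cnj (c j k) * c j k' :: complex)"
    using Suc.IH by blast
  \<comment> \<open>The direction \<open>e\<close> contributes the new row with index
    \<open>n\<close>. The old rows are extended by zero at the last vector, whose remainder
    \<open>w n\<close> vanishes.\<close>
  define c' where "c' j k = (if j < n then if k < n then c j k else 0 else cinner e (v k))" for j k
  have "cinner (v k) (v k') = (\<Sum>j<Suc n. cnj (c' j k) * c' j k')" if "k < Suc n" "k' < Suc n" for k k'
    using that c wn by (auto simp: split[of k k'] c'_def less_Suc_eq)
  then show ?case by blast
qed simp

text \<open>Passing from a scalar matrix to its action on vectors does not increase the norm. The
  Gram matrix of the vectors is a sum of rank-one matrices by \<open>gram_decomposition\<close>, so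
  the form splits into scalar forms, each bounded by Cauchy-Schwarz and the operator norm.\<close>

lemma matrix_form_le:
  fixes v :: "nat \<Rightarrow> 'h::chilbert_space" and G :: "nat \<Rightarrow> nat \<Rightarrow> complex"
  shows "Re (\<Sum>i<n. \<Sum>k<n. G i k * cinner (v i) (v k)) \<le> matrix_opnorm n (\<lambda>i k z. G i k * z) * (\<Sum>k<n. (norm (v k))\<^sup>2)"
proof -
  let ?m = "matrix_opnorm n (\<lambda>i k z. G i k * z)"
  obtain c where c: "\<And>k k'. k < n \<Longrightarrow> k' < n \<Longrightarrow> cinner (v k) (v k') = (\<Sum>j<n. cnj (c j k) * c j k' :: complex)"
    using gram_decomposition by metis
  have form: "Re (\<Sum>i<n. \<Sum>k<n. G i k * (cnj (z i) * z k)) \<le> ?m * (\<Sum>k<n. (cmod (z k))\<^sup>2)" for z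
  proof -
    have "Re (\<Sum>i<n. \<Sum>k<n. G i k * (cnj (z i) * z k)) \<le> cmod (\<Sum>i<n. cnj (z i) * (\<Sum>k<n. G i k * z k))"
      by (rule order.trans[OF _ complex_Re_le_cmod]) (simp add: sum_distrib_left ac_simps)
    also have "\<dots> \<le> (\<Sum>i<n. \<bar>cmod (z i)\<bar> * \<bar>cmod (\<Sum>k<n. G i k * z k)\<bar>)"
      by (rule order.trans[OF norm_sum]) (simp add: norm_mult)
    also have "\<dots> \<le> L2_set (\<lambda>i. cmod (z i)) {..<n} * L2_set (\<lambda>i. cmod (\<Sum>k<n. G i k * z k)) {..<n}"
      by (rule L2_set_mult_ineq)
    also have "\<dots> \<le> L2_set (\<lambda>i. cmod (z i)) {..<n} * (?m * L2_set (\<lambda>i. cmod (z i)) {..<n})"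
      by (intro mult_left_mono matrix_opnorm_bound bounded_linear_mult_right) simp
    also have "\<dots> = ?m * (L2_set (\<lambda>i. cmod (z i)) {..<n})\<^sup>2" by (simp add: power2_eq_square)
    also have "(L2_set (\<lambda>i. cmod (z i)) {..<n})\<^sup>2 = (\<Sum>k<n. (cmod (z k))\<^sup>2)"
      by (simp add: L2_set_def sum_nonneg)
    finally show ?thesis .
  qed
  have "(\<Sum>i<n. \<Sum>k<n. G i k * cinner (v i) (v k)) = (\<Sum>i<n. \<Sum>k<n. \<Sum>j<n. G i k * (cnj (c j i) * c j k))"
    by (simp add: c sum_distrib_left)
  also have "\<dots> = (\<Sum>i<n. \<Sum>j<n. \<Sum>k<n. G i k * (cnj (c j i) * c j k))"
    by (intro sum.cong refl sum.swap)
  also have "\<dots> = (\<Sum>j<n. \<Sum>i<n. \<Sum>k<n. G i k * (cnj (c j i) * c j k))"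
    by (rule sum.swap)
  finally have "Re (\<Sum>i<n. \<Sum>k<n. G i k * cinner (v i) (v k)) =
      (\<Sum>j<n. Re (\<Sum>i<n. \<Sum>k<n. G i k * (cnj (c j i) * c j k)))" by simp
  also have "\<dots> \<le> (\<Sum>j<n. ?m * (\<Sum>k<n. (cmod (c j k))\<^sup>2))" by (intro sum_mono form)
  also have "\<dots> = ?m * (\<Sum>k<n. \<Sum>j<n. (cmod (c j k))\<^sup>2)"
    unfolding sum_distrib_left[symmetric] by (rule arg_cong[where f = "\<lambda>s. ?m * s"], rule sum.swap)
  also have "(\<Sum>k<n. \<Sum>j<n. (cmod (c j k))\<^sup>2) = (\<Sum>k<n. (norm (v k))\<^sup>2)"
  proof (rule sum.cong[OF refl])
    fix k assume "k \<in> {..<n}"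
    then have "complex_of_real ((norm (v k))\<^sup>2) = (\<Sum>j<n. cnj (c j k) * c j k)"
      using c[of k k] by (simp add: cinner_self)
    also have "\<dots> = complex_of_real (\<Sum>j<n. (cmod (c j k))\<^sup>2)"
      by (simp add: complex_norm_square mult.commute del: of_real_power)
    finally show "(\<Sum>j<n. (cmod (c j k))\<^sup>2) = (norm (v k))\<^sup>2" using of_real_eq_iff by metis
  qed
  finally show ?thesis .
qed

section \<open>Factorisation and the correspondences of a higher-rank graph\<close>

text \<open>The value at \<open>a\<close> of the inner product of \<open>x\<close> with itself, as a
  real number (see \<open>E_inner_self\<close>).\<close>

definition esum :: "('l, 'r::finite) hrgraph \<Rightarrow> nat ^ 'r \<Rightarrow> ('l \<Rightarrow> complex) \<Rightarrow> 'l \<Rightarrow> real" where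
  "esum L n x a = (\<Sum>\<^sub>\<infinity>l\<in>mors_from L n a. (cmod (x l))\<^sup>2)"

definition factor :: "('l, 'r::finite) hrgraph \<Rightarrow> nat ^ 'r \<Rightarrow> nat ^ 'r \<Rightarrow> 'l \<Rightarrow> 'l \<times> 'l" where
  "factor L m n v = (THE p. is_factor L m n v p)"

lemma esum_nonneg [simp]: "0 \<le> esum L n x a"
  by (simp add: esum_def infsum_nonneg)

lemma mors_from_subset: "mors_from L n a \<subseteq> mors L n"
  by (auto simp: mors_from_def)

lemma A0_bounded:
  assumes "f \<in> A0 L" shows "\<exists>c\<ge>0. \<forall>a. cmod (f a) \<le> c"
proof -
  have "\<forall>\<^sub>F a in cofinite. cmod (f a) < 1"
    using assms by (intro order_tendstoD(2)[OF tendsto_norm_zero]) (auto simp: A0_def)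
  then have fin: "finite {a. \<not> cmod (f a) < 1}" by (simp add: eventually_cofinite)
  let ?c = "1 + (\<Sum>a | \<not> cmod (f a) < 1. cmod (f a))"
  have "cmod (f a) \<le> ?c" for a
  proof (cases "cmod (f a) < 1")
    case True
    then show ?thesis using sum_nonneg[of "{a. \<not> cmod (f a) < 1}" "\<lambda>a. cmod (f a)"] by simp
  next
    case False
    then have "cmod (f a) \<le> (\<Sum>a | \<not> cmod (f a) < 1. cmod (f a))"
      using fin by (intro member_le_sum) auto
    then show ?thesis by simp
  qed
  moreover have "0 \<le> ?c" by (simp add: sum_nonneg add_nonneg_nonneg)
  ultimately show ?thesis by blast
qed

context higher_rank_graph
begin

text \<open>A morphism \<open>l\<close> of degree zero factors both as \<open>rng L l\<close> times
  \<open>l\<close> and as \<open>l\<close> times \<open>src L l\<close>; uniqueness of the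
  factorisation makes \<open>l\<close> an object.\<close>

lemma mors_zero: "mors L 0 = obj L"
proof
  show "obj L \<subseteq> mors L 0" using obj_mor deg_id by (auto simp: mors_def)
  show "mors L 0 \<subseteq> obj L"
  proof
    fix l assume "l \<in> mors L 0"
    then have l: "l \<in> mor L" "deg L l = 0" by (auto simp: mors_def)
    have "is_factor L 0 0 l (rng L l, l)" "is_factor L 0 0 l (l, src L l)"
      using l rng_obj src_obj obj_mor deg_id rng_id src_id id_left id_right
      by (auto simp: is_factor_def mors_def)
    then have "(rng L l, l) = (l, src L l)" using factorisation[of l 0 0] l by auto
    then show "l \<in> obj L" using rng_obj[OF l(1)] by auto
  qed
qed

lemma morsD: "l \<in> mors L n \<Longrightarrow> l \<in> mor L" "l \<in> mors L n \<Longrightarrow> deg L l = n"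
  by (auto simp: mors_def)

lemma src_mors: "l \<in> mors L n \<Longrightarrow> src L l \<in> obj L"
  using src_obj by (auto simp: mors_def)

lemma rng_mors: "l \<in> mors L n \<Longrightarrow> rng L l \<in> obj L"
  using rng_obj by (auto simp: mors_def)

lemma cmp_mors: "l \<in> mors L m \<Longrightarrow> k \<in> mors L n \<Longrightarrow> src L l = rng L k \<Longrightarrow> cmp L l k \<in> mors L (m + n)"
  using cmp_mor deg_cmp by (auto simp: mors_def)

lemma is_factor_unique: "is_factor L m n v p \<Longrightarrow> is_factor L m n v q \<Longrightarrow> p = q"
proof -
  assume pq: "is_factor L m n v p" "is_factor L m n v q"
  then have "v \<in> mors L (m + n)" using cmp_mors by (auto simp: is_factor_def)
  then show "p = q" using factorisation[of v m n] pq by (auto simp: mors_def)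
qed

lemma factor_cmp:
  "l \<in> mors L m \<Longrightarrow> k \<in> mors L n \<Longrightarrow> src L l = rng L k \<Longrightarrow> factor L m n (cmp L l k) = (l, k)"
proof -
  assume "l \<in> mors L m" "k \<in> mors L n" "src L l = rng L k"
  then have "is_factor L m n (cmp L l k) (l, k)" by (simp add: is_factor_def)
  then show ?thesis unfolding factor_def by (blast intro: is_factor_unique)
qed

lemma factor_is_factor:
  assumes "v \<in> mors L (m + n)" shows "is_factor L m n v (factor L m n v)"
  unfolding factor_def
proof (rule theI')
  show "\<exists>!p. is_factor L m n v p" using factorisation[of v m n] assms by (auto simp: mors_def)
qed

lemma factor_cases:
  assumes "v \<in> mors L (m + n)"
  obtains l k where "l \<in> mors L m" "k \<in> mors L n" "src L l = rng L k" "v = cmp L l k"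
    "factor L m n v = (l, k)"
  using factor_is_factor[OF assms] factor_cmp by (metis is_factor_def prod.collapse)

definition mors_to :: "nat ^ 'r \<Rightarrow> 'l \<Rightarrow> 'l set" where
  "mors_to n l = {k \<in> mors L n. rng L k = src L l}"

lemma bij_betw_cmp:
  "bij_betw (\<lambda>(l, k). cmp L l k) (SIGMA l:mors L m. mors_to n l) (mors L (m + n))"
proof (rule bij_betw_byWitness[where f' = "factor L m n"])
  show "\<forall>p\<in>SIGMA l:mors L m. mors_to n l. factor L m n (case p of (l, k) \<Rightarrow> cmp L l k) = p"
    using factor_cmp by (auto simp: mors_to_def)
  show "\<forall>v\<in>mors L (m + n). (case factor L m n v of (l, k) \<Rightarrow> cmp L l k) = v"
    by (metis factor_cases case_prod_conv)
  show "(\<lambda>(l, k). cmp L l k) ` (SIGMA l:mors L m. mors_to n l) \<subseteq> mors L (m + n)"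
    using cmp_mors by (auto simp: mors_to_def)
  show "factor L m n ` mors L (m + n) \<subseteq> (SIGMA l:mors L m. mors_to n l)"
  proof
    fix p assume "p \<in> factor L m n ` mors L (m + n)"
    then obtain v where "v \<in> mors L (m + n)" "p = factor L m n v" by blast
    then show "p \<in> (SIGMA l:mors L m. mors_to n l)"
      by (elim factor_cases) (auto simp: mors_to_def)
  qed
qed

text \<open>The finite counterpart of \<open>bij_betw_cmp\<close>. Row estimates concern finite sets
  of paths, and a finite set is fibred here over its own first factors, with finite fibres.\<close>

lemma finite_mors_Sigma:
  assumes F: "finite F" "F \<subseteq> mors L (m + n)"
  obtains K H where "finite K" "K \<subseteq> mors L m" "\<And>l. finite (H l)" "\<And>l. l \<in> K \<Longrightarrow> H l \<subseteq> mors_to n l"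
    "bij_betw (\<lambda>(l, k). cmp L l k) (SIGMA l:K. H l) F"
proof -
  define F' where "F' = factor L m n ` F"
  define K where "K = fst ` F'"
  define H where "H l = {k. (l, k) \<in> F'}" for l
  have F'_mem: "l \<in> mors L m \<and> k \<in> mors_to n l \<and> cmp L l k \<in> F" if lk: "(l, k) \<in> F'" for l k
  proof -
    obtain v where v: "v \<in> F" "factor L m n v = (l, k)" using lk by (auto simp: F'_def)
    then have "v \<in> mors L (m + n)" using F by auto
    then show ?thesis by (cases rule: factor_cases) (use v in \<open>auto simp: mors_to_def\<close>)
  qed
  have fin: "finite F'" using F by (simp add: F'_def)
  have eq: "F' = (SIGMA l:K. H l)" by (force simp: K_def H_def)
  have "bij_betw (\<lambda>(l, k). cmp L l k) F' F"
  proof (rule bij_betw_byWitness[where f' = "factor L m n"])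
    show "\<forall>p\<in>F'. factor L m n (case p of (l, k) \<Rightarrow> cmp L l k) = p"
      using F'_mem factor_cmp by (fastforce simp: mors_to_def)
    show "\<forall>v\<in>F. (case factor L m n v of (l, k) \<Rightarrow> cmp L l k) = v"
      using F by (metis factor_cases case_prod_conv subsetD)
  qed (use F'_mem in \<open>auto simp: F'_def\<close>)
  moreover have "finite (H l)" for l
    by (rule finite_subset[of _ "snd ` F'"]) (use fin in \<open>force simp: H_def\<close>)+
  moreover have "finite K" "K \<subseteq> mors L m" using fin F'_mem by (auto simp: K_def)
  moreover have "H l \<subseteq> mors_to n l" for l using F'_mem by (auto simp: H_def)
  ultimately show ?thesis using that[of K H] eq by simp
qed

section \<open>Function spaces over the paths of one degree\<close>

lemma bij_betw_source: "bij_betw snd (SIGMA a:obj L. mors_from L n a) (mors L n)"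
  by (rule bij_betw_byWitness[where f' = "\<lambda>l. (src L l, l)"]) (auto simp: mors_from_def src_mors)

lemma mors_from_outside: "a \<notin> obj L \<Longrightarrow> mors_from L n a = {}"
  using src_mors by (auto simp: mors_from_def)

lemma mors_from_zero: "a \<in> obj L \<Longrightarrow> mors_from L 0 a = {a}"
  by (auto simp: mors_from_def mors_zero src_id)

lemma esum_outside: "a \<notin> obj L \<Longrightarrow> esum L n x a = 0"
  by (simp add: esum_def mors_from_outside)

lemma E_outside: "x \<in> E L n \<Longrightarrow> l \<notin> mors L n \<Longrightarrow> x l = 0"
  by (simp add: E_def)

lemma E_summable: "x \<in> E L n \<Longrightarrow> (\<lambda>l. (cmod (x l))\<^sup>2) summable_on mors_from L n a"
  by (cases "a \<in> obj L") (auto simp: E_def mors_from_outside)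

lemma E_tendsto: "x \<in> E L n \<Longrightarrow> (esum L n x \<longlongrightarrow> 0) cofinite"
  by (simp add: E_def esum_def[abs_def])

lemma sum_le_esum: "x \<in> E L n \<Longrightarrow> finite F \<Longrightarrow> F \<subseteq> mors_from L n a \<Longrightarrow> (\<Sum>l\<in>F. (cmod (x l))\<^sup>2) \<le> esum L n x a"
  unfolding esum_def by (intro finite_sum_le_infsum E_summable) auto

text \<open>Finite partial sums dominated by a function vanishing at infinity give summability over
  each source and, by squeezing, decay. Membership in \<open>E L n\<close> can thus be proved by
  finite estimates alone.\<close>

lemma E_I:
  assumes out: "\<And>l. l \<notin> mors L n \<Longrightarrow> x l = 0"
    and le: "\<And>a F. a \<in> obj L \<Longrightarrow> finite F \<Longrightarrow> F \<subseteq> mors_from L n a \<Longrightarrow> (\<Sum>l\<in>F. (cmod (x l))\<^sup>2) \<le> g a"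
    and nn: "\<And>a. 0 \<le> g a" and lim: "(g \<longlongrightarrow> 0) cofinite"
  shows "x \<in> E L n" "esum L n x a \<le> g a"
proof -
  note * = summable_on_nonneg_boundI[OF _ le]
  have *: "(\<lambda>l. (cmod (x l))\<^sup>2) summable_on mors_from L n a" "esum L n x a \<le> g a" if "a \<in> obj L" for a
    unfolding esum_def by (rule *; use that in auto)+
  have le: "esum L n x a \<le> g a" for a
    by (cases "a \<in> obj L") (auto simp: * esum_outside nn)
  then show "esum L n x a \<le> g a" .
  have "(esum L n x \<longlongrightarrow> 0) cofinite"
    by (rule tendsto_sandwich[OF _ _ tendsto_const lim]) (auto simp: le)
  then show "x \<in> E L n" using out * by (simp add: E_def esum_def[abs_def])
qed

text \<open>The only path of degree zero with source \<open>a\<close> is \<open>a\<close> itself, so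
  \<open>esum L 0 f a\<close> is the squared modulus of \<open>f a\<close>. This puts
  \<open>\<sigma>\<close> on the same footing as the maps \<open>T j\<close>.\<close>

lemma A0_eq_E: "A0 L = E L 0"
proof (intro set_eqI iffI)
  fix f assume f: "f \<in> A0 L"
  show "f \<in> E L 0"
  proof (rule E_I(1)[where g = "\<lambda>a. (cmod (f a))\<^sup>2"])
    show "((\<lambda>a. (cmod (f a))\<^sup>2) \<longlongrightarrow> 0) cofinite"
      using f by (auto simp: A0_def tendsto_norm_zero intro!: tendsto_null_power)
    show "(\<Sum>l\<in>F. (cmod (f l))\<^sup>2) \<le> (cmod (f a))\<^sup>2" if "a \<in> obj L" "F \<subseteq> mors_from L 0 a" for a F
      using that mors_from_zero[OF that(1)] by (auto simp: subset_singleton_iff)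
  qed (use f in \<open>auto simp: A0_def mors_zero\<close>)
next
  fix f assume f: "f \<in> E L 0"
  have "esum L 0 f = (\<lambda>a. (cmod (f a))\<^sup>2)"
  proof
    fix a show "esum L 0 f a = (cmod (f a))\<^sup>2"
      by (cases "a \<in> obj L") (use f in \<open>auto simp: esum_def mors_from_zero mors_from_outside E_def mors_zero\<close>)
  qed
  then have "((\<lambda>a. (cmod (f a))\<^sup>2) \<longlongrightarrow> 0) cofinite"
    using E_tendsto[OF f] by simp
  then have "((\<lambda>a. sqrt ((cmod (f a))\<^sup>2)) \<longlongrightarrow> 0) cofinite" using tendsto_real_sqrt by fastforce
  then have "(f \<longlongrightarrow> 0) cofinite" by (simp add: tendsto_norm_zero_iff)
  then show "f \<in> A0 L" using f by (auto simp: A0_def E_def mors_zero)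
qed

lemma E_bounded:
  assumes x: "x \<in> E L n" shows "\<exists>c\<ge>0. \<forall>a. esum L n x a \<le> c"
proof -
  have "(\<lambda>a. of_real (esum L n x a)) \<in> A0 L"
    using E_tendsto[OF x] by (auto simp: A0_def esum_outside tendsto_of_real_iff[where c = 0, simplified])
  from A0_bounded[OF this] show ?thesis by auto
qed

lemma E_lincomb:
  assumes x: "x \<in> E L n" and y: "y \<in> E L n"
  shows "(\<lambda>l. b * x l + c * y l) \<in> E L n"
proof (rule E_I(1)[where g = "\<lambda>a. 2 * (cmod b)\<^sup>2 * esum L n x a + 2 * (cmod c)\<^sup>2 * esum L n y a"])
  have sq: "(cmod (b * s + c * t))\<^sup>2 \<le> 2 * (cmod b)\<^sup>2 * (cmod s)\<^sup>2 + 2 * (cmod c)\<^sup>2 * (cmod t)\<^sup>2" for s t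
  proof -
    have "(cmod (b * s + c * t))\<^sup>2 \<le> (cmod b * cmod s + cmod c * cmod t)\<^sup>2"
      using norm_triangle_ineq[of "b * s" "c * t"] by (intro power_mono) (simp_all add: norm_mult)
    also have "\<dots> \<le> 2 * (cmod b * cmod s)\<^sup>2 + 2 * (cmod c * cmod t)\<^sup>2"
      using sum_squares_bound[of "cmod b * cmod s" "cmod c * cmod t"] by (simp add: power2_sum)
    finally show ?thesis by (simp add: power_mult_distrib)
  qed
  show "(\<Sum>l\<in>F. (cmod (b * x l + c * y l))\<^sup>2) \<le> 2 * (cmod b)\<^sup>2 * esum L n x a + 2 * (cmod c)\<^sup>2 * esum L n y a"
    if "finite F" "F \<subseteq> mors_from L n a" for a F
  proof -
    have "(\<Sum>l\<in>F. (cmod (b * x l + c * y l))\<^sup>2) \<le>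
        2 * (cmod b)\<^sup>2 * (\<Sum>l\<in>F. (cmod (x l))\<^sup>2) + 2 * (cmod c)\<^sup>2 * (\<Sum>l\<in>F. (cmod (y l))\<^sup>2)"
      unfolding sum_distrib_left sum.distrib[symmetric] by (intro sum_mono sq)
    also have "\<dots> \<le> 2 * (cmod b)\<^sup>2 * esum L n x a + 2 * (cmod c)\<^sup>2 * esum L n y a"
      using that x y by (intro add_mono mult_left_mono sum_le_esum) auto
    finally show ?thesis .
  qed
  show "((\<lambda>a. 2 * (cmod b)\<^sup>2 * esum L n x a + 2 * (cmod c)\<^sup>2 * esum L n y a) \<longlongrightarrow> 0) cofinite"
    by (rule tendsto_eq_intros E_tendsto x y refl)+ simp
qed (use x y in \<open>auto simp: E_outside\<close>)

lemma E_zero: "(\<lambda>l. 0) \<in> E L n"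
  by (rule E_I(1)[where g = "\<lambda>a. 0"]) auto

lemma E_scale: "x \<in> E L n \<Longrightarrow> (\<lambda>l. c * x l) \<in> E L n"
  using E_lincomb[of x n x c 0] by simp

lemma tendsto_delta_cofinite: "((\<lambda>a. if a = b then (c::real) else 0) \<longlongrightarrow> 0) cofinite"
proof (rule tendsto_eventually)
  show "\<forall>\<^sub>F a in cofinite. (if a = b then c else 0) = 0"
    unfolding eventually_cofinite by (rule finite_subset[of _ "{b}"]) auto
qed

lemma dirac_E:
  assumes l: "l \<in> mors L n" shows "dirac l \<in> E L n"
proof (rule E_I(1)[OF _ _ _ tendsto_delta_cofinite])
  show "(\<Sum>k\<in>F. (cmod (dirac l k))\<^sup>2) \<le> (if a = src L l then 1 else 0)"
    if "finite F" "F \<subseteq> mors_from L n a" for a F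
  proof -
    have "(\<Sum>k\<in>F. (cmod (dirac l k))\<^sup>2) = (\<Sum>k\<in>F. if k = l then 1 else 0)"
      by (intro sum.cong) (auto simp: dirac_def)
    also have "\<dots> = (if l \<in> F then 1 else 0)" using that(1) by (simp add: sum.delta)
    finally show ?thesis using that(2) by (auto simp: mors_from_def)
  qed
qed (use l in \<open>auto simp: dirac_def\<close>)

lemma dirac_A0: "a \<in> obj L \<Longrightarrow> dirac a \<in> A0 L"
  unfolding A0_eq_E by (rule dirac_E) (simp add: mors_zero)

lemma E_inner_summable:
  assumes "x \<in> E L n" "y \<in> E L n"
  shows "(\<lambda>l. norm (cnj (x l) * y l)) summable_on mors_from L n a"
    "(\<Sum>\<^sub>\<infinity>l\<in>mors_from L n a. norm (cnj (x l) * y l)) \<le> esum L n x a + esum L n y a"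
proof -
  have le: "norm (cnj (x l) * y l) \<le> (cmod (x l))\<^sup>2 + (cmod (y l))\<^sup>2" for l
    by (simp add: norm_mult mult_le_sum_squares)
  have sum: "(\<lambda>l. (cmod (x l))\<^sup>2 + (cmod (y l))\<^sup>2) summable_on mors_from L n a"
    by (intro summable_on_add E_summable assms)
  show 1: "(\<lambda>l. norm (cnj (x l) * y l)) summable_on mors_from L n a"
    by (rule summable_on_comparison_test[OF sum le]) simp
  have "(\<Sum>\<^sub>\<infinity>l\<in>mors_from L n a. norm (cnj (x l) * y l)) \<le>
      (\<Sum>\<^sub>\<infinity>l\<in>mors_from L n a. (cmod (x l))\<^sup>2 + (cmod (y l))\<^sup>2)"
    by (intro infsum_mono 1 sum le)
  also have "\<dots> = esum L n x a + esum L n y a"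
    unfolding esum_def by (intro infsum_add E_summable assms)
  finally show "(\<Sum>\<^sub>\<infinity>l\<in>mors_from L n a. norm (cnj (x l) * y l)) \<le> esum L n x a + esum L n y a" .
qed

lemma E_inner_has_sum:
  assumes "x \<in> E L n" "y \<in> E L n" "a \<in> obj L"
  shows "((\<lambda>l. cnj (x l) * y l) has_sum E_inner L n x y a) (mors_from L n a)"
  using Infinite_Sum.abs_summable_summable[OF E_inner_summable(1)[OF assms(1,2)]] assms(3)
  by (simp add: E_inner_def)

lemma norm_E_inner_le:
  assumes "x \<in> E L n" "y \<in> E L n"
  shows "cmod (E_inner L n x y a) \<le> esum L n x a + esum L n y a"
proof (cases "a \<in> obj L")
  case True
  then show ?thesis
    using order.trans[OF norm_infsum_bound[OF E_inner_summable(1)[OF assms]] E_inner_summable(2)[OF assms]]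
    by (simp add: E_inner_def)
qed (simp add: E_inner_def add_nonneg_nonneg)

lemma E_inner_A0:
  assumes "x \<in> E L n" "y \<in> E L n"
  shows "E_inner L n x y \<in> A0 L"
proof -
  have "((\<lambda>a. esum L n x a + esum L n y a) \<longlongrightarrow> 0) cofinite"
    by (rule tendsto_eq_intros E_tendsto assms refl)+ simp
  then have "(E_inner L n x y \<longlongrightarrow> 0) cofinite"
    by (rule Lim_null_comparison[rotated]) (simp add: norm_E_inner_le[OF assms])
  then show ?thesis by (simp add: A0_def E_inner_def)
qed

lemma E_inner_self:
  assumes "x \<in> E L n"
  shows "E_inner L n x x a = of_real (esum L n x a)"
proof (cases "a \<in> obj L")
  case True
  have "((\<lambda>l. complex_of_real ((cmod (x l))\<^sup>2)) has_sum of_real (esum L n x a)) (mors_from L n a)"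
    unfolding esum_def by (intro has_sum_of_real has_sum_infsum E_summable assms)
  then have "((\<lambda>l. cnj (x l) * x l) has_sum of_real (esum L n x a)) (mors_from L n a)"
    by (simp add: complex_norm_square mult.commute del: of_real_power)
  then show ?thesis using E_inner_has_sum[OF assms assms True] has_sum_unique by blast
qed (simp add: E_inner_def esum_outside)

section \<open>Tensor products of functions on paths\<close>

lemma E_tensor_outside: "v \<notin> mors L (m + n) \<Longrightarrow> E_tensor L m n x y v = 0"
  by (simp add: E_tensor_def)

lemma E_tensor_cmp:
  "l \<in> mors L m \<Longrightarrow> k \<in> mors L n \<Longrightarrow> src L l = rng L k \<Longrightarrow> E_tensor L m n x y (cmp L l k) = x l * y k"
  using factor_cmp[of l m k n] by (simp add: E_tensor_def cmp_mors factor_def)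

text \<open>For a fixed second factor \<open>k\<close>, the first factors all have source
  \<open>rng L k\<close>, so their squares add up to at most a uniform bound \<open>c\<close> for
  \<open>esum L m x\<close>. Summing over \<open>k\<close> last gives the dominating function
  \<open>c * esum L n y\<close>.\<close>

lemma E_tensor_E:
  assumes x: "x \<in> E L m" and y: "y \<in> E L n"
  shows "E_tensor L m n x y \<in> E L (m + n)"
proof -
  obtain c where c: "c \<ge> 0" "\<And>a. esum L m x a \<le> c" using E_bounded[OF x] by blast
  show ?thesis
  proof (rule E_I(1)[where g = "\<lambda>a. c * esum L n y a"])
    fix a F assume F: "finite F" "F \<subseteq> mors_from L (m + n) a"
    have "F \<subseteq> mors L (m + n)" using F(2) mors_from_subset by (rule order.trans)
    with F(1) obtain K H where KH: "finite K" "K \<subseteq> mors L m" "\<And>l. finite (H l)" "\<And>l. l \<in> K \<Longrightarrow> H l \<subseteq> mors_to n l"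
      "bij_betw (\<lambda>(l, k). cmp L l k) (SIGMA l:K. H l) F"
      by (rule finite_mors_Sigma) (rule that)
    have mem: "l \<in> mors L m \<and> k \<in> mors L n \<and> src L l = rng L k" if "l \<in> K" "k \<in> H l" for l k
      using that KH(2) KH(4)[OF that(1)] by (auto simp: mors_to_def)
    have "k \<in> mors_from L n a" if "l \<in> K" "k \<in> H l" for l k
    proof -
      have "cmp L l k \<in> F" using bij_betwE[OF KH(5)] that by auto
      then have "src L (cmp L l k) = a" using F(2) by (auto simp: mors_from_def)
      then show ?thesis using mem[OF that] src_cmp[of l k] morsD by (auto simp: mors_from_def)
    qed
    then have B: "finite (\<Union> (H ` K))" "\<Union> (H ` K) \<subseteq> mors_from L n a" using KH(1,3) by auto
    have "(\<Sum>v\<in>F. (cmod (E_tensor L m n x y v))\<^sup>2) = (\<Sum>(l, k)\<in>(SIGMA l:K. H l). (cmod (E_tensor L m n x y (cmp L l k)))\<^sup>2)"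
      by (subst sum.reindex_bij_betw[OF KH(5), symmetric]) (simp add: case_prod_beta)
    also have "\<dots> = (\<Sum>l\<in>K. \<Sum>k\<in>H l. (cmod (E_tensor L m n x y (cmp L l k)))\<^sup>2)"
      by (rule sum.Sigma[symmetric]) (use KH in auto)
    also have "\<dots> = (\<Sum>l\<in>K. \<Sum>k | k \<in> \<Union> (H ` K) \<and> k \<in> H l. (cmod (x l))\<^sup>2 * (cmod (y k))\<^sup>2)"
      using mem by (intro sum.cong) (auto simp: E_tensor_cmp norm_mult power_mult_distrib)
    also have "\<dots> = (\<Sum>k\<in>\<Union> (H ` K). \<Sum>l | l \<in> K \<and> k \<in> H l. (cmod (x l))\<^sup>2 * (cmod (y k))\<^sup>2)"
      by (rule sum.swap_restrict[OF KH(1) B(1)])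
    also have "\<dots> = (\<Sum>k\<in>\<Union> (H ` K). (\<Sum>l | l \<in> K \<and> k \<in> H l. (cmod (x l))\<^sup>2) * (cmod (y k))\<^sup>2)"
      by (simp add: sum_distrib_right)
    also have "\<dots> \<le> (\<Sum>k\<in>\<Union> (H ` K). c * (cmod (y k))\<^sup>2)"
    proof (intro sum_mono mult_right_mono)
      fix k
      have "(\<Sum>l | l \<in> K \<and> k \<in> H l. (cmod (x l))\<^sup>2) \<le> esum L m x (rng L k)"
        by (rule sum_le_esum[OF x]) (use KH(1) mem in \<open>auto simp: mors_from_def\<close>)
      then show "(\<Sum>l | l \<in> K \<and> k \<in> H l. (cmod (x l))\<^sup>2) \<le> c" using c(2) order.trans by blast
    qed simp
    also have "\<dots> \<le> c * esum L n y a"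
      unfolding sum_distrib_left[symmetric] by (intro mult_left_mono sum_le_esum[OF y B] c(1))
    finally show "(\<Sum>v\<in>F. (cmod (E_tensor L m n x y v))\<^sup>2) \<le> c * esum L n y a" .
  next
    show "((\<lambda>a. c * esum L n y a) \<longlongrightarrow> 0) cofinite"
      by (rule tendsto_eq_intros E_tendsto y refl)+ simp
  qed (use c in \<open>auto simp: E_tensor_outside\<close>)
qed

lemma E_tensor_dirac:
  assumes "l \<in> mors L m" "k \<in> mors L n" "src L l = rng L k"
  shows "E_tensor L m n (dirac l) (dirac k) = dirac (cmp L l k)"
proof
  fix v
  show "E_tensor L m n (dirac l) (dirac k) v = dirac (cmp L l k) v"
  proof (cases "v \<in> mors L (m + n)")
    case True
    then show ?thesis
    proof (cases rule: factor_cases)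
      case (1 l' k')
      then show ?thesis using factor_cmp[OF assms] by (auto simp: E_tensor_cmp dirac_def)
    qed
  qed (use cmp_mors[OF assms] in \<open>auto simp: E_tensor_outside dirac_def\<close>)
qed

lemma cmp_rng: "l \<in> mors L n \<Longrightarrow> cmp L (rng L l) l = l"
  and cmp_src: "l \<in> mors L n \<Longrightarrow> cmp L l (src L l) = l"
  by (auto simp: mors_def id_left id_right)

text \<open>The factorisation of \<open>l\<close> with first degree zero is by the identity at its
  range. Hence the left action is tensoring by an element of degree zero, and likewise on the right
  in \<open>E_tensor_right\<close>.\<close>

lemma E_tensor_left: "x \<in> E L n \<Longrightarrow> E_tensor L 0 n f x = left_act L f x"
proof
  fix l assume x: "x \<in> E L n"
  show "E_tensor L 0 n f x l = left_act L f x l"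
  proof (cases "l \<in> mors L n")
    case True
    then show ?thesis
      using E_tensor_cmp[of "rng L l" 0 l n f x] cmp_rng rng_mors src_id
      by (simp add: mors_zero left_act_def)
  qed (use x in \<open>simp add: E_tensor_outside left_act_def E_outside\<close>)
qed

lemma E_tensor_right: "x \<in> E L n \<Longrightarrow> E_tensor L n 0 x f = right_act L x f"
proof
  fix l assume x: "x \<in> E L n"
  show "E_tensor L n 0 x f l = right_act L x f l"
  proof (cases "l \<in> mors L n")
    case True
    then show ?thesis
      using E_tensor_cmp[of l n "src L l" 0 x f] cmp_src src_mors rng_id
      by (simp add: mors_zero right_act_def)
  qed (use x in \<open>simp add: E_tensor_outside right_act_def E_outside\<close>)
qed

lemma left_act_E: "f \<in> A0 L \<Longrightarrow> x \<in> E L n \<Longrightarrow> left_act L f x \<in> E L n"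
  using E_tensor_E[of f 0 x n] by (simp add: E_tensor_left A0_eq_E)

lemma A0_mult: "f \<in> A0 L \<Longrightarrow> g \<in> A0 L \<Longrightarrow> (\<lambda>a. f a * g a) \<in> A0 L"
  and E_tensor_A0: "f \<in> A0 L \<Longrightarrow> g \<in> A0 L \<Longrightarrow> E_tensor L 0 0 f g = (\<lambda>a. f a * g a)"
proof -
  assume f: "f \<in> A0 L" and g: "g \<in> A0 L"
  have eq: "left_act L f g = (\<lambda>a. f a * g a)"
    using g rng_id unfolding left_act_def A0_def fun_eq_iff by (metis (mono_tags, lifting) mem_Collect_eq mult_zero_right)
  then show "E_tensor L 0 0 f g = (\<lambda>a. f a * g a)"
    using g E_tensor_left by (simp add: A0_eq_E)
  show "(\<lambda>a. f a * g a) \<in> A0 L"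
    using left_act_E[OF f, of g 0] f g eq by (simp add: A0_eq_E)
qed

text \<open>Density of finitely supported functions, uniformly in the source: off a finite set
  \<open>A\<close> of objects \<open>esum\<close> is already small, and over each object of
  \<open>A\<close> finitely many paths carry all but a small tail.\<close>

lemma E_truncate:
  assumes x: "x \<in> E L n" and e: "e > 0"
  shows "\<exists>F0. finite F0 \<and> F0 \<subseteq> mors L n \<and> (\<forall>F. finite F \<longrightarrow> F0 \<subseteq> F \<longrightarrow>
    (\<lambda>l. if l \<in> F then 0 else x l) \<in> E L n \<and> (\<forall>a. esum L n (\<lambda>l. if l \<in> F then 0 else x l) a \<le> e))"
proof -
  define A where "A = {a. \<not> esum L n x a < e}"
  have "finite A"
    using order_tendstoD(2)[OF E_tendsto[OF x] e] by (simp add: A_def eventually_cofinite)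
  have "\<exists>F. finite F \<and> F \<subseteq> mors_from L n a \<and> (\<Sum>\<^sub>\<infinity>l\<in>mors_from L n a - F. (cmod (x l))\<^sup>2) < e" for a
    by (rule summable_on_small_tail) (use E_summable[OF x] e in auto)
  then obtain B where B: "\<And>a. finite (B a)" "\<And>a. B a \<subseteq> mors_from L n a"
    "\<And>a. (\<Sum>\<^sub>\<infinity>l\<in>mors_from L n a - B a. (cmod (x l))\<^sup>2) < e" by metis
  define F0 where "F0 = (\<Union>a\<in>A. B a)"
  have "(\<lambda>l. if l \<in> F then 0 else x l) \<in> E L n \<and> (\<forall>a. esum L n (\<lambda>l. if l \<in> F then 0 else x l) a \<le> e)"
    if F: "finite F" "F0 \<subseteq> F" for F
  proof
    let ?y = "\<lambda>l. if l \<in> F then 0 else x l"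
    have le: "(\<Sum>l\<in>G. (cmod (?y l))\<^sup>2) \<le> esum L n x a" if "finite G" "G \<subseteq> mors_from L n a" for G a
      by (rule order.trans[OF sum_mono sum_le_esum[OF x that]]) auto
    note E = E_I[OF _ le esum_nonneg E_tendsto[OF x]]
    show y: "?y \<in> E L n" by (rule E(1)) (use x in \<open>auto simp: E_outside\<close>)
    show "\<forall>a. esum L n ?y a \<le> e"
    proof
      fix a
      show "esum L n ?y a \<le> e"
      proof (cases "a \<in> A")
        case False
        have "esum L n ?y a \<le> esum L n x a" by (rule E(2)) (use x in \<open>auto simp: E_outside\<close>)
        then show ?thesis using False by (simp add: A_def)
      next
        case True
        have "esum L n ?y a \<le> (\<Sum>\<^sub>\<infinity>l\<in>mors_from L n a - B a. (cmod (x l))\<^sup>2)"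
          unfolding esum_def
        proof (rule infsum_mono_neutral)
          show "(\<lambda>l. (cmod (x l))\<^sup>2) summable_on mors_from L n a - B a"
            by (rule summable_on_subset_banach[OF E_summable[OF x]]) auto
        qed (use E_summable[OF y] F True in \<open>auto simp: F0_def\<close>)
        then show ?thesis using B(3)[of a] by simp
      qed
    qed
  qed
  moreover have "finite F0" "F0 \<subseteq> mors L n"
    using \<open>finite A\<close> B mors_from_subset by (fastforce simp: F0_def)+
  ultimately show ?thesis by blast
qed

end

section \<open>Maps given by row contractions\<close>

lemma has_sum_sum:
  fixes f :: "'k \<Rightarrow> 'i \<Rightarrow> 'b::topological_comm_monoid_add"
  assumes "\<And>k. k \<in> A \<Longrightarrow> (f k has_sum s k) I"
  shows "((\<lambda>i. \<Sum>k\<in>A. f k i) has_sum (\<Sum>k\<in>A. s k)) I"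
  using assms by (induction A rule: infinite_finite_induct) (auto intro: has_sum_add)

lemma matrix_opnorm_le_sum:
  "matrix_opnorm n (\<lambda>i k z. G i k * z) \<le> (\<Sum>i<n. \<Sum>k<n. cmod (G i k))"
proof (rule matrix_opnorm_le)
  fix z :: "nat \<Rightarrow> complex" assume z: "L2_set (\<lambda>k. norm (z k)) {..<n} \<le> 1"
  have z1: "cmod (z k) \<le> 1" if "k < n" for k
    by (rule order.trans[OF member_le_L2_set[of "{..<n}"] z]) (use that in auto)
  have "L2_set (\<lambda>i. cmod (\<Sum>k<n. G i k * z k)) {..<n} \<le> (\<Sum>i<n. cmod (\<Sum>k<n. G i k * z k))"
    by (rule L2_set_le_sum) simp
  also have "\<dots> \<le> (\<Sum>i<n. \<Sum>k<n. cmod (G i k))"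
  proof (intro sum_mono order.trans[OF norm_sum])
    fix i k assume "k \<in> {..<n}"
    then show "cmod (G i k * z k) \<le> cmod (G i k)"
      using mult_left_mono[OF z1[of k], of "cmod (G i k)"] by (simp add: norm_mult)
  qed
  finally show "L2_set (\<lambda>i. cmod (\<Sum>k<n. G i k * z k)) {..<n} \<le> (\<Sum>i<n. \<Sum>k<n. cmod (G i k))" .
qed

context higher_rank_graph
begin

text \<open>Fubini along \<open>bij_betw_cmp\<close>: a square-summable family on paths of degree
  \<open>m + n\<close> is a square-summable family, over first factors, of families over second
  factors.\<close>

lemma l2_Sigma:
  assumes f: "l2 (mors L (m + n)) f"
  shows "\<And>l. l \<in> mors L m \<Longrightarrow> l2 (mors_to n l) (\<lambda>k. f (cmp L l k))"
    and "\<And>F. finite F \<Longrightarrow> F \<subseteq> mors L m \<Longrightarrow>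
      L2_set (\<lambda>l. l2n (mors_to n l) (\<lambda>k. f (cmp L l k))) F \<le> l2n (mors L (m + n)) f"
proof -
  let ?g = "\<lambda>(l, k). (norm (f (cmp L l k)))\<^sup>2"
  let ?S = "SIGMA l:mors L m. mors_to n l"
  have eq: "?g = (\<lambda>p. (norm (f (case p of (l, k) \<Rightarrow> cmp L l k)))\<^sup>2)" by auto
  have sum: "?g summable_on ?S"
    unfolding eq
    using f by (subst summable_on_reindex_bij_betw[OF bij_betw_cmp, where f = "\<lambda>v. (norm (f v))\<^sup>2"]) (simp add: l2_def)
  have infsum: "infsum ?g ?S = (l2n (mors L (m + n)) f)\<^sup>2"
    unfolding eq l2n_square
    by (rule infsum_reindex_bij_betw[OF bij_betw_cmp, where f = "\<lambda>v. (norm (f v))\<^sup>2"])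
  show "l2 (mors_to n l) (\<lambda>k. f (cmp L l k))" if "l \<in> mors L m" for l
    using summable_on_SigmaD1[OF sum that] by (simp add: l2_def)
  show "L2_set (\<lambda>l. l2n (mors_to n l) (\<lambda>k. f (cmp L l k))) F \<le> l2n (mors L (m + n)) f"
    if F: "finite F" "F \<subseteq> mors L m" for F
  proof -
    have "(\<Sum>l\<in>F. (l2n (mors_to n l) (\<lambda>k. f (cmp L l k)))\<^sup>2) \<le>
        (\<Sum>\<^sub>\<infinity>l\<in>mors L m. (l2n (mors_to n l) (\<lambda>k. f (cmp L l k)))\<^sup>2)"
      using summable_on_Sigma_banach[OF sum] F
      by (intro finite_sum_le_infsum) (simp_all add: l2n_square infsum_nonneg)
    also have "\<dots> = (l2n (mors L (m + n)) f)\<^sup>2"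
      unfolding infsum[symmetric] using infsum_Sigma'_banach[OF sum] by (simp add: l2n_square)
    finally show ?thesis unfolding L2_set_def by (simp add: real_le_lsqrt)
  qed
qed

end

text \<open>The common ground of both directions: \<open>P\<close> is the restriction of a
  contraction to objects in one, and \<open>\<sigma>\<close> on Dirac functions in the other. The
  projections may vanish and need not add up to the identity.\<close>

locale graph_projections = higher_rank_graph L
  for L :: "('l, 'r::finite) hrgraph" +
  fixes P :: "'l \<Rightarrow> ('h::chilbert_space \<Rightarrow>\<^sub>L 'h)"
  assumes P_BH: "a \<in> obj L \<Longrightarrow> P a \<in> BH"
    and P_idem: "a \<in> obj L \<Longrightarrow> P a (P a h) = P a h"
    and P_self: "a \<in> obj L \<Longrightarrow> cinner (P a h) k = cinner h (P a k)"
    and P_orth: "a \<in> obj L \<Longrightarrow> b \<in> obj L \<Longrightarrow> a \<noteq> b \<Longrightarrow> P a (P b h) = 0"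
begin

text \<open>The projection is there because the Dirac function at \<open>l\<close> is unchanged by
  the right action of the Dirac function at \<open>src L l\<close>, which moves to \<open>h\<close>
  across the balanced tensor product.\<close>

definition tvec :: "('l \<Rightarrow> complex) \<times> 'h \<Rightarrow> 'l \<Rightarrow> 'h" where
  "tvec = (\<lambda>(x, h) l. x l *\<^sub>C P (src L l) h)"

text \<open>The clause on the source projection is right linearity over \<open>A0 L\<close>; left
  linearity is the separate \<open>range_row\<close>, required only where a row is applied behind
  another one.\<close>

definition module_row :: "nat ^ 'r \<Rightarrow> ('l \<Rightarrow> ('h \<Rightarrow>\<^sub>L 'h)) \<Rightarrow> bool" where
  "module_row n W \<longleftrightarrow> row_contraction (mors L n) W \<and>
     (\<forall>l\<in>mors L n. \<forall>h. W l (P (src L l) h) = W l h)"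

definition range_row :: "nat ^ 'r \<Rightarrow> ('l \<Rightarrow> ('h \<Rightarrow>\<^sub>L 'h)) \<Rightarrow> bool" where
  "range_row n W \<longleftrightarrow> (\<forall>l\<in>mors L n. \<forall>a\<in>obj L. \<forall>h. P a (W l h) =
     (if rng L l = a then W l h else 0))"

text \<open>The meeting point of the two directions: for a contraction, \<open>T\<close> is built
  from the row (\<open>implements_exists\<close>); for a representation, the row is read off from
  \<open>T\<close> and this relation follows by density (\<open>implementsI\<close>).\<close>

definition implements :: "nat ^ 'r \<Rightarrow> ('l \<Rightarrow> ('h \<Rightarrow>\<^sub>L 'h)) \<Rightarrow> (('l \<Rightarrow> complex) \<Rightarrow> ('h \<Rightarrow>\<^sub>L 'h)) \<Rightarrow> bool" where
  "implements n W T \<longleftrightarrow> (\<forall>x\<in>E L n. T x \<in> BH \<and>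
     (\<forall>h. T x h = rowop (mors L n) W (tvec (x, h))))"

definition comp_row :: "nat ^ 'r \<Rightarrow> nat ^ 'r \<Rightarrow> ('l \<Rightarrow> ('h \<Rightarrow>\<^sub>L 'h)) \<Rightarrow> ('l \<Rightarrow> ('h \<Rightarrow>\<^sub>L 'h)) \<Rightarrow> 'l \<Rightarrow> ('h \<Rightarrow>\<^sub>L 'h)" where
  "comp_row m n W1 W2 v = W1 (fst (factor L m n v)) o\<^sub>L W2 (snd (factor L m n v))"

lemma norm_P_square: "a \<in> obj L \<Longrightarrow> of_real ((norm (P a h))\<^sup>2) = cinner h (P a h)"
  unfolding cinner_self[symmetric] by (simp add: P_self P_idem)

lemma norm_P_le: "a \<in> obj L \<Longrightarrow> norm (P a h) \<le> norm h"
proof -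
  assume a: "a \<in> obj L"
  have "cmod (of_real ((norm (P a h))\<^sup>2)) \<le> norm h * norm (P a h)"
    unfolding norm_P_square[OF a] by (rule cmod_cinner_le)
  then have "norm (P a h) * norm (P a h) \<le> norm h * norm (P a h)"
    by (simp add: power2_eq_square norm_mult)
  then show ?thesis by (cases "norm (P a h) = 0") auto
qed

lemma norm_sum_P:
  "finite F \<Longrightarrow> F \<subseteq> obj L \<Longrightarrow>
     (norm (\<Sum>a\<in>F. P a (h a)))\<^sup>2 = (\<Sum>a\<in>F. (norm (P a (h a)))\<^sup>2)"
proof (induction F rule: finite_induct)
  case (insert b F)
  have "cinner (P b (h b)) (P a (h a)) = 0" if "a \<in> F" for a
    using insert that P_orth[of b a "h a"] P_self[of b "h b"] by (metis cinner_zero_right insert_subset subsetD)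
  then have "cinner (P b (h b)) (\<Sum>a\<in>F. P a (h a)) = 0"
    by (simp add: cinner.sum_right)
  then show ?case using insert by (simp add: norm_add_square)
qed simp

lemma P_row: "row_contraction (obj L) P"
  unfolding row_contraction_def
proof (intro conjI allI impI ballI)
  fix F and h :: "'l \<Rightarrow> 'h" assume F: "finite F" "F \<subseteq> obj L"
  have "(norm (\<Sum>a\<in>F. P a (h a)))\<^sup>2 \<le> (\<Sum>a\<in>F. (norm (h a))\<^sup>2)"
    unfolding norm_sum_P[OF F] using F by (intro sum_mono power_mono norm_P_le) auto
  then show "norm (\<Sum>a\<in>F. P a (h a)) \<le> L2_set (\<lambda>a. norm (h a)) F"
    unfolding L2_set_def by (rule real_le_rsqrt)
qed (rule P_BH)

text \<open>Bessel's inequality is the adjoint form of \<open>P_row\<close>, since each projection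
  is its own adjoint.\<close>

lemma P_bessel: "finite F \<Longrightarrow> F \<subseteq> obj L \<Longrightarrow> (\<Sum>a\<in>F. (norm (P a h))\<^sup>2) \<le> (norm h)\<^sup>2"
proof -
  assume F: "finite F" "F \<subseteq> obj L"
  have "cadj (P a) = P a" if "a \<in> obj L" for a
    using that by (intro cadj_unique P_BH) (simp_all add: P_self)
  then have "L2_set (\<lambda>a. norm (P a h)) F = L2_set (\<lambda>a. norm (cadj (P a) h)) F"
    using F by (intro L2_set_cong) auto
  also have "\<dots> \<le> norm h" by (rule row_contraction_adjoint_le[OF P_row F])
  finally have "(L2_set (\<lambda>a. norm (P a h)) F)\<^sup>2 \<le> (norm h)\<^sup>2" by (intro power_mono) auto
  then show ?thesis by (simp add: L2_set_def sum_nonneg)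
qed

lemma module_row_P: "module_row 0 P"
  by (simp add: module_row_def mors_zero P_row P_idem src_id)

lemma range_row_P: "range_row 0 P"
  using P_orth by (auto simp: range_row_def mors_zero P_idem rng_id)

text \<open>Grouping the paths by source leaves at most \<open>c\<close> times the sum of the
  squares of \<open>norm (P a h)\<close>, and Bessel's inequality bounds this by \<open>c\<close>
  times the square of \<open>norm h\<close>.\<close>

lemma tvec_l2:
  assumes x: "x \<in> E L n" and c: "\<And>a. esum L n x a \<le> c" and c0: "0 \<le> c"
  shows "l2 (mors L n) (tvec (x, h))" "l2n (mors L n) (tvec (x, h)) \<le> sqrt c * norm h"
proof -
  have "L2_set (\<lambda>l. norm (tvec (x, h) l)) F \<le> sqrt c * norm h" if F: "finite F" "F \<subseteq> mors L n" for F
  proof -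
    let ?p = "\<lambda>a. (norm (P a h))\<^sup>2"
    have "(\<Sum>l\<in>F. (norm (tvec (x, h) l))\<^sup>2) = (\<Sum>l\<in>F. (cmod (x l))\<^sup>2 * ?p (src L l))"
      by (simp add: tvec_def norm_scaleC power_mult_distrib)
    also have "\<dots> = (\<Sum>a\<in>src L ` F. \<Sum>l\<in>{l\<in>F. src L l = a}. (cmod (x l))\<^sup>2 * ?p (src L l))"
      by (rule sum.group[symmetric]) (use F in auto)
    also have "\<dots> = (\<Sum>a\<in>src L ` F. (\<Sum>l\<in>{l\<in>F. src L l = a}. (cmod (x l))\<^sup>2) * ?p a)"
      by (intro sum.cong refl) (simp add: sum_distrib_right)
    also have "\<dots> \<le> (\<Sum>a\<in>src L ` F. c * ?p a)"
    proof (intro sum_mono mult_right_mono)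
      fix a
      have "(\<Sum>l\<in>{l\<in>F. src L l = a}. (cmod (x l))\<^sup>2) \<le> esum L n x a"
        by (rule sum_le_esum[OF x]) (use F in \<open>auto simp: mors_from_def\<close>)
      then show "(\<Sum>l\<in>{l\<in>F. src L l = a}. (cmod (x l))\<^sup>2) \<le> c" using c order.trans by blast
    qed simp
    also have "\<dots> \<le> c * (norm h)\<^sup>2"
      unfolding sum_distrib_left[symmetric] using F src_mors c0
      by (intro mult_left_mono P_bessel) auto
    finally show ?thesis unfolding L2_set_def using real_sqrt_le_mono by (fastforce simp: real_sqrt_mult)
  qed
  then show "l2 (mors L n) (tvec (x, h))" "l2n (mors L n) (tvec (x, h)) \<le> sqrt c * norm h"
    by (rule l2_boundI; use c0 in simp)+
qed

lemma l2_tvec: "x \<in> E L n \<Longrightarrow> l2 (mors L n) (tvec (x, h))"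
  using tvec_l2(1) E_bounded by blast

lemma module_row_tvec:
  assumes "module_row n W" "l \<in> mors L n"
  shows "W l (tvec (x, h) l) = x l *\<^sub>C W l h"
  using assms row_contraction_BH[of "mors L n" W l] by (simp add: module_row_def tvec_def BH_scaleC)

lemma implementsD:
  "implements n W T \<Longrightarrow> x \<in> E L n \<Longrightarrow> T x \<in> BH"
  "implements n W T \<Longrightarrow> x \<in> E L n \<Longrightarrow> T x h = rowop (mors L n) W (tvec (x, h))"
  by (simp_all add: implements_def)

lemma implements_has_sum:
  assumes W: "module_row n W" and T: "implements n W T" and x: "x \<in> E L n"
  shows "((\<lambda>l. x l *\<^sub>C W l h) has_sum T x h) (mors L n)"
proof -
  have "((\<lambda>l. W l (tvec (x, h) l)) has_sum rowop (mors L n) W (tvec (x, h))) (mors L n)"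
    using W by (intro rowop_has_sum l2_tvec x) (simp add: module_row_def)
  then show ?thesis
    by (subst has_sum_cong[where g = "\<lambda>l. W l (tvec (x, h) l)"])
      (simp_all add: module_row_tvec[OF W] implementsD(2)[OF T x])
qed

lemma implementsI:
  assumes W: "module_row n W"
    and BH: "\<And>x. x \<in> E L n \<Longrightarrow> T x \<in> BH"
    and sum: "\<And>x h. x \<in> E L n \<Longrightarrow> ((\<lambda>l. x l *\<^sub>C W l h) has_sum T x h) (mors L n)"
  shows "implements n W T"
  unfolding implements_def
proof (intro ballI conjI allI)
  fix x h assume x: "x \<in> E L n"
  have "rowop (mors L n) W (tvec (x, h)) = (\<Sum>\<^sub>\<infinity>l\<in>mors L n. x l *\<^sub>C W l h)"
    unfolding rowop_def by (intro infsum_cong module_row_tvec[OF W])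
  then show "T x h = rowop (mors L n) W (tvec (x, h))"
    using infsumI[OF sum[OF x]] by simp
qed (rule BH)

lemma implements_dirac:
  assumes W: "module_row n W" and T: "implements n W T" and l: "l \<in> mors L n"
  shows "T (dirac l) = W l"
proof (rule blinfun_eqI)
  fix h
  have "((\<lambda>k. dirac l k *\<^sub>C W k h) has_sum W l h) {l}"
    by (rule has_sum_finiteI) (simp_all add: dirac_def)
  then have "((\<lambda>k. dirac l k *\<^sub>C W k h) has_sum W l h) (mors L n)"
    by (subst (asm) has_sum_cong_neutral[where T = "mors L n" and g = "\<lambda>k. dirac l k *\<^sub>C W k h"])
      (use l in \<open>auto simp: dirac_def scaleC.zero_left\<close>)
  then show "T (dirac l) h = W l h"
    using implements_has_sum[OF W T dirac_E[OF l]] has_sum_unique by blast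
qed

lemma implements_cong:
  assumes "implements n W T" "\<And>l. l \<in> mors L n \<Longrightarrow> W l = W' l" "\<And>x. x \<in> E L n \<Longrightarrow> T x = T' x"
  shows "implements n W' T'"
  using assms unfolding implements_def rowop_def by (simp cong: infsum_cong)

lemma implements_exists:
  assumes W: "module_row n W"
  obtains T where "T \<in> E L n \<rightarrow>\<^sub>E BH" "implements n W T"
proof -
  have row: "row_contraction (mors L n) W" using W by (simp add: module_row_def)
  have "\<exists>A\<in>BH. blinfun_apply A = (\<lambda>h. rowop (mors L n) W (tvec (x, h)))" if x: "x \<in> E L n" for x
  proof -
    obtain c where c: "c \<ge> 0" "\<And>a. esum L n x a \<le> c" using E_bounded[OF x] by blast
    show ?thesis
    proof (rule BH_I)
      fix h k
      have "tvec (x, h + k) = (\<lambda>l. tvec (x, h) l + tvec (x, k) l)"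
        by (simp add: tvec_def blinfun.add_right scaleC_add_right fun_eq_iff)
      then show "rowop (mors L n) W (tvec (x, h + k)) = rowop (mors L n) W (tvec (x, h)) + rowop (mors L n) W (tvec (x, k))"
        using rowop_add[OF row l2_tvec[OF x] l2_tvec[OF x]] by simp
    next
      fix b h
      have "rowop (mors L n) W (tvec (x, b *\<^sub>C h)) = rowop (mors L n) W (\<lambda>l. b *\<^sub>C tvec (x, h) l)"
        unfolding rowop_def
        by (rule infsum_cong) (simp add: tvec_def BH_scaleC P_BH src_mors scaleC_scaleC mult.commute)
      then show "rowop (mors L n) W (tvec (x, b *\<^sub>C h)) = b *\<^sub>C rowop (mors L n) W (tvec (x, h))"
        using rowop_scaleC[OF row l2_tvec[OF x]] by simp
    next
      show "norm (rowop (mors L n) W (tvec (x, h))) \<le> norm h * sqrt c" for h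
        using order.trans[OF norm_rowop_le[OF row l2_tvec[OF x]] tvec_l2(2)[OF x c(2,1), of h]] by (simp add: mult.commute)
    qed
  qed
  then obtain A where A: "\<And>x. x \<in> E L n \<Longrightarrow> A x \<in> BH"
    "\<And>x. x \<in> E L n \<Longrightarrow> blinfun_apply (A x) = (\<lambda>h. rowop (mors L n) W (tvec (x, h)))" by metis
  show ?thesis
    by (rule that[of "restrict A (E L n)"]) (use A in \<open>auto simp: implements_def\<close>)
qed

lemma implements_lincomb:
  assumes W: "module_row n W" and T: "implements n W T" and x: "x \<in> E L n" and y: "y \<in> E L n"
  shows "blinfun_apply (T (\<lambda>l. b * x l + c * y l)) h = b *\<^sub>C T x h + c *\<^sub>C T y h"
proof -
  have "((\<lambda>l. b *\<^sub>C (x l *\<^sub>C W l h) + c *\<^sub>C (y l *\<^sub>C W l h)) has_sum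
      b *\<^sub>C T x h + c *\<^sub>C T y h) (mors L n)"
    by (rule has_sum_add[OF has_sum_bounded_linear[OF scaleC.bounded_linear_right implements_has_sum[OF W T x]]
        has_sum_bounded_linear[OF scaleC.bounded_linear_right implements_has_sum[OF W T y]]])
  then have "((\<lambda>l. (b * x l + c * y l) *\<^sub>C W l h) has_sum
      b *\<^sub>C T x h + c *\<^sub>C T y h) (mors L n)"
    by (simp add: scaleC_add_left scaleC_scaleC)
  then show ?thesis
    using implements_has_sum[OF W T E_lincomb[OF x y]] has_sum_unique by blast
qed

lemma implements_E_linear:
  "module_row n W \<Longrightarrow> implements n W T \<Longrightarrow> T \<in> E L n \<rightarrow>\<^sub>E BH \<Longrightarrow> E_linear L n T"
  by (simp add: E_linear_def implements_lincomb)

text \<open>Grouping by source again: paths from \<open>a\<close> share the factor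
  \<open>cinner h (P a k)\<close> and their coefficients add up to \<open>E_inner L n x y a\<close>.
  This turns the coordinate inner product into the one prescribed by \<open>ker1\<close>.\<close>

lemma tvec_inner_has_sum:
  assumes x: "x \<in> E L n" and y: "y \<in> E L n"
  shows "((\<lambda>a. E_inner L n x y a * cinner h (P a k)) has_sum
    (\<Sum>\<^sub>\<infinity>l\<in>mors L n. cinner (tvec (x, h) l) (tvec (y, k) l))) (obj L)"
proof -
  let ?f = "\<lambda>l. cinner (tvec (x, h) l) (tvec (y, k) l)"
  have "(?f has_sum infsum ?f (mors L n)) (mors L n)"
    by (rule l2_cinner_has_sum[OF l2_tvec[OF x] l2_tvec[OF y]])
  then have big: "((\<lambda>p. ?f (snd p)) has_sum infsum ?f (mors L n)) (SIGMA a:obj L. mors_from L n a)"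
    by (subst has_sum_reindex_bij_betw[OF bij_betw_source])
  show ?thesis
  proof (rule has_sum_SigmaD[OF big])
    fix a assume a: "a \<in> obj L"
    have "((\<lambda>l. (cnj (x l) * y l) * cinner h (P a k)) has_sum
        E_inner L n x y a * cinner h (P a k)) (mors_from L n a)"
      by (rule has_sum_cmult_left[OF E_inner_has_sum[OF x y a]])
    then show "((\<lambda>l. ?f (snd (a, l))) has_sum E_inner L n x y a * cinner h (P a k)) (mors_from L n a)"
      by (subst has_sum_cong[where g = "\<lambda>l. (cnj (x l) * y l) * cinner h (P a k)"])
        (use a in \<open>auto simp: mors_from_def tvec_def cinner_scaleC_left cinner_scaleC_right P_self P_idem\<close>)
  qed
qed

text \<open>Entry \<open>i\<close> of the image of \<open>h\<close> is the row operator at the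
  family \<open>f i\<close> representing the sum over \<open>k\<close> of \<open>x i k\<close>
  tensor \<open>h k\<close>. The squares of the \<open>l2n\<close> norms of all \<open>f i\<close>
  add up, object by object, to the form of the Gram matrix \<open>G a\<close> on the vectors
  \<open>P a (h k)\<close>. Then \<open>matrix_form_le\<close> bounds the form at \<open>a\<close>
  by the norm of \<open>G a\<close>, and Bessel's inequality sums over \<open>a\<close>.\<close>

lemma implements_contractive:
  assumes W: "module_row n W" and T: "implements n W T"
  shows "completely_contractive L n T"
  unfolding completely_contractive_def
proof (intro allI impI matrix_opnorm_le)
  fix N :: nat and x :: "nat \<Rightarrow> nat \<Rightarrow> 'l \<Rightarrow> complex" and h :: "nat \<Rightarrow> 'h"
  assume "\<forall>i<N. \<forall>k<N. x i k \<in> E L n"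
  then have x: "\<And>i k. i < N \<Longrightarrow> k < N \<Longrightarrow> x i k \<in> E L n" by blast
  assume h: "L2_set (\<lambda>k. norm (h k)) {..<N} \<le> 1"
  have row: "row_contraction (mors L n) W" using W by (simp add: module_row_def)
  define G where "G a i k = (\<Sum>l<N. E_inner L n (x l i) (x l k) a)" for a i k
  let ?q = "\<lambda>a. \<Sum>k'<N. \<Sum>k<N. G a k' k * cinner (P a (h k')) (P a (h k))"
  let ?t = "\<lambda>a i k' k. E_inner L n (x i k') (x i k) a * cinner (h k') (P a (h k))"
  let ?s = "\<lambda>i. \<Sum>k'<N. \<Sum>k<N. \<Sum>\<^sub>\<infinity>l\<in>mors L n. cinner (tvec (x i k', h k') l) (tvec (x i k, h k) l)"
  define M where "M = Sup (insert 0 ((\<lambda>a. matrix_opnorm N (\<lambda>i k z. G a i k * z)) ` obj L))"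
  define f where "f i l = (\<Sum>k<N. tvec (x i k, h k) l)" for i l
  have f: "l2 (mors L n) (f i)" if "i < N" for i
    unfolding f_def using that x by (intro l2_sum l2_tvec) auto
  \<comment> \<open>The supremum \<open>M\<close> dominates the individual norms only if these are
    bounded over all objects. The entries of \<open>G a\<close> are, because they are finite sums of
    elements of \<open>A0 L\<close> evaluated at \<open>a\<close>.\<close>
  have "\<exists>c\<ge>0. \<forall>a. cmod (G a i k) \<le> c" if "i < N" "k < N" for i k
  proof -
    have "\<forall>l. \<exists>c. l < N \<longrightarrow> (\<forall>a. cmod (E_inner L n (x l i) (x l k) a) \<le> c)"
      using A0_bounded[OF E_inner_A0[OF x x]] that by metis
    from choice[OF this] obtain c where "\<And>l a. l < N \<Longrightarrow> cmod (E_inner L n (x l i) (x l k) a) \<le> c l" by blast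
    then have "cmod (G a i k) \<le> (\<Sum>l<N. c l)" for a
      unfolding G_def by (intro order.trans[OF norm_sum] sum_mono) auto
    then show ?thesis using norm_ge_zero order.trans by blast
  qed
  then obtain c where c: "\<And>a i k. i < N \<Longrightarrow> k < N \<Longrightarrow> cmod (G a i k) \<le> c i k" by metis
  have "matrix_opnorm N (\<lambda>i k z. G a i k * z) \<le> (\<Sum>i<N. \<Sum>k<N. c i k)" for a
    by (rule order.trans[OF matrix_opnorm_le_sum]) (auto intro!: sum_mono c)
  then have bdd: "bdd_above (insert 0 ((\<lambda>a. matrix_opnorm N (\<lambda>i k z. G a i k * z)) ` obj L))"
    by (auto intro!: bdd_aboveI)
  have M: "matrix_opnorm N (\<lambda>i k z. G a i k * z) \<le> M" if "a \<in> obj L" for a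
    unfolding M_def using that by (intro cSup_upper bdd) auto
  have M0: "0 \<le> M" unfolding M_def by (intro cSup_upper bdd) auto
  have "((\<lambda>a. \<Sum>k'<N. \<Sum>k<N. ?t a i k' k) has_sum ?s i) (obj L)"
    if i: "i < N" for i
    using x[OF i] by (intro has_sum_sum tvec_inner_has_sum) auto
  moreover have "?s i = of_real ((l2n (mors L n) (f i))\<^sup>2)" if i: "i < N" for i
  proof -
    have "((\<lambda>l. \<Sum>k'<N. \<Sum>k<N. cinner (tvec (x i k', h k') l) (tvec (x i k, h k) l)) has_sum ?s i) (mors L n)"
      using x[OF i] by (intro has_sum_sum l2_cinner_has_sum l2_tvec) auto
    then have "((\<lambda>l. cinner (f i l) (f i l)) has_sum ?s i) (mors L n)"
      unfolding f_def cinner.sum_left unfolding cinner.sum_right .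
    from infsumI[OF this] show ?thesis unfolding l2n_square_cinner[OF f[OF i]] by simp
  qed
  ultimately have "((\<lambda>a. \<Sum>i<N. \<Sum>k'<N. \<Sum>k<N. ?t a i k' k)
      has_sum (\<Sum>i<N. of_real ((l2n (mors L n) (f i))\<^sup>2))) (obj L)"
    by (intro has_sum_sum) auto
  moreover have "(\<Sum>i<N. \<Sum>k'<N. \<Sum>k<N. ?t a i k' k) = ?q a"
    if a: "a \<in> obj L" for a
  proof -
    have "(\<Sum>i<N. \<Sum>k'<N. \<Sum>k<N. ?t a i k' k) =
        (\<Sum>k'<N. \<Sum>i<N. \<Sum>k<N. ?t a i k' k)"
      by (rule sum.swap)
    also have "\<dots> = (\<Sum>k'<N. \<Sum>k<N. \<Sum>i<N. ?t a i k' k)"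
      by (intro sum.cong refl sum.swap)
    finally show ?thesis by (simp add: G_def sum_distrib_right P_self[OF a] P_idem[OF a])
  qed
  ultimately have "(?q
      has_sum (\<Sum>i<N. of_real ((l2n (mors L n) (f i))\<^sup>2))) (obj L)"
    by (simp cong: has_sum_cong)
  from has_sum_Re[OF this]
  have "((\<lambda>a. Re (?q a)) has_sum (\<Sum>i<N. (l2n (mors L n) (f i))\<^sup>2)) (obj L)" by simp
  then have "(\<Sum>i<N. (l2n (mors L n) (f i))\<^sup>2) \<le> M"
  proof (rule has_sum_le_finite_sums)
    fix F assume F: "finite F" "F \<subseteq> obj L"
    have "(\<Sum>a\<in>F. Re (?q a)) \<le> (\<Sum>a\<in>F. M * (\<Sum>k<N. (norm (P a (h k)))\<^sup>2))"
    proof (rule sum_mono)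
      fix a assume "a \<in> F"
      then have "a \<in> obj L" using F by auto
      then show "Re (?q a) \<le> M * (\<Sum>k<N. (norm (P a (h k)))\<^sup>2)"
        by (intro order.trans[OF matrix_form_le mult_right_mono[OF M]]) (auto intro: sum_nonneg)
    qed
    also have "\<dots> = M * (\<Sum>a\<in>F. \<Sum>k<N. (norm (P a (h k)))\<^sup>2)"
      by (simp add: sum_distrib_left)
    also have "(\<Sum>a\<in>F. \<Sum>k<N. (norm (P a (h k)))\<^sup>2) = (\<Sum>k<N. \<Sum>a\<in>F. (norm (P a (h k)))\<^sup>2)"
      by (rule sum.swap)
    also have "M * \<dots> \<le> M * (\<Sum>k<N. (norm (h k))\<^sup>2)"
      by (intro mult_left_mono sum_mono P_bessel F M0)
    also have "\<dots> \<le> M * 1"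
    proof (rule mult_left_mono[OF _ M0])
      have "(L2_set (\<lambda>k. norm (h k)) {..<N})\<^sup>2 \<le> 1\<^sup>2" using h by (intro power_mono) auto
      then show "(\<Sum>k<N. (norm (h k))\<^sup>2) \<le> 1" by (simp add: L2_set_def sum_nonneg)
    qed
    finally show "(\<Sum>a\<in>F. Re (?q a)) \<le> M"
      by simp
  qed
  moreover have "(norm (\<Sum>k<N. T (x i k) (h k)))\<^sup>2 \<le> (l2n (mors L n) (f i))\<^sup>2" if i: "i < N" for i
  proof -
    have "(\<Sum>k<N. T (x i k) (h k)) = rowop (mors L n) W (f i)"
      unfolding f_def using x[OF i] by (subst rowop_sum[OF row]) (auto simp: l2_tvec implementsD(2)[OF T])
    then show ?thesis using norm_rowop_le[OF row f[OF i]] by (simp add: power_mono)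
  qed
  then have "(\<Sum>i<N. (norm (\<Sum>k<N. T (x i k) (h k)))\<^sup>2) \<le> (\<Sum>i<N. (l2n (mors L n) (f i))\<^sup>2)"
    by (intro sum_mono) auto
  ultimately have "(\<Sum>i<N. (norm (\<Sum>k<N. T (x i k) (h k)))\<^sup>2) \<le> M" by linarith
  then show "L2_set (\<lambda>i. norm (\<Sum>k<N. T (x i k) (h k))) {..<N} \<le> E_matrix_norm L n N x"
    by (simp add: L2_set_def E_matrix_norm_def M_def G_def)
qed

end

section \<open>Composition and tensor products\<close>

context graph_projections
begin

text \<open>The second row acts on the fibre over each first factor \<open>l\<close>, the first row
  on the results; the two nested square sums merge into one over \<open>F\<close>.\<close>

lemma module_row_comp:
  assumes W1: "module_row m W1" and W2: "module_row n W2"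
  shows "module_row (m + n) (comp_row m n W1 W2)"
  unfolding module_row_def row_contraction_def
proof (intro conjI allI impI ballI)
  have r1: "row_contraction (mors L m) W1" and r2: "row_contraction (mors L n) W2"
    using W1 W2 by (auto simp: module_row_def)
  show "comp_row m n W1 W2 v \<in> BH" if "v \<in> mors L (m + n)" for v
    using that by (cases rule: factor_cases)
      (auto simp: comp_row_def intro!: BH_compose row_contraction_BH[OF r1] row_contraction_BH[OF r2])
  show "comp_row m n W1 W2 v (P (src L v) h) = comp_row m n W1 W2 v h"
    if "v \<in> mors L (m + n)" for v h
    using that
  proof (cases rule: factor_cases)
    case (1 l k)
    then show ?thesis using W2 src_cmp[of l k] morsD by (auto simp: comp_row_def module_row_def)
  qed
  fix F and h :: "'l \<Rightarrow> 'h"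
  assume F: "finite F" "F \<subseteq> mors L (m + n)"
  obtain K H where KH: "finite K" "K \<subseteq> mors L m" "\<And>l. finite (H l)" "\<And>l. l \<in> K \<Longrightarrow> H l \<subseteq> mors_to n l"
    "bij_betw (\<lambda>(l, k). cmp L l k) (SIGMA l:K. H l) F"
    using finite_mors_Sigma[OF F] by metis
  have mem: "l \<in> mors L m \<and> k \<in> mors L n \<and> src L l = rng L k" if "l \<in> K" "k \<in> H l" for l k
    using that KH(2) KH(4)[OF that(1)] by (auto simp: mors_to_def)
  have "(\<Sum>v\<in>F. comp_row m n W1 W2 v (h v)) =
      (\<Sum>(l, k)\<in>(SIGMA l:K. H l). comp_row m n W1 W2 (cmp L l k) (h (cmp L l k)))"
    by (subst sum.reindex_bij_betw[OF KH(5), symmetric]) (simp add: case_prod_beta)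
  also have "\<dots> = (\<Sum>l\<in>K. \<Sum>k\<in>H l. comp_row m n W1 W2 (cmp L l k) (h (cmp L l k)))"
    by (rule sum.Sigma[symmetric]) (use KH in auto)
  also have "\<dots> = (\<Sum>l\<in>K. \<Sum>k\<in>H l. W1 l (W2 k (h (cmp L l k))))"
    by (intro sum.cong refl) (use mem factor_cmp in \<open>auto simp: comp_row_def\<close>)
  also have "\<dots> = (\<Sum>l\<in>K. W1 l (\<Sum>k\<in>H l. W2 k (h (cmp L l k))))"
    by (simp add: blinfun.sum_right)
  also have "norm \<dots> \<le> L2_set (\<lambda>l. norm (\<Sum>k\<in>H l. W2 k (h (cmp L l k)))) K"
    by (rule row_contractionD[OF r1 KH(1,2)])
  also have "\<dots> \<le> L2_set (\<lambda>l. L2_set (\<lambda>k. norm (h (cmp L l k))) (H l)) K"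
    using KH(3) mem by (intro L2_set_mono row_contractionD[OF r2]) auto
  also have "\<dots> = sqrt (\<Sum>l\<in>K. \<Sum>k\<in>H l. (norm (h (cmp L l k)))\<^sup>2)"
    by (simp add: L2_set_def sum_nonneg)
  also have "(\<Sum>l\<in>K. \<Sum>k\<in>H l. (norm (h (cmp L l k)))\<^sup>2) = (\<Sum>(l, k)\<in>(SIGMA l:K. H l). (norm (h (cmp L l k)))\<^sup>2)"
    by (rule sum.Sigma) (use KH in auto)
  also have "\<dots> = (\<Sum>v\<in>F. (norm (h v))\<^sup>2)"
    by (subst sum.reindex_bij_betw[OF KH(5), symmetric]) (simp add: case_prod_beta)
  finally show "norm (\<Sum>v\<in>F. comp_row m n W1 W2 v (h v)) \<le> L2_set (\<lambda>v. norm (h v)) F"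
    by (simp add: L2_set_def)
qed

text \<open>The coordinate form of sending \<open>x\<close> tensor \<open>y\<close> tensor
  \<open>h\<close> to \<open>x\<close> tensor \<open>T2 y h\<close>: coordinate \<open>l\<close> of
  the image comes from the paths \<open>k\<close> composable with \<open>l\<close>. All other terms
  of the series for \<open>T2 y h\<close> are killed by the projection at \<open>src L l\<close>, by
  \<open>range_row\<close>.\<close>

lemma rowop_mors_to:
  assumes W2: "module_row n W2" "range_row n W2" and T2: "implements n W2 T2"
    and x: "x \<in> E L m" and y: "y \<in> E L n" and l: "l \<in> mors L m"
  shows "rowop (mors_to n l) W2 (\<lambda>k. tvec (E_tensor L m n x y, h) (cmp L l k)) = tvec (x, T2 y h) l"
proof -
  let ?g = "\<lambda>v. x l *\<^sub>C P (src L l) v"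
  have a: "src L l \<in> obj L" using src_mors[OF l] .
  have "bounded_linear ?g"
    by (intro bounded_linear_compose[OF scaleC.bounded_linear_right] blinfun.bounded_linear_right)
  from has_sum_bounded_linear[OF this implements_has_sum[OF W2(1) T2 y]]
  have "((\<lambda>k. ?g (y k *\<^sub>C W2 k h)) has_sum ?g (T2 y h)) (mors L n)" .
  then have "((\<lambda>k. W2 k (tvec (E_tensor L m n x y, h) (cmp L l k))) has_sum ?g (T2 y h)) (mors_to n l)"
  proof (subst has_sum_cong_neutral[where T = "mors L n" and g = "\<lambda>k. ?g (y k *\<^sub>C W2 k h)"])
    fix k assume "k \<in> mors L n - mors_to n l"
    then have "P (src L l) (W2 k h) = 0"
      using W2(2) a by (auto simp: range_row_def mors_to_def)
    then show "?g (y k *\<^sub>C W2 k h) = 0"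
      by (simp add: BH_scaleC P_BH a scaleC.zero_right)
  next
    fix k assume "k \<in> mors_to n l \<inter> mors L n"
    then have k: "k \<in> mors L n" "src L l = rng L k" by (auto simp: mors_to_def)
    have BH: "W2 k \<in> BH" using W2(1) k row_contraction_BH by (auto simp: module_row_def)
    have "P (src L l) (W2 k h) = W2 k h"
      using W2(2) a k by (auto simp: range_row_def)
    moreover have "W2 k (P (src L k) h) = W2 k h"
      using W2(1) k by (auto simp: module_row_def)
    ultimately show "W2 k (tvec (E_tensor L m n x y, h) (cmp L l k)) = ?g (y k *\<^sub>C W2 k h)"
      using k l morsD src_cmp[of l k]
      by (simp add: tvec_def E_tensor_cmp BH_scaleC BH P_BH rng_mors scaleC_scaleC)
  qed (auto simp: mors_to_def)
  from infsumI[OF this] show ?thesis by (simp add: rowop_def tvec_def)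
qed

text \<open>The sum over paths of degree \<open>m + n\<close> is evaluated as an iterated sum over
  factorisations; \<open>rowop_mors_to\<close> computes the inner one.\<close>

lemma rowop_comp:
  assumes W1: "module_row m W1" and W2: "module_row n W2" "range_row n W2"
    and T1: "implements m W1 T1" and T2: "implements n W2 T2"
    and x: "x \<in> E L m" and y: "y \<in> E L n"
  shows "T1 x (T2 y h) =
    rowop (mors L (m + n)) (comp_row m n W1 W2) (tvec (E_tensor L m n x y, h))"
proof -
  let ?I = "mors L (m + n)" and ?W = "comp_row m n W1 W2" and ?f = "tvec (E_tensor L m n x y, h)"
  have r: "row_contraction ?I ?W" "row_contraction (mors L m) W1" "row_contraction (mors L n) W2"
    using module_row_comp[OF W1 W2(1)] W1 W2(1) by (auto simp: module_row_def)
  have f: "l2 ?I ?f" by (intro l2_tvec E_tensor_E x y)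
  have "((\<lambda>v. ?W v (?f v)) has_sum rowop ?I ?W ?f) ?I"
    by (rule rowop_has_sum[OF r(1) f])
  then have big: "((\<lambda>p. (\<lambda>v. ?W v (?f v)) (case p of (l, k) \<Rightarrow> cmp L l k)) has_sum rowop ?I ?W ?f)
      (SIGMA l:mors L m. mors_to n l)"
    by (subst has_sum_reindex_bij_betw[OF bij_betw_cmp])
  have "((\<lambda>l. W1 l (tvec (x, T2 y h) l)) has_sum rowop ?I ?W ?f) (mors L m)"
  proof (rule has_sum_SigmaD[OF big])
    fix l assume l: "l \<in> mors L m"
    have "((\<lambda>k. W2 k (?f (cmp L l k))) has_sum tvec (x, T2 y h) l) (mors_to n l)"
      unfolding rowop_mors_to[OF W2 T2 x y l, symmetric]
      by (rule rowop_has_sum[OF row_contraction_subset[OF r(3)] l2_Sigma(1)[OF f l]]) (auto simp: mors_to_def)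
    from has_sum_bounded_linear[OF blinfun.bounded_linear_right this, of "W1 l"]
    show "((\<lambda>k. ?W (case (l, k) of (l, k) \<Rightarrow> cmp L l k) (?f (case (l, k) of (l, k) \<Rightarrow> cmp L l k)))
        has_sum W1 l (tvec (x, T2 y h) l)) (mors_to n l)"
      by (subst has_sum_cong[where g = "\<lambda>k. W1 l (W2 k (?f (cmp L l k)))"])
        (use l factor_cmp in \<open>auto simp: comp_row_def mors_to_def\<close>)
  qed
  from infsumI[OF this] show ?thesis by (simp add: implementsD(2)[OF T1 x] rowop_def)
qed

lemma implements_comp:
  assumes W1: "module_row m W1" and W2: "module_row n W2" "range_row n W2"
    and T1: "implements m W1 T1" and T2: "implements n W2 T2"
    and T: "implements (m + n) (comp_row m n W1 W2) T"
    and x: "x \<in> E L m" and y: "y \<in> E L n"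
  shows "T (E_tensor L m n x y) = T1 x o\<^sub>L T2 y"
  by (rule blinfun_eqI)
    (simp add: rowop_comp[OF W1 W2 T1 T2 x y] implementsD(2)[OF T E_tensor_E[OF x y]])

text \<open>The action is a tensor product with degree zero, and composing with the row
  \<open>P\<close> on the left does not change a \<open>range_row\<close>, so this is a case of
  \<open>implements_comp\<close>. For the right action \<open>module_row\<close> plays that
  part.\<close>

lemma implements_left_act:
  assumes W: "module_row n W" "range_row n W" and \<sigma>: "implements 0 P \<sigma>" and T: "implements n W T"
    and f: "f \<in> A0 L" and x: "x \<in> E L n"
  shows "T (left_act L f x) = \<sigma> f o\<^sub>L T x"
proof -
  have "implements (0 + n) (comp_row 0 n P W) T"
  proof (rule implements_cong)
    show "implements (0 + n) W T" using T by simp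
    fix l assume "l \<in> mors L (0 + n)"
    then have l: "l \<in> mors L n" by simp
    then have "factor L 0 n l = (rng L l, l)"
      using factor_cmp[of "rng L l" 0 l n] cmp_rng[OF l] rng_mors[OF l] src_id by (simp add: mors_zero)
    then show "W l = comp_row 0 n P W l"
      using W(2) l rng_mors[OF l] by (intro blinfun_eqI) (simp add: comp_row_def range_row_def)
  qed simp
  from implements_comp[OF module_row_P W \<sigma> T this _ x] f E_tensor_left[OF x]
  show ?thesis by (simp add: A0_eq_E)
qed

lemma implements_right_act:
  assumes W: "module_row n W" and \<sigma>: "implements 0 P \<sigma>" and T: "implements n W T"
    and f: "f \<in> A0 L" and x: "x \<in> E L n"
  shows "T (right_act L x f) = T x o\<^sub>L \<sigma> f"
proof -
  have "implements (n + 0) (comp_row n 0 W P) T"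
  proof (rule implements_cong)
    show "implements (n + 0) W T" using T by simp
    fix l assume "l \<in> mors L (n + 0)"
    then have l: "l \<in> mors L n" by simp
    then have "factor L n 0 l = (l, src L l)"
      using factor_cmp[of l n "src L l" 0] cmp_src[OF l] src_mors[OF l] rng_id by (simp add: mors_zero)
    then show "W l = comp_row n 0 W P l"
      using W l by (intro blinfun_eqI) (simp add: comp_row_def module_row_def)
  qed simp
  from implements_comp[OF W module_row_P range_row_P T \<sigma> this x] f E_tensor_right[OF x]
  show ?thesis by (simp add: A0_eq_E)
qed

lemma implements_star_hom:
  assumes \<sigma>: "implements 0 P \<sigma>" and ext: "\<sigma> \<in> A0 L \<rightarrow>\<^sub>E BH"
  shows "star_hom L \<sigma>"
  unfolding star_hom_def
proof (intro conjI ballI allI)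
  fix f g assume f: "f \<in> A0 L" and g: "g \<in> A0 L"
  show "blinfun_apply (\<sigma> (\<lambda>a. b * f a + c * g a)) h = b *\<^sub>C \<sigma> f h + c *\<^sub>C \<sigma> g h" for b c h
    using implements_lincomb[OF module_row_P \<sigma>] f g by (simp add: A0_eq_E)
  show "\<sigma> (\<lambda>a. f a * g a) = \<sigma> f o\<^sub>L \<sigma> g"
    using implements_left_act[OF module_row_P range_row_P \<sigma> \<sigma> f, of g] g E_tensor_left[of g 0 f] E_tensor_A0[OF f g]
    by (simp add: A0_eq_E)
next
  fix f assume f: "f \<in> A0 L"
  then have f': "(\<lambda>a. cnj (f a)) \<in> A0 L"
    unfolding A0_def using tendsto_cnj[of f 0] by auto
  note sum = implements_has_sum[OF module_row_P \<sigma>, unfolded mors_zero]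
  have "cadj (\<sigma> f) = \<sigma> (\<lambda>a. cnj (f a))"
  proof (rule cadj_unique)
    fix h k
    have "((\<lambda>a. cinner (f a *\<^sub>C P a h) k) has_sum cinner (\<sigma> f h) k) (obj L)"
      using f by (intro has_sum_bounded_linear[OF cinner.bounded_linear_left] sum) (simp add: A0_eq_E)
    then have "((\<lambda>a. cinner h (cnj (f a) *\<^sub>C P a k)) has_sum cinner (\<sigma> f h) k) (obj L)"
      by (subst has_sum_cong[where g = "\<lambda>a. cinner (f a *\<^sub>C P a h) k"])
        (simp_all add: cinner_scaleC_left cinner_scaleC_right P_self)
    moreover have "((\<lambda>a. cinner h (cnj (f a) *\<^sub>C P a k)) has_sum
        cinner h (blinfun_apply (\<sigma> (\<lambda>a. cnj (f a))) k)) (obj L)"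
      using f' by (intro has_sum_bounded_linear[OF cinner.bounded_linear_right] sum) (simp add: A0_eq_E)
    ultimately show "cinner (\<sigma> f h) k = cinner h (blinfun_apply (\<sigma> (\<lambda>a. cnj (f a))) k)"
      using has_sum_unique by blast
  qed (use f' ext in auto)
  then show "\<sigma> (\<lambda>a. cnj (f a)) = cadj (\<sigma> f)" by simp
qed (rule ext)

section \<open>The internal tensor products and the commutation relation\<close>

abbreviation rsum :: "nat ^ 'r \<Rightarrow> ('l \<Rightarrow> ('h \<Rightarrow>\<^sub>L 'h)) \<Rightarrow> (('l \<Rightarrow> complex) \<times> 'h) list \<Rightarrow> 'h" where
  "rsum n W u \<equiv> rowop (mors L n) W (lsum tvec u)"

text \<open>Expanding \<open>\<sigma>\<close> at \<open>E_inner L n x y\<close> as the series of its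
  values times the projections \<open>P a\<close> gives the series of
  \<open>tvec_inner_has_sum\<close>.\<close>

lemma l2_kernel_ker1:
  assumes \<sigma>: "implements 0 P \<sigma>"
  shows "l2_kernel (gens1 L n) (ker1 L \<sigma> n) (mors L n) tvec"
proof
  fix g g' :: "('l \<Rightarrow> complex) \<times> 'h"
  assume "g \<in> gens1 L n" "g' \<in> gens1 L n"
  then obtain x h y k where g: "g = (x, h)" "g' = (y, k)" "x \<in> E L n" "y \<in> E L n"
    by (auto simp: gens1_def)
  have "((\<lambda>a. cinner h (E_inner L n x y a *\<^sub>C P a k)) has_sum
      cinner h (\<sigma> (E_inner L n x y) k)) (obj L)"
    using has_sum_bounded_linear[OF cinner.bounded_linear_right
        implements_has_sum[OF module_row_P \<sigma> E_inner_A0[OF g(3,4), unfolded A0_eq_E]]]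
    by (simp add: mors_zero)
  then show "ker1 L \<sigma> n g g' = (\<Sum>\<^sub>\<infinity>l\<in>mors L n. cinner (tvec g l) (tvec g' l))"
    using tvec_inner_has_sum[OF g(3,4), of h k] has_sum_unique
    by (force simp: g ker1_def cinner_scaleC_right)
qed (auto simp: gens1_def l2_tvec)

lemma merge2_gens: "g \<in> gens2 L m n \<Longrightarrow> merge2 L m n g \<in> gens1 L (m + n)"
  by (auto simp: gens2_def gens1_def merge2_def E_tensor_E)

lemma merge2_map_gens: "set u \<subseteq> gens2 L m n \<Longrightarrow> set (map (merge2 L m n) u) \<subseteq> gens1 L (m + n)"
  unfolding set_map image_subset_iff using merge2_gens by blast

lemma l2_kernel_ker2:
  assumes \<sigma>: "implements 0 P \<sigma>"
  shows "l2_kernel (gens2 L m n) (ker2 L \<sigma> m n) (mors L (m + n)) (\<lambda>g. tvec (merge2 L m n g))"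
proof -
  interpret l2_kernel "gens1 L (m + n)" "ker1 L \<sigma> (m + n)" "mors L (m + n)" tvec
    by (rule l2_kernel_ker1[OF \<sigma>])
  show ?thesis
    by unfold_locales (simp_all add: ker2_def l2_gen kernel merge2_gens)
qed

lemma ksum_dist_merge2: "ksum_dist (ker2 L \<sigma> m n) u v =
    ksum_dist (ker1 L \<sigma> (m + n)) (map (merge2 L m n) u) (map (merge2 L m n) v)"
  by (simp add: ksum_dist_def ksum_inner_def ker2_def o_def)

lemma rowop_lsum:
  assumes W: "row_contraction I W"
  shows "(\<And>g. g \<in> set u \<Longrightarrow> l2 I (\<phi> g)) \<Longrightarrow> l2 I (lsum \<phi> u) \<and> rowop I W (lsum \<phi> u) = (\<Sum>g\<leftarrow>u. rowop I W (\<phi> g))"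
proof (induction u)
  case Nil
  then show ?case by (simp add: lsum_def[abs_def] rowop_def blinfun.zero_right)
next
  case (Cons g u)
  have eq: "lsum \<phi> (g # u) = (\<lambda>i. \<phi> g i + lsum \<phi> u i)" by (simp add: fun_eq_iff)
  show ?case unfolding eq using Cons by (simp add: rowop_add[OF W] l2_add(1))
qed

definition apply2 :: "(('l \<Rightarrow> complex) \<Rightarrow> ('h \<Rightarrow>\<^sub>L 'h)) \<Rightarrow> ('l \<Rightarrow> complex) \<times> ('l \<Rightarrow> complex) \<times> 'h \<Rightarrow> ('l \<Rightarrow> complex) \<times> 'h" where
  "apply2 T = (\<lambda>(x, y, h). (x, T y h))"

lemma apply2_gens: "set u \<subseteq> gens2 L m n \<Longrightarrow> set (map (apply2 T) u) \<subseteq> gens1 L m"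
  by (auto simp: gens2_def gens1_def apply2_def)

text \<open>The linear extension of \<open>rowop_mors_to\<close> from single generators to formal
  sums.\<close>

lemma lsum_apply2:
  assumes W2: "module_row n W2" "range_row n W2" and T2: "implements n W2 T2"
    and u: "set u \<subseteq> gens2 L m n" and l: "l \<in> mors L m"
  shows "l2 (mors_to n l) (\<lambda>k. lsum tvec (map (merge2 L m n) u) (cmp L l k))"
    "rowop (mors_to n l) W2 (\<lambda>k. lsum tvec (map (merge2 L m n) u) (cmp L l k)) = lsum tvec (map (apply2 T2) u) l"
proof -
  have row: "row_contraction (mors_to n l) W2"
    using W2(1) by (auto simp: module_row_def mors_to_def intro: row_contraction_subset)
  let ?\<psi> = "\<lambda>g k. tvec (merge2 L m n g) (cmp L l k)"
  have eq: "(\<lambda>k. lsum tvec (map (merge2 L m n) u) (cmp L l k)) = lsum ?\<psi> u"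
    by (simp add: lsum_def o_def fun_eq_iff)
  have "l2 (mors_to n l) (?\<psi> g)" if "g \<in> set u" for g
    using that u by (intro l2_Sigma(1)[OF _ l]) (auto simp: merge2_def gens2_def l2_tvec E_tensor_E)
  then have 1: "l2 (mors_to n l) (lsum ?\<psi> u)" "rowop (mors_to n l) W2 (lsum ?\<psi> u) = (\<Sum>g\<leftarrow>u. rowop (mors_to n l) W2 (?\<psi> g))"
    using rowop_lsum[OF row, of u ?\<psi>] by blast+
  show "l2 (mors_to n l) (\<lambda>k. lsum tvec (map (merge2 L m n) u) (cmp L l k))" unfolding eq by (rule 1)
  have "rowop (mors_to n l) W2 (?\<psi> g) = tvec (apply2 T2 g) l" if "g \<in> set u" for g
    using that u rowop_mors_to[OF W2 T2 _ _ l] by (auto simp: gens2_def merge2_def apply2_def)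
  then have "(\<Sum>g\<leftarrow>u. rowop (mors_to n l) W2 (?\<psi> g)) = lsum tvec (map (apply2 T2) u) l"
    by (simp add: lsum_def o_def cong: map_cong)
  then show "rowop (mors_to n l) W2 (\<lambda>k. lsum tvec (map (merge2 L m n) u) (cmp L l k)) = lsum tvec (map (apply2 T2) u) l"
    unfolding eq using 1 by simp
qed

lemma l2_lsum_merge2:
  assumes "set u \<subseteq> gens2 L m n"
  shows "l2 (mors L (m + n)) (lsum tvec (map (merge2 L m n) u))"
proof -
  \<comment> \<open>The zero row is a dummy: only the square-summability half of
    \<open>rowop_lsum\<close> is wanted.\<close>
  have "row_contraction (mors L (m + n)) (\<lambda>_. 0 :: 'h \<Rightarrow>\<^sub>L 'h)" by (simp add: row_contraction_def)
  from rowop_lsum[OF this, of "map (merge2 L m n) u" tvec] show ?thesis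
    using assms by (force simp: gens2_def merge2_def l2_tvec E_tensor_E)
qed

text \<open>Tensoring with the identity keeps the map of \<open>T2\<close> a contraction: each
  coordinate is a row operator applied to one fibre, and \<open>l2_Sigma\<close> reassembles the
  fibres. It is what lets \<open>id_tensor_T_tilde\<close> send Cauchy sequences to Cauchy
  sequences.\<close>

lemma ksum_dist_apply2_le:
  assumes W2: "module_row n W2" "range_row n W2" and \<sigma>: "implements 0 P \<sigma>" and T2: "implements n W2 T2"
    and u: "set u \<subseteq> gens2 L m n" and v: "set v \<subseteq> gens2 L m n"
  shows "ksum_dist (ker1 L \<sigma> m) (map (apply2 T2) u) (map (apply2 T2) v) \<le> ksum_dist (ker2 L \<sigma> m n) u v"
proof -
  interpret k1: l2_kernel "gens1 L m" "ker1 L \<sigma> m" "mors L m" tvec by (rule l2_kernel_ker1[OF \<sigma>])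
  interpret k12: l2_kernel "gens1 L (m + n)" "ker1 L \<sigma> (m + n)" "mors L (m + n)" tvec
    by (rule l2_kernel_ker1[OF \<sigma>])
  let ?d = "\<lambda>v'. lsum tvec (map (merge2 L m n) u) v' - lsum tvec (map (merge2 L m n) v) v'"
  have d: "l2 (mors L (m + n)) ?d" by (intro l2_diff l2_lsum_merge2 u v)
  have "norm (lsum tvec (map (apply2 T2) u) l - lsum tvec (map (apply2 T2) v) l) \<le> l2n (mors_to n l) (\<lambda>k. ?d (cmp L l k))"
    if l: "l \<in> mors L m" for l
  proof -
    have row: "row_contraction (mors_to n l) W2"
      using W2(1) by (auto simp: module_row_def mors_to_def intro: row_contraction_subset)
    note lu = lsum_apply2[OF W2 T2 u l] and lv = lsum_apply2[OF W2 T2 v l]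
    show ?thesis
      unfolding lu(2)[symmetric] lv(2)[symmetric] rowop_diff[OF row lu(1) lv(1), symmetric]
      by (rule norm_rowop_le[OF row l2_diff(1)[OF lu(1) lv(1)]])
  qed
  then have "L2_set (\<lambda>l. norm (lsum tvec (map (apply2 T2) u) l - lsum tvec (map (apply2 T2) v) l)) F \<le> l2n (mors L (m + n)) ?d"
    if "finite F" "F \<subseteq> mors L m" for F
    by (intro order.trans[OF L2_set_mono l2_Sigma(2)[OF d that]]) (use that in auto)
  then have "l2n (mors L m) (\<lambda>l. lsum tvec (map (apply2 T2) u) l - lsum tvec (map (apply2 T2) v) l) \<le> l2n (mors L (m + n)) ?d"
    by (intro l2_boundI(2)) auto
  moreover have "set (map (merge2 L m n) u) \<subseteq> gens1 L (m + n)" "set (map (merge2 L m n) v) \<subseteq> gens1 L (m + n)"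
    using merge2_map_gens u v by blast+
  ultimately show ?thesis
    by (simp only: ksum_dist_merge2 k1.ksum_dist_eq[OF apply2_gens[OF u] apply2_gens[OF v]] k12.ksum_dist_eq)
qed

lemma T_tilde_sum_eq:
  assumes W: "module_row n W" and T: "implements n W T" and u: "set u \<subseteq> gens1 L n"
  shows "(\<Sum>(x, h)\<leftarrow>u. T x h) = rsum n W u"
proof -
  have row: "row_contraction (mors L n) W" using W by (simp add: module_row_def)
  have "rsum n W u = (\<Sum>g\<leftarrow>u. rowop (mors L n) W (tvec g))"
    using rowop_lsum[OF row, of u tvec] u by (force simp: gens1_def l2_tvec)
  also have "\<dots> = (\<Sum>(x, h)\<leftarrow>u. T x h)"
    using u by (intro arg_cong[where f = sum_list] map_cong) (auto simp: gens1_def implementsD(2)[OF T])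
  finally show ?thesis by simp
qed

text \<open>Row operators are nonexpansive for \<open>ksum_dist\<close>, so limits along a Cauchy
  sequence exist and depend only on its class.\<close>

lemma norm_rowop_diff_le:
  assumes \<sigma>: "implements 0 P \<sigma>" and W: "module_row n W"
    and u: "set u \<subseteq> gens1 L n" and v: "set v \<subseteq> gens1 L n"
  shows "norm (rsum n W u - rsum n W v) \<le> ksum_dist (ker1 L \<sigma> n) u v"
proof -
  interpret l2_kernel "gens1 L n" "ker1 L \<sigma> n" "mors L n" tvec by (rule l2_kernel_ker1[OF \<sigma>])
  have row: "row_contraction (mors L n) W" using W by (simp add: module_row_def)
  show ?thesis
    unfolding ksum_dist_eq[OF u v] rowop_diff[OF row l2_lsum[OF u] l2_lsum[OF v], symmetric]
    by (rule norm_rowop_le[OF row l2_diff(1)[OF l2_lsum[OF u] l2_lsum[OF v]]])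
qed

lemma T_tilde_apply2_sum_eq:
  assumes W1: "module_row m W1" and W2: "module_row n W2" "range_row n W2"
    and T1: "implements m W1 T1" and T2: "implements n W2 T2" and u: "set u \<subseteq> gens2 L m n"
  shows "(\<Sum>(x, h)\<leftarrow>map (apply2 T2) u. T1 x h) =
    rsum (m + n) (comp_row m n W1 W2) (map (merge2 L m n) u)"
proof -
  have row: "row_contraction (mors L (m + n)) (comp_row m n W1 W2)"
    using module_row_comp[OF W1 W2(1)] by (simp add: module_row_def)
  have "(\<Sum>(x, h)\<leftarrow>map (apply2 T2) u. T1 x h) =
      (\<Sum>g\<leftarrow>map (merge2 L m n) u. rowop (mors L (m + n)) (comp_row m n W1 W2) (tvec g))"
    unfolding map_map o_def using u
    by (intro arg_cong[where f = sum_list] map_cong)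
      (auto simp: gens2_def apply2_def merge2_def rowop_comp[OF W1 W2 T1 T2])
  also have "\<dots> = rsum (m + n) (comp_row m n W1 W2) (map (merge2 L m n) u)"
    using rowop_lsum[OF row, of "map (merge2 L m n) u" tvec] u
    by (force simp: gens2_def merge2_def l2_tvec E_tensor_E)
  finally show ?thesis .
qed

text \<open>\<open>S\<close> is any nonempty set of Cauchy sequences with a common limit, not
  necessarily a class, so that the result applies to \<open>flip_tensor_id\<close> as well as to
  elements of the completion.\<close>

lemma T_tilde_id_tensor:
  assumes W1: "module_row m W1" and W2: "module_row n W2" "range_row n W2" and \<sigma>: "implements 0 P \<sigma>"
    and T1: "implements m W1 T1" and T2: "implements n W2 T2"
    and S: "S \<subseteq> kcauchy (gens2 L m n) (ker2 L \<sigma> m n)" "S \<noteq> {}"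
    and lim: "\<And>X. X \<in> S \<Longrightarrow> (\<lambda>p. rsum (m + n) (comp_row m n W1 W2) (map (merge2 L m n) (X p))) \<longlonglongrightarrow> v"
  shows "T_tilde T1 (id_tensor_T_tilde L \<sigma> m T2 S) = v"
proof -
  interpret k1: l2_kernel "gens1 L m" "ker1 L \<sigma> m" "mors L m" tvec by (rule l2_kernel_ker1[OF \<sigma>])
  let ?i = "\<lambda>X p. map (apply2 T2) (X p)"
  have eq: "id_tensor_T_tilde L \<sigma> m T2 S = kequiv (gens1 L m) (ker1 L \<sigma> m) `` (?i ` S)"
    by (simp add: id_tensor_T_tilde_def apply2_def)
  have set: "set (X p) \<subseteq> gens2 L m n" if "X \<in> S" for X p
    using that S by (auto simp: kcauchy_def)
  have cauchy: "?i X \<in> kcauchy (gens1 L m) (ker1 L \<sigma> m)" if X: "X \<in> S" for X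
    unfolding kcauchy_def
  proof (intro CollectI conjI allI impI)
    show "set (?i X p) \<subseteq> gens1 L m" for p by (rule apply2_gens[OF set[OF X]])
    fix e :: real assume "e > 0"
    then obtain M where "\<forall>p\<ge>M. \<forall>q\<ge>M. ksum_dist (ker2 L \<sigma> m n) (X p) (X q) < e"
      using X S(1) unfolding kcauchy_def by blast
    then show "\<exists>M. \<forall>p\<ge>M. \<forall>q\<ge>M. ksum_dist (ker1 L \<sigma> m) (?i X p) (?i X q) < e"
      using ksum_dist_apply2_le[OF W2 \<sigma> T2 set[OF X] set[OF X]] by (meson le_less_trans)
  qed
  show ?thesis
    unfolding eq
  proof (rule T_tilde_eqI)
    show "kequiv (gens1 L m) (ker1 L \<sigma> m) `` (?i ` S) \<noteq> {}"
      using S(2) k1.kequiv_refl[OF cauchy] by blast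
    fix Z assume "Z \<in> kequiv (gens1 L m) (ker1 L \<sigma> m) `` (?i ` S)"
    then obtain X where X: "X \<in> S" and Z: "(?i X, Z) \<in> kequiv (gens1 L m) (ker1 L \<sigma> m)" by blast
    then have Zset: "set (Z p) \<subseteq> gens1 L m" for p by (auto simp: kequiv_def kcauchy_def)
    show "(\<lambda>p. \<Sum>(x, h)\<leftarrow>Z p. T1 x h) \<longlonglongrightarrow> v"
    proof (rule tendsto_norm_diff_le)
      show "(\<lambda>p. \<Sum>(x, h)\<leftarrow>?i X p. T1 x h) \<longlonglongrightarrow> v"
        unfolding T_tilde_apply2_sum_eq[OF W1 W2 T1 T2 set[OF X]] by (rule lim[OF X])
      show "(\<lambda>p. ksum_dist (ker1 L \<sigma> m) (?i X p) (Z p)) \<longlonglongrightarrow> 0" using Z by (simp add: kequiv_def)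
      show "norm ((\<Sum>(x, h)\<leftarrow>?i X p. T1 x h) - (\<Sum>(x, h)\<leftarrow>Z p. T1 x h)) \<le>
          ksum_dist (ker1 L \<sigma> m) (?i X p) (Z p)" for p
        unfolding T_tilde_sum_eq[OF W1 T1 apply2_gens[OF set[OF X]]] T_tilde_sum_eq[OF W1 T1 Zset]
        by (rule norm_rowop_diff_le[OF \<sigma> W1 apply2_gens[OF set[OF X]] Zset])
    qed
  qed
qed

lemma merge2_map_gens': "set u \<subseteq> gens2 L n m \<Longrightarrow> set (map (merge2 L n m) u) \<subseteq> gens1 L (m + n)"
  using merge2_map_gens[of u n m] by (simp add: add.commute)

text \<open>The span of the elementary tensors in the other order is dense, so \<open>flip_tensor_id\<close> never yields
  the empty set, on which \<open>T_tilde\<close> would be a junk value.\<close>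

lemma flip_dense:
  assumes \<sigma>: "implements 0 P \<sigma>" and u: "set u \<subseteq> gens2 L m n" and e: "e > 0"
  shows "\<exists>w. set w \<subseteq> gens2 L n m \<and>
    ksum_dist (ker1 L \<sigma> (m + n)) (map (merge2 L m n) u) (map (merge2 L n m) w) < e"
proof -
  interpret l2_kernel "gens1 L (m + n)" "ker1 L \<sigma> (m + n)" "mors L (m + n)" tvec
    by (rule l2_kernel_ker1[OF \<sigma>])
  let ?I = "mors L (m + n)"
  define f where "f = lsum tvec (map (merge2 L m n) u)"
  have f: "l2 ?I f" unfolding f_def by (rule l2_lsum_merge2[OF u])
  have Pf: "P (src L l) (f l) = f l" if l: "l \<in> ?I" for l
    using l src_mors[OF l] unfolding f_def
    by (induction u) (auto simp: blinfun.zero_right blinfun.add_right merge2_def tvec_def BH_scaleC P_BH P_idem)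
  obtain F where F: "finite F" "F \<subseteq> ?I" "(\<Sum>\<^sub>\<infinity>l\<in>?I - F. (norm (f l))\<^sup>2) < e\<^sup>2"
    using summable_on_small_tail[of "\<lambda>l. (norm (f l))\<^sup>2" ?I "e\<^sup>2"] f e by (auto simp: l2_def)
  obtain vs where vs: "set vs = F" "distinct vs" using finite_distinct_list[OF F(1)] by blast
  \<comment> \<open>Each \<open>v\<close> is factored in the other order, \<open>n\<close> before
    \<open>m\<close>. The two Dirac functions merge to the one at \<open>v\<close>, and by
    \<open>Pf\<close> the projection in \<open>tvec\<close> leaves \<open>f v\<close> unchanged, so
    this generator contributes exactly the coordinate \<open>f v\<close>.\<close>
  define G where "G v = (dirac (fst (factor L n m v)) :: 'l \<Rightarrow> complex, dirac (snd (factor L n m v)) :: 'l \<Rightarrow> complex, f v)" for v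
  have G: "G v \<in> gens2 L n m \<and> merge2 L n m (G v) = (dirac v, f v)" if "v \<in> F" for v
  proof -
    have "v \<in> mors L (n + m)" using that F by (auto simp: add.commute)
    then show ?thesis
      by (cases rule: factor_cases) (auto simp: G_def gens2_def merge2_def dirac_E E_tensor_dirac)
  qed
  have w: "set (map G vs) \<subseteq> gens2 L n m" using G vs by auto
  have "lsum tvec (map (merge2 L n m) (map G vs)) l = (if l \<in> F then f l else 0)" if l: "l \<in> ?I" for l
  proof -
    have "lsum tvec (map (merge2 L n m) (map G vs)) l = (\<Sum>v\<leftarrow>vs. tvec (merge2 L n m (G v)) l)"
      by (simp add: lsum_def o_def)
    also have "\<dots> = (\<Sum>v\<in>F. tvec (merge2 L n m (G v)) l)"
      using vs by (simp add: sum_list_distinct_conv_sum_set)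
    also have "\<dots> = (\<Sum>v\<in>F. if v = l then f l else 0)"
      using G Pf[OF l] by (intro sum.cong) (auto simp: tvec_def dirac_def scaleC.zero_left)
    also have "\<dots> = (if l \<in> F then f l else 0)" using F(1) by simp
    finally show ?thesis .
  qed
  then have "(\<Sum>\<^sub>\<infinity>l\<in>?I. (norm (f l - lsum tvec (map (merge2 L n m) (map G vs)) l))\<^sup>2) =
      (\<Sum>\<^sub>\<infinity>l\<in>?I - F. (norm (f l))\<^sup>2)"
    by (intro infsum_cong_neutral) auto
  then have "l2n ?I (\<lambda>l. f l - lsum tvec (map (merge2 L n m) (map G vs)) l) < e"
    unfolding l2n_def using F(3) e by (metis real_sqrt_less_mono real_sqrt_abs abs_of_pos)
  then have "ksum_dist (ker1 L \<sigma> (m + n)) (map (merge2 L m n) u) (map (merge2 L n m) (map G vs)) < e"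
    unfolding f_def ksum_dist_eq[OF merge2_map_gens[OF u] merge2_map_gens'[OF w]] .
  with w show ?thesis by blast
qed

lemma flip_properties:
  assumes \<sigma>: "implements 0 P \<sigma>" and C: "C \<in> kcompletion (gens2 L m n) (ker2 L \<sigma> m n)" and X: "X \<in> C"
  shows "flip_tensor_id L \<sigma> m n C \<subseteq> kcauchy (gens2 L n m) (ker2 L \<sigma> n m)"
    "flip_tensor_id L \<sigma> m n C \<noteq> {}"
    "Y \<in> flip_tensor_id L \<sigma> m n C \<Longrightarrow>
      (\<lambda>p. ksum_dist (ker1 L \<sigma> (m + n)) (map (merge2 L m n) (X p)) (map (merge2 L n m) (Y p))) \<longlonglongrightarrow> 0"
proof -
  interpret k12: l2_kernel "gens1 L (m + n)" "ker1 L \<sigma> (m + n)" "mors L (m + n)" tvec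
    by (rule l2_kernel_ker1[OF \<sigma>])
  interpret k2: l2_kernel "gens2 L m n" "ker2 L \<sigma> m n" "mors L (m + n)" "\<lambda>g. tvec (merge2 L m n g)"
    by (rule l2_kernel_ker2[OF \<sigma>])
  show "flip_tensor_id L \<sigma> m n C \<subseteq> kcauchy (gens2 L n m) (ker2 L \<sigma> n m)"
    by (auto simp: flip_tensor_id_def)
  show "Y \<in> flip_tensor_id L \<sigma> m n C \<Longrightarrow>
      (\<lambda>p. ksum_dist (ker1 L \<sigma> (m + n)) (map (merge2 L m n) (X p)) (map (merge2 L n m) (Y p))) \<longlonglongrightarrow> 0"
    using X by (auto simp: flip_tensor_id_def)
  have X_set: "set (X p) \<subseteq> gens2 L m n" for p using k2.kcompletion_dist(1)[OF C X X] k2.kcauchy_set by blast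
  let ?d = "ksum_dist (ker1 L \<sigma> (m + n))" and ?m = "map (merge2 L m n)" and ?m' = "map (merge2 L n m)"
  \<comment> \<open>One representative \<open>X\<close> is approximated termwise with errors tending
    to zero. The approximants inherit the Cauchy property, and stay at distance tending to zero from
    every other representative of the class.\<close>
  have "\<exists>w. set w \<subseteq> gens2 L n m \<and> ?d (?m (X p)) (?m' w) < inverse (real (Suc p))" for p
    by (rule flip_dense[OF \<sigma> X_set]) simp
  then obtain Y where Y: "\<And>p. set (Y p) \<subseteq> gens2 L n m" "\<And>p. ?d (?m (X p)) (?m' (Y p)) < inverse (real (Suc p))"
    by metis
  note m = merge2_map_gens merge2_map_gens'
  have lim: "(\<lambda>p. ?d (?m (X p)) (?m' (Y p))) \<longlonglongrightarrow> 0"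
  proof (rule tendsto_sandwich[OF _ _ tendsto_const LIMSEQ_inverse_real_of_nat])
    show "\<forall>\<^sub>F p in sequentially. 0 \<le> ?d (?m (X p)) (?m' (Y p))"
      using k12.ksum_dist_nonneg[OF m(1)[OF X_set] m(2)[OF Y(1)]] by simp
  qed (use Y(2) in \<open>auto intro: always_eventually less_imp_le\<close>)
  have "(\<lambda>p. ?m (X p)) \<in> kcauchy (gens1 L (m + n)) (ker1 L \<sigma> (m + n))"
    using k2.kcompletion_dist(1)[OF C X X] m(1)[OF X_set] by (simp add: kcauchy_def ksum_dist_merge2)
  from k12.kcauchy_approx[OF this m(2)[OF Y(1)] lim]
  have "Y \<in> kcauchy (gens2 L n m) (ker2 L \<sigma> n m)"
    using Y(1) by (simp add: kcauchy_def ksum_dist_merge2 add.commute[of n m])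
  moreover have "(\<lambda>p. ?d (?m (Z p)) (?m' (Y p))) \<longlonglongrightarrow> 0" if Z: "Z \<in> C" for Z
  proof (rule k12.ksum_dist_tendsto_trans)
    show "(\<lambda>p. ?d (?m (X p)) (?m (Z p))) \<longlonglongrightarrow> 0"
      using k2.kcompletion_dist(2)[OF C X Z] by (simp add: ksum_dist_merge2)
    show "set (?m (Z p)) \<subseteq> gens1 L (m + n)" for p
      using k2.kcompletion_dist(1)[OF C Z Z] by (intro m(1) k2.kcauchy_set)
  qed (rule m X_set Y(1) lim)+
  ultimately show "flip_tensor_id L \<sigma> m n C \<noteq> {}" by (auto simp: flip_tensor_id_def)
qed

text \<open>Both sides are limits along the same merged sums, for the two composed rows. The flipped
  sequences are replaced by \<open>X\<close> since they differ from it by a null distance in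
  \<open>E L (m + n)\<close> tensor the Hilbert space.\<close>

lemma commutation_sides:
  assumes W1: "module_row m W1" "range_row m W1" and W2: "module_row n W2" "range_row n W2"
    and \<sigma>: "implements 0 P \<sigma>" and T1: "implements m W1 T1" and T2: "implements n W2 T2"
    and C: "C \<in> kcompletion (gens2 L m n) (ker2 L \<sigma> m n)" and X: "X \<in> C"
  shows "(\<lambda>p. rsum (m + n) (comp_row m n W1 W2) (map (merge2 L m n) (X p)))
      \<longlonglongrightarrow> T_tilde T1 (id_tensor_T_tilde L \<sigma> m T2 C)"
    "(\<lambda>p. rsum (m + n) (comp_row n m W2 W1) (map (merge2 L m n) (X p)))
      \<longlonglongrightarrow> T_tilde T2 (id_tensor_T_tilde L \<sigma> n T1 (flip_tensor_id L \<sigma> m n C))"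
proof -
  interpret k2: l2_kernel "gens2 L m n" "ker2 L \<sigma> m n" "mors L (m + n)" "\<lambda>g. tvec (merge2 L m n g)"
    by (rule l2_kernel_ker2[OF \<sigma>])
  let ?d = "ksum_dist (ker1 L \<sigma> (m + n))" and ?m = "map (merge2 L m n)" and ?m' = "map (merge2 L n m)"
  have set: "set (Y p) \<subseteq> gens2 L m n" if "Y \<in> C" for Y p
    using k2.kcompletion_dist(1)[OF C that that] k2.kcauchy_set by blast
  have conv: "\<exists>v. (\<lambda>p. rsum (m + n) W (?m (X p))) \<longlonglongrightarrow> v"
    if W: "module_row (m + n) W" for W
  proof -
    have "Cauchy (\<lambda>p. rsum (m + n) W (?m (X p)))"
    proof (rule metric_CauchyI)
      fix e :: real assume "e > 0"
      then obtain M where M: "\<forall>p\<ge>M. \<forall>q\<ge>M. ksum_dist (ker2 L \<sigma> m n) (X p) (X q) < e"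
        using k2.kcompletion_dist(1)[OF C X X] unfolding kcauchy_def by blast
      have "dist (rsum (m + n) W (?m (X p))) (rsum (m + n) W (?m (X q))) < e"
        if "p \<ge> M" "q \<ge> M" for p q
        using norm_rowop_diff_le[OF \<sigma> W merge2_map_gens[OF set[OF X]] merge2_map_gens[OF set[OF X]], of p q] M that
        unfolding dist_norm ksum_dist_merge2[symmetric] by (meson le_less_trans)
      then show "\<exists>M. \<forall>p\<ge>M. \<forall>q\<ge>M. dist (rsum (m + n) W (?m (X p)))
          (rsum (m + n) W (?m (X q))) < e" by blast
    qed
    then show ?thesis using Cauchy_convergent_iff convergent_def by blast
  qed
  note Wc = module_row_comp[OF W1(1) W2(1)]
  have Wc': "module_row (m + n) (comp_row n m W2 W1)"
    using module_row_comp[OF W2(1) W1(1)] by (simp add: add.commute)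
  obtain v where v: "(\<lambda>p. rsum (m + n) (comp_row m n W1 W2) (?m (X p))) \<longlonglongrightarrow> v"
    using conv[OF Wc] by blast
  have "T_tilde T1 (id_tensor_T_tilde L \<sigma> m T2 C) = v"
  proof (rule T_tilde_id_tensor[OF W1(1) W2 \<sigma> T1 T2])
    show "C \<subseteq> kcauchy (gens2 L m n) (ker2 L \<sigma> m n)" using k2.kcompletion_dist(1)[OF C] by blast
    show "C \<noteq> {}" using X by blast
    fix Y assume Y: "Y \<in> C"
    show "(\<lambda>p. rsum (m + n) (comp_row m n W1 W2) (?m (Y p))) \<longlonglongrightarrow> v"
      by (rule tendsto_norm_diff_le[OF v k2.kcompletion_dist(2)[OF C X Y, unfolded ksum_dist_merge2]])
        (rule norm_rowop_diff_le[OF \<sigma> Wc merge2_map_gens[OF set[OF X]] merge2_map_gens[OF set[OF Y]]])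
  qed
  with v show "(\<lambda>p. rsum (m + n) (comp_row m n W1 W2) (?m (X p)))
      \<longlonglongrightarrow> T_tilde T1 (id_tensor_T_tilde L \<sigma> m T2 C)" by simp
  obtain w where w: "(\<lambda>p. rsum (m + n) (comp_row n m W2 W1) (?m (X p))) \<longlonglongrightarrow> w"
    using conv[OF Wc'] by blast
  note flip = flip_properties[OF \<sigma> C X]
  have "T_tilde T2 (id_tensor_T_tilde L \<sigma> n T1 (flip_tensor_id L \<sigma> m n C)) = w"
  proof (rule T_tilde_id_tensor[OF W2(1) W1 \<sigma> T2 T1 flip(1,2)])
    fix Y assume Y: "Y \<in> flip_tensor_id L \<sigma> m n C"
    then have Yset: "set (Y p) \<subseteq> gens2 L n m" for p using flip(1) by (auto simp: kcauchy_def)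
    have "(\<lambda>p. rsum (m + n) (comp_row n m W2 W1) (?m' (Y p))) \<longlonglongrightarrow> w"
      by (rule tendsto_norm_diff_le[OF w flip(3)[OF Y]])
        (rule norm_rowop_diff_le[OF \<sigma> Wc' merge2_map_gens[OF set[OF X]] merge2_map_gens'[OF Yset]])
    then show "(\<lambda>p. rsum (n + m) (comp_row n m W2 W1) (?m' (Y p))) \<longlonglongrightarrow> w"
      by (simp add: add.commute)
  qed
  with w show "(\<lambda>p. rsum (m + n) (comp_row n m W2 W1) (?m (X p)))
      \<longlonglongrightarrow> T_tilde T2 (id_tensor_T_tilde L \<sigma> n T1 (flip_tensor_id L \<sigma> m n C))" by simp
qed

text \<open>For necessity, the relation is evaluated at a single elementary tensor of Dirac
  functions and \<open>h\<close>, which isolates one entry of each composed row. For sufficiency,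
  equal rows give equal sequences, and limits are unique.\<close>

lemma commutation_iff:
  assumes W1: "module_row m W1" "range_row m W1" and W2: "module_row n W2" "range_row n W2"
    and \<sigma>: "implements 0 P \<sigma>" and T1: "implements m W1 T1" and T2: "implements n W2 T2"
  shows "(\<forall>C\<in>kcompletion (gens2 L m n) (ker2 L \<sigma> m n).
      T_tilde T1 (id_tensor_T_tilde L \<sigma> m T2 C) =
      T_tilde T2 (id_tensor_T_tilde L \<sigma> n T1 (flip_tensor_id L \<sigma> m n C))) \<longleftrightarrow>
    (\<forall>v\<in>mors L (m + n). comp_row m n W1 W2 v = comp_row n m W2 W1 v)"
proof -
  interpret k2: l2_kernel "gens2 L m n" "ker2 L \<sigma> m n" "mors L (m + n)" "\<lambda>g. tvec (merge2 L m n g)"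
    by (rule l2_kernel_ker2[OF \<sigma>])
  show ?thesis
  proof (intro iffI ballI)
    note Wc = module_row_comp[OF W1(1) W2(1)]
    have Wc': "module_row (m + n) (comp_row n m W2 W1)"
      using module_row_comp[OF W2(1) W1(1)] by (simp add: add.commute)
    fix v assume comm: "\<forall>C\<in>kcompletion (gens2 L m n) (ker2 L \<sigma> m n).
        T_tilde T1 (id_tensor_T_tilde L \<sigma> m T2 C) =
        T_tilde T2 (id_tensor_T_tilde L \<sigma> n T1 (flip_tensor_id L \<sigma> m n C))"
      and v: "v \<in> mors L (m + n)"
    from v obtain l k where lk: "l \<in> mors L m" "k \<in> mors L n" "src L l = rng L k" "v = cmp L l k"
      by (rule factor_cases)
    show "comp_row m n W1 W2 v = comp_row n m W2 W1 v"
    proof (rule blinfun_eqI)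
      fix h :: 'h
      define X where "X = (\<lambda>p :: nat. [(dirac l :: 'l \<Rightarrow> complex, dirac k :: 'l \<Rightarrow> complex, h)])"
      have X: "X \<in> kcauchy (gens2 L m n) (ker2 L \<sigma> m n)"
        unfolding X_def using lk by (intro k2.kcauchy_const) (auto simp: gens2_def dirac_E)
      define C where "C = kequiv (gens2 L m n) (ker2 L \<sigma> m n) `` {X}"
      have C: "C \<in> kcompletion (gens2 L m n) (ker2 L \<sigma> m n)" "X \<in> C"
        using X k2.kequiv_refl[OF X] by (auto simp: kcompletion_def C_def intro: quotientI)
      have rowop: "rsum (m + n) W (map (merge2 L m n) (X p)) = W v h"
        if W: "module_row (m + n) W" for W p
      proof -
        \<comment> \<open>An auxiliary map implementing \<open>W\<close> lets
          \<open>implements_dirac\<close> supply the value of the row operator at a Dirac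
          function.\<close>
        obtain T where T: "implements (m + n) W T" using implements_exists[OF W] by blast
        have "lsum tvec (map (merge2 L m n) (X p)) = tvec (dirac v, h)"
          using lk by (simp add: X_def lsum_def merge2_def E_tensor_dirac fun_eq_iff)
        then show ?thesis
          using implementsD(2)[OF T dirac_E[OF v], of h] implements_dirac[OF W T v] by simp
      qed
      note sides = commutation_sides[OF W1 W2 \<sigma> T1 T2 C, unfolded rowop[OF Wc] rowop[OF Wc'] LIMSEQ_const_iff]
      show "comp_row m n W1 W2 v h = comp_row n m W2 W1 v h"
        using sides comm C(1) by simp
    qed
  next
    fix C assume eq: "\<forall>v\<in>mors L (m + n). comp_row m n W1 W2 v = comp_row n m W2 W1 v"
      and C: "C \<in> kcompletion (gens2 L m n) (ker2 L \<sigma> m n)"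
    obtain X where X: "X \<in> C" using k2.kcompletion_nonempty[OF C] by blast
    have "rowop (mors L (m + n)) (comp_row m n W1 W2) = rowop (mors L (m + n)) (comp_row n m W2 W1)"
      using eq by (auto simp: rowop_def fun_eq_iff intro!: infsum_cong)
    then show "T_tilde T1 (id_tensor_T_tilde L \<sigma> m T2 C) =
        T_tilde T2 (id_tensor_T_tilde L \<sigma> n T1 (flip_tensor_id L \<sigma> m n C))"
      using commutation_sides[OF W1 W2 \<sigma> T1 T2 C X] LIMSEQ_unique by metis
  qed
qed

end

section \<open>Extending a family on the edges to all paths\<close>

lemma blinfun_compose_assoc: "(A o\<^sub>L B) o\<^sub>L C = A o\<^sub>L (B o\<^sub>L C)"
  by (rule blinfun_eqI) simp

definition dsize :: "nat ^ 'r::finite \<Rightarrow> nat" where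
  "dsize n = (\<Sum>i\<in>UNIV. n $ i)"

lemma dsize_add: "dsize (m + n) = dsize m + dsize n"
  by (simp add: dsize_def sum.distrib)

lemma dsize_unit_deg [simp]: "dsize (axis j (Suc 0)) = 1"
  by (simp add: dsize_def axis_def)

lemma dsize_eq_0: "dsize n = 0 \<longleftrightarrow> n = 0"
  by (simp add: dsize_def vec_eq_iff)

lemma degree_split:
  assumes "0 < n $ j" shows "\<exists>n'. n = unit_deg j + n'"
  by (rule exI[of _ "\<chi> i. if i = j then n $ i - 1 else n $ i"]) (use assms in \<open>auto simp: vec_eq_iff axis_def\<close>)

lemma degree_cases:
  fixes n :: "nat ^ 'r::finite"
  obtains "n = 0" | j n' where "n = unit_deg j + n'"
proof (cases "n = 0")
  case False
  then obtain j where "0 < n $ j" by (auto simp: vec_eq_iff)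
  then show ?thesis using degree_split that(2) by blast
qed (rule that(1))

context higher_rank_graph
begin

lemma edge_decomposition:
  assumes "l \<in> mors L (unit_deg j + n)"
  obtains e k where "e \<in> mors L (unit_deg j)" "k \<in> mors L n" "src L e = rng L k" "l = cmp L e k"
  using assms by (rule factor_cases)

lemma deg_cmp_mors: "e \<in> mors L n \<Longrightarrow> k \<in> mor L \<Longrightarrow> src L e = rng L k \<Longrightarrow> deg L (cmp L e k) = n + deg L k"
  by (auto simp: mors_def deg_cmp)

lemma mor_mors: "l \<in> mor L \<longleftrightarrow> l \<in> mors L (deg L l)"
  by (simp add: mors_def)

lemma mor_induct [consumes 1, case_names object edge]:
  assumes "l \<in> mor L" and "\<And>a. a \<in> obj L \<Longrightarrow> Q a"
    and "\<And>j e k. e \<in> mors L (unit_deg j) \<Longrightarrow> k \<in> mor L \<Longrightarrow> src L e = rng L k \<Longrightarrow> Q k \<Longrightarrow> Q (cmp L e k)"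
  shows "Q l"
  using assms(1)
proof (induction "dsize (deg L l)" arbitrary: l rule: less_induct)
  case less
  show ?case
  proof (cases rule: degree_cases[of "deg L l"])
    case 1
    then show ?thesis using less.prems mors_zero assms(2) by (auto simp: mor_mors)
  next
    case (2 j n)
    then have "l \<in> mors L (unit_deg j + n)" using less.prems by (simp add: mor_mors)
    then obtain e k where ek: "e \<in> mors L (unit_deg j)" "k \<in> mors L n" "src L e = rng L k" "l = cmp L e k"
      by (rule edge_decomposition)
    then have "dsize (deg L k) < dsize (deg L l)" "k \<in> mor L"
      using 2 by (auto simp: mors_def dsize_add)
    then show ?thesis using less.hyps ek assms(3) by blast
  qed
qed

end

text \<open>\<open>edge_commute\<close> is the form in which \<open>commutation_iff\<close> delivers
  the commutation relation of a representation.\<close>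

locale edge_rows = graph_projections L P
  for L :: "('l, 'r::finite) hrgraph" and P :: "'l \<Rightarrow> ('h::chilbert_space \<Rightarrow>\<^sub>L 'h)" +
  fixes W :: "'r \<Rightarrow> 'l \<Rightarrow> ('h \<Rightarrow>\<^sub>L 'h)"
  assumes edge_module: "module_row (unit_deg j) (W j)"
    and edge_range: "range_row (unit_deg j) (W j)"
    and edge_commute: "v \<in> mors L (unit_deg i + unit_deg j) \<Longrightarrow>
      comp_row (unit_deg i) (unit_deg j) (W i) (W j) v = comp_row (unit_deg j) (unit_deg i) (W j) (W i) v"
begin

text \<open>A relation, because a path has no canonical word of edges: it collects the operators of
  all words, and \<open>path_op_unique\<close> shows that they agree.\<close>

inductive path_op :: "'l \<Rightarrow> ('h \<Rightarrow>\<^sub>L 'h) \<Rightarrow> bool" where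
  object: "a \<in> obj L \<Longrightarrow> path_op a (P a)"
| edge: "e \<in> mors L (unit_deg j) \<Longrightarrow> path_op k A \<Longrightarrow> src L e = rng L k \<Longrightarrow> path_op (cmp L e k) (W j e o\<^sub>L A)"

lemma edge_square:
  assumes "e \<in> mors L (unit_deg i)" "f \<in> mors L (unit_deg j)" "src L e = rng L f"
    and "f' \<in> mors L (unit_deg j)" "e' \<in> mors L (unit_deg i)" "src L f' = rng L e'"
    and "cmp L e f = cmp L f' e'"
  shows "W i e o\<^sub>L W j f = W j f' o\<^sub>L W i e'"
  using edge_commute[OF cmp_mors[OF assms(1-3)]] factor_cmp[OF assms(1-3)] factor_cmp[OF assms(4-6)] assms(7)
  by (simp add: comp_row_def)

lemma path_op_properties:
  assumes "path_op l A"
  shows "l \<in> mor L" "A \<in> BH" "P (rng L l) o\<^sub>L A = A" "A o\<^sub>L P (src L l) = A"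
proof -
  have "l \<in> mor L \<and> A \<in> BH \<and> P (rng L l) o\<^sub>L A = A \<and> A o\<^sub>L P (src L l) = A"
    using assms
  proof induction
    case (object a)
    then show ?case using obj_mor rng_id src_id by (auto simp: P_BH P_idem intro!: blinfun_eqI)
  next
    case (edge e j k A)
    have e: "e \<in> mor L" using edge.hyps(1) by (rule morsD)
    have "P (rng L e) o\<^sub>L W j e = W j e"
      using edge_range[of j] edge.hyps(1) rng_mors by (intro blinfun_eqI) (auto simp: range_row_def)
    then have "P (rng L e) o\<^sub>L (W j e o\<^sub>L A) = W j e o\<^sub>L A" by (simp add: blinfun_compose_assoc[symmetric])
    moreover have "(W j e o\<^sub>L A) o\<^sub>L P (src L k) = W j e o\<^sub>L A"
      using edge.IH by (simp add: blinfun_compose_assoc)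
    moreover have "W j e \<in> BH"
      using edge_module[of j] edge.hyps(1) by (auto simp: module_row_def intro: row_contraction_BH)
    ultimately show ?case
      using edge e by (auto simp: cmp_mor rng_cmp src_cmp BH_compose)
  qed
  then show "l \<in> mor L" "A \<in> BH" "P (rng L l) o\<^sub>L A = A" "A o\<^sub>L P (src L l) = A" by auto
qed

lemma path_op_exists: "l \<in> mor L \<Longrightarrow> \<exists>A. path_op l A"
  by (induction rule: mor_induct) (blast intro: object edge)+

text \<open>If two paths to the same morphism start with edges of different colours, both factor through the
  square formed by these colours.\<close>

lemma path_op_unique: "path_op l A \<Longrightarrow> path_op l B \<Longrightarrow> A = B"
proof (induction "dsize (deg L l)" arbitrary: l A B rule: less_induct)
  case less
  have not_obj: "cmp L e k \<notin> obj L" if "e \<in> mors L (unit_deg j)" "path_op k C" "src L e = rng L k" for e j k C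
  proof
    assume "cmp L e k \<in> obj L"
    then have "dsize (deg L (cmp L e k)) = 0" by (simp add: deg_id dsize_eq_0)
    then show False
      using that path_op_properties(1)[OF that(2)] by (simp add: mors_def deg_cmp dsize_add)
  qed
  from less.prems(1) show ?case
  proof cases
    case A: object
    from less.prems(2) show ?thesis
    proof cases
      case object
      then show ?thesis using A by simp
    next
      case (edge f j k' B')
      then show ?thesis using A not_obj by blast
    qed
  next
    case A: (edge e i k A')
    from less.prems(2) show ?thesis
    proof cases
      case object
      then show ?thesis using A not_obj by blast
    next
      case B: (edge f j k' B')
      have k: "k \<in> mor L" "k' \<in> mor L" using A B path_op_properties(1) by auto
      have deg_l: "deg L l = unit_deg i + deg L k" "deg L l = unit_deg j + deg L k'"
        using A(1,3,5) B(1,3,5) k by (metis deg_cmp_mors)+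
      have small: "dsize (deg L k) < dsize (deg L l)" "dsize (deg L k') < dsize (deg L l)"
        unfolding deg_l(1) by (simp add: dsize_add) (unfold deg_l(1)[symmetric] deg_l(2), simp add: dsize_add)
      have fac_f: "is_factor L (unit_deg j) (deg L k') l (f, k')"
        using B k by (simp add: is_factor_def mors_def)
      show ?thesis
      proof (cases "i = j")
        case True
        then have "deg L k = deg L k'" using deg_l by simp
        then have "is_factor L (unit_deg j) (deg L k') l (e, k)"
          using A k True by (simp add: is_factor_def mors_def)
        then have "(e, k) = (f, k')" using is_factor_unique fac_f by blast
        then show ?thesis using less.hyps[OF small(1)] A B True by auto
      next
        case False
        \<comment> \<open>\<open>l\<close> also starts with \<open>f\<close>, so its degree is
          positive in colour \<open>j\<close>; the edge \<open>e\<close> of colour \<open>i\<close>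
          contributes nothing there. Hence \<open>k\<close> can be rewritten to start with an edge
          \<open>f1\<close> of colour \<open>j\<close>.\<close>
        have "deg L k $ j = (unit_deg i + deg L k) $ j" using False by (simp add: axis_def)
        also have "\<dots> = (unit_deg j + deg L k') $ j" using deg_l by simp
        finally have "0 < deg L k $ j" by simp
        then obtain n where n: "deg L k = unit_deg j + n" using degree_split by blast
        then have "k \<in> mors L (unit_deg j + n)" using k by (simp add: mors_def)
        then obtain f1 c where f1: "f1 \<in> mors L (unit_deg j)" "c \<in> mors L n" "src L f1 = rng L c" "k = cmp L f1 c"
          by (rule edge_decomposition)
        have e: "e \<in> mors L (unit_deg i)" "src L e = rng L k" "l = cmp L e k" using A by auto
        have mor: "e \<in> mor L" "f1 \<in> mor L" "c \<in> mor L" using e f1 by (auto simp: mors_def)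
        have ef: "src L e = rng L f1" using e(2) f1 rng_cmp mor by simp
        have "cmp L e f1 \<in> mors L (unit_deg j + unit_deg i)"
          using cmp_mors[OF e(1) f1(1) ef] by (simp add: add.commute)
        then obtain f' e' where f': "f' \<in> mors L (unit_deg j)" "e' \<in> mors L (unit_deg i)" "src L f' = rng L e'"
          "cmp L e f1 = cmp L f' e'"
          by (rule edge_decomposition)
        have mor': "f' \<in> mor L" "e' \<in> mor L" using f' by (auto simp: mors_def)
        have ec: "src L e' = rng L c"
          using src_cmp[OF mor(1,2) ef] src_cmp[OF mor' f'(3)] f'(4) f1(3) by simp
        have "l = cmp L (cmp L e f1) c" using e(3) f1(3,4) ef cmp_assoc mor by simp
        also have "\<dots> = cmp L f' (cmp L e' c)" using f'(3,4) ec cmp_assoc mor mor' by simp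
        finally have l: "l = cmp L f' (cmp L e' c)" .
        have "deg L (cmp L e' c) = deg L k'"
        proof -
          have "unit_deg j + deg L k' = unit_deg i + (unit_deg j + n)" using deg_l n by simp
          then have "unit_deg j + deg L k' = unit_deg j + (unit_deg i + n)" by (simp add: add.left_commute)
          then show ?thesis using f' f1 mor' mor ec by (simp add: mors_def deg_cmp)
        qed
        then have "is_factor L (unit_deg j) (deg L k') l (f', cmp L e' c)"
          using l f' mor mor' ec cmp_mor rng_cmp by (auto simp: is_factor_def mors_def)
        then have eq: "f' = f" "cmp L e' c = k'" using is_factor_unique fac_f by blast+
        \<comment> \<open>The common tail \<open>c\<close> closes the diamond: by induction
          \<open>A'\<close> and \<open>B'\<close> both end in \<open>D\<close>, and
          \<open>edge_square\<close> exchanges the two edge operators in front.\<close>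
        obtain D where D: "path_op c D" using path_op_exists mor(3) by blast
        have "A' = W j f1 o\<^sub>L D"
          using less.hyps[OF small(1)] A edge[OF f1(1) D f1(3)] f1(4) by blast
        moreover have "B' = W i e' o\<^sub>L D"
          using less.hyps[OF small(2)] B edge[OF f'(2) D ec] eq(2) by blast
        moreover have "W i e o\<^sub>L W j f1 = W j f' o\<^sub>L W i e'"
          by (rule edge_square[OF e(1) f1(1) ef f'])
        ultimately show ?thesis using A B eq by (simp add: blinfun_compose_assoc[symmetric])
      qed
    qed
  qed
qed

definition ext :: "'l \<Rightarrow> ('h \<Rightarrow>\<^sub>L 'h)" where
  "ext = (\<lambda>l\<in>mor L. THE A. path_op l A)"

lemma ext_eq: "path_op l A \<Longrightarrow> ext l = A"
  using path_op_properties(1) path_op_unique by (auto simp: ext_def)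

lemma path_op_ext: "l \<in> mor L \<Longrightarrow> path_op l (ext l)"
  using path_op_exists ext_eq by metis

lemma ext_object: "a \<in> obj L \<Longrightarrow> ext a = P a"
  by (rule ext_eq[OF object])

lemma ext_edge:
  assumes e: "e \<in> mors L (unit_deg j)" shows "ext e = W j e"
proof -
  have "path_op (cmp L e (src L e)) (W j e o\<^sub>L P (src L e))"
    using e src_mors[OF e] rng_id by (intro edge object) auto
  moreover have "W j e o\<^sub>L P (src L e) = W j e"
    using edge_module[of j] e by (intro blinfun_eqI) (simp add: module_row_def)
  ultimately show ?thesis using ext_eq cmp_src[OF e] by simp
qed

lemma path_op_cmp: "path_op l A \<Longrightarrow> path_op k B \<Longrightarrow> src L l = rng L k \<Longrightarrow> path_op (cmp L l k) (A o\<^sub>L B)"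
proof (induction rule: path_op.induct)
  case (object a)
  then have "a = rng L k" using src_id by simp
  then show ?case using object path_op_properties[OF object(2)] id_left by simp
next
  case (edge e j l A)
  have mor: "e \<in> mor L" "l \<in> mor L" "k \<in> mor L"
    using edge path_op_properties(1) by (auto simp: mors_def)
  have lk: "src L l = rng L k" using edge.prems(2) src_cmp[OF mor(1,2)] edge.hyps by simp
  have "path_op (cmp L e (cmp L l k)) (W j e o\<^sub>L (A o\<^sub>L B))"
    using edge lk mor rng_cmp by (intro path_op.edge) auto
  then show ?case using cmp_assoc[OF mor] edge.hyps lk by (simp add: blinfun_compose_assoc)
qed

lemma ext_cmp: "l \<in> mor L \<Longrightarrow> k \<in> mor L \<Longrightarrow> src L l = rng L k \<Longrightarrow> ext (cmp L l k) = ext l o\<^sub>L ext k"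
  by (intro ext_eq path_op_cmp path_op_ext)

lemma module_row_cong:
  "module_row n U \<Longrightarrow> (\<And>l. l \<in> mors L n \<Longrightarrow> U l = U' l) \<Longrightarrow> module_row n U'"
proof -
  assume U: "module_row n U" and eq: "\<And>l. l \<in> mors L n \<Longrightarrow> U l = U' l"
  have "(\<Sum>i\<in>F. U' i (h i)) = (\<Sum>i\<in>F. U i (h i))" if "F \<subseteq> mors L n" for F h
    using that eq by (intro sum.cong) auto
  then show "module_row n U'"
    using U eq by (simp add: module_row_def row_contraction_def)
qed

text \<open>Induction on the total degree: in degree \<open>unit_deg j + n'\<close>,
  multiplicativity makes \<open>ext\<close> the composition of the edge row \<open>W j\<close> with
  \<open>ext\<close> in degree \<open>n'\<close>.\<close>

lemma module_row_ext: "module_row n ext"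
proof (induction "dsize n" arbitrary: n rule: less_induct)
  case less
  show ?case
  proof (cases rule: degree_cases[of n])
    case 1
    then show ?thesis using module_row_cong[OF module_row_P] ext_object by (simp add: mors_zero)
  next
    case (2 j n')
    then have "module_row n' ext" by (intro less) (simp add: dsize_add)
    from module_row_comp[OF edge_module this] have "module_row n (comp_row (unit_deg j) n' (W j) ext)"
      using 2 by simp
    then show ?thesis
    proof (rule module_row_cong)
      fix l assume "l \<in> mors L n"
      then have "l \<in> mors L (unit_deg j + n')" using 2 by simp
      then show "comp_row (unit_deg j) n' (W j) ext l = ext l"
        by (cases rule: factor_cases) (auto simp: comp_row_def ext_cmp morsD ext_edge)
    qed
  qed
qed

lemma graph_contraction_ext: "graph_contraction L ext"
  unfolding graph_contraction_def
proof (intro conjI ballI allI impI)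
  show "ext \<in> mor L \<rightarrow>\<^sub>E BH"
    using path_op_properties(2)[OF path_op_ext] by (auto simp: ext_def PiE_def)
  show "ext l o\<^sub>L ext k = ext (cmp L l k)" if "l \<in> mor L" "k \<in> mor L" "src L l = rng L k" for l k
    using ext_cmp that by simp
  show "ext l o\<^sub>L ext k = 0" if lk: "l \<in> mor L" "k \<in> mor L" "src L l \<noteq> rng L k" for l k
  proof -
    have "P (src L l) o\<^sub>L P (rng L k) = 0"
      using lk P_orth src_obj rng_obj by (intro blinfun_eqI) simp
    then have "(ext l o\<^sub>L P (src L l)) o\<^sub>L (P (rng L k) o\<^sub>L ext k) = 0"
      by (metis blinfun_compose_assoc blinfun_compose_zero)
    then show ?thesis using path_op_properties(3,4)[OF path_op_ext] lk by simp
  qed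
  show "\<exists>S\<in>BH. has_sot_sum (\<lambda>l. ext l o\<^sub>L cadj (ext l)) S (mors L n) \<and> op_le S id_blinfun" for n
  proof -
    have "row_contraction (mors L n) ext" using module_row_ext by (simp add: module_row_def)
    then show ?thesis
      using row_contraction_iff_sot_sum[of "mors L n" ext] path_op_properties(2)[OF path_op_ext] morsD(1) by blast
  qed
  show "is_proj_op (ext a)" if a: "a \<in> obj L" for a
    unfolding is_proj_op_def ext_object[OF a]
  proof (intro conjI)
    show "P a o\<^sub>L P a = P a" using a by (intro blinfun_eqI) (simp add: P_idem)
    show "cadj (P a) = P a" using a by (intro cadj_unique) (simp_all add: P_BH P_self)
  qed (rule P_BH[OF a])
qed

end


section \<open>From a contraction to a representation\<close>

context higher_rank_graph
begin

lemma graph_contraction_projections: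
  assumes V: "graph_contraction L V"
  shows "graph_projections L V"
proof (unfold_locales)
  have proj: "is_proj_op (V a)" if "a \<in> obj L" for a using V that by (simp add: graph_contraction_def)
  fix a h k assume a: "a \<in> obj L"
  show BH: "V a \<in> BH" using proj[OF a] by (simp add: is_proj_op_def)
  show "V a (V a h) = V a h"
    using proj[OF a] by (metis is_proj_op_def blinfun_apply_blinfun_compose)
  show "cinner (V a h) k = cinner h (V a k)"
    using proj[OF a] cinner_cadj_right[OF BH] by (metis is_proj_op_def)
  fix b assume "b \<in> obj L" "a \<noteq> b"
  then have "V a o\<^sub>L V b = 0"
    using V a obj_mor src_id rng_id unfolding graph_contraction_def by (metis subsetD)
  then show "V a (V b h) = 0"
    by (metis blinfun_apply_blinfun_compose zero_blinfun.rep_eq)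
qed

lemma representation_exists:
  fixes V :: "'l \<Rightarrow> ('h::chilbert_space \<Rightarrow>\<^sub>L 'h)"
  assumes V: "graph_contraction L V"
  shows "\<exists>\<sigma> T. product_system_rep L \<sigma> T \<and> (\<forall>a\<in>obj L. \<sigma> (dirac a) = V a) \<and>
    (\<forall>j. \<forall>l\<in>mors L (unit_deg j). T j (dirac l) = V l)"
proof -
  interpret graph_projections L V by (rule graph_contraction_projections[OF V])
  have BH: "V l \<in> BH" if "l \<in> mor L" for l using V that by (auto simp: graph_contraction_def)
  have cmp0: "V l o\<^sub>L V k = (if src L l = rng L k then V (cmp L l k) else 0)" if "l \<in> mor L" "k \<in> mor L" for l k
    using V that by (auto simp: graph_contraction_def)
  have cmp: "V l (V k h) = (if src L l = rng L k then V (cmp L l k) h else 0)"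
    if "l \<in> mor L" "k \<in> mor L" for l k h
    using arg_cong[OF cmp0[OF that], of "\<lambda>A. blinfun_apply A h"] by simp
  have row: "module_row n V" for n
    unfolding module_row_def
  proof (intro conjI ballI allI)
    show "row_contraction (mors L n) V"
      using V BH morsD(1) by (subst row_contraction_iff_sot_sum) (auto simp: graph_contraction_def)
    show "V l (V (src L l) h) = V l h" if "l \<in> mors L n" for l h
      using that cmp[of l "src L l"] src_mors[OF that] obj_mor rng_id cmp_src[OF that] by (auto simp: mors_def)
  qed
  have range: "range_row n V" for n
    unfolding range_row_def
  proof (intro ballI allI)
    fix l a h assume l: "l \<in> mors L n" and a: "a \<in> obj L"
    then show "V a (V l h) = (if rng L l = a then V l h else 0)"
      using cmp[of a l] src_id[OF a] obj_mor cmp_rng[OF l] by (auto simp: mors_def)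
  qed
  obtain \<sigma> where \<sigma>: "\<sigma> \<in> E L 0 \<rightarrow>\<^sub>E BH" "implements 0 V \<sigma>" by (rule implements_exists[OF row])
  have "\<exists>T. T \<in> E L (unit_deg j) \<rightarrow>\<^sub>E BH \<and> implements (unit_deg j) V T" for j :: 'r
    using implements_exists[OF row] by metis
  then obtain T where T: "\<And>j. T j \<in> E L (unit_deg j) \<rightarrow>\<^sub>E BH" "\<And>j. implements (unit_deg j) V (T j)"
    by metis
  \<comment> \<open>By multiplicativity the composed row does not remember how the degree was split,
    so the two orders in the commutation relation agree.\<close>
  have comp: "comp_row m n V V v = V v" if "v \<in> mors L (m + n)" for m n v
    using that by (cases rule: factor_cases) (simp add: comp_row_def cmp0 morsD)
  have "product_system_rep L \<sigma> T"
    unfolding product_system_rep_def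
  proof (intro conjI allI ballI)
    show "star_hom L \<sigma>" using implements_star_hom \<sigma> by (simp add: A0_eq_E)
    show "E_linear L (unit_deg j) (T j)" for j by (rule implements_E_linear[OF row T(2,1)])
    show "completely_contractive L (unit_deg j) (T j)" for j by (rule implements_contractive[OF row T(2)])
    show "T j (right_act L (left_act L f x) g) = \<sigma> f o\<^sub>L T j x o\<^sub>L \<sigma> g"
      if "f \<in> A0 L" "g \<in> A0 L" "x \<in> E L (unit_deg j)" for j f g x
      using implements_right_act[OF row \<sigma>(2) T(2) that(2) left_act_E[OF that(1,3)]]
        implements_left_act[OF row range \<sigma>(2) T(2) that(1,3)] by simp
    fix i j :: 'r and C
    have "\<forall>v\<in>mors L (unit_deg i + unit_deg j). comp_row (unit_deg i) (unit_deg j) V V v = comp_row (unit_deg j) (unit_deg i) V V v"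
      by (metis comp add.commute)
    then show "T_tilde (T i) (id_tensor_T_tilde L \<sigma> (unit_deg i) (T j) C) =
        T_tilde (T j) (id_tensor_T_tilde L \<sigma> (unit_deg j) (T i) (flip_tensor_id L \<sigma> (unit_deg i) (unit_deg j) C))"
      if "C \<in> kcompletion (gens2 L (unit_deg i) (unit_deg j)) (ker2 L \<sigma> (unit_deg i) (unit_deg j))"
      using commutation_iff[OF row range row range \<sigma>(2) T(2) T(2)] that by blast
  qed
  moreover have "\<sigma> (dirac a) = V a" if "a \<in> obj L" for a
    using implements_dirac[OF row \<sigma>(2)] that by (simp add: mors_zero)
  ultimately show ?thesis using implements_dirac[OF row T(2)] by blast
qed

lemma graph_contraction_eqI:
  assumes V: "graph_contraction L V" and V': "graph_contraction L V'"
    and obj: "\<And>a. a \<in> obj L \<Longrightarrow> V a = V' a"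
    and edge: "\<And>j l. l \<in> mors L (unit_deg j) \<Longrightarrow> V l = V' l"
  shows "V = V'"
proof (rule extensionalityI[of _ "mor L"])
  show "V \<in> extensional (mor L)" "V' \<in> extensional (mor L)"
    using V V' by (auto simp: graph_contraction_def PiE_def)
  show "V l = V' l" if "l \<in> mor L" for l
    using that
  proof (induction rule: mor_induct)
    case (edge j e k)
    have "V (cmp L e k) = V e o\<^sub>L V k" "V' (cmp L e k) = V' e o\<^sub>L V' k"
      using V V' edge.hyps(2,3) morsD(1)[OF edge.hyps(1)] by (simp_all add: graph_contraction_def)
    then show ?case using edge.IH assms(4)[OF edge.hyps(1)] by simp
  qed (rule obj)
qed


section \<open>From a representation to a contraction\<close>

lemma E_restrict: "x \<in> E L n \<Longrightarrow> (\<lambda>l. if l \<in> F then 0 else x l) \<in> E L n"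
proof (rule E_I(1)[where g = "esum L n x"])
  assume x: "x \<in> E L n"
  show "(\<Sum>l\<in>G. (cmod (if l \<in> F then 0 else x l))\<^sup>2) \<le> esum L n x a" if "finite G" "G \<subseteq> mors_from L n a" for a G
    by (rule order.trans[OF sum_mono sum_le_esum[OF x that]]) auto
qed (auto simp: E_outside E_tendsto)

text \<open>Removing finitely many coordinates from \<open>x\<close> changes \<open>S x h\<close> by
  the partial sum over them, and \<open>E_truncate\<close> makes the remainder small. The bound is
  phrased through \<open>esum\<close> so that \<open>\<sigma>\<close> and every \<open>T j\<close>
  are covered at once.\<close>

lemma linear_bounded_has_sum:
  assumes S: "E_linear L n S"
    and bound: "\<And>y e h. y \<in> E L n \<Longrightarrow> 0 < e \<Longrightarrow> (\<And>a. esum L n y a \<le> e) \<Longrightarrow> norm (S y h) \<le> sqrt e * norm h"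
    and x: "x \<in> E L n"
  shows "((\<lambda>l. x l *\<^sub>C S (dirac l) h) has_sum S x h) (mors L n)"
proof -
  let ?r = "\<lambda>F l. if l \<in> F then 0 else x l"
  have lin: "blinfun_apply (S (\<lambda>l. b * y l + c * z l)) h = b *\<^sub>C S y h + c *\<^sub>C S z h"
    if "y \<in> E L n" "z \<in> E L n" for y z b c
    using S that by (simp add: E_linear_def)
  have split: "S x h = S (?r F) h + (\<Sum>l\<in>F. x l *\<^sub>C S (dirac l) h)"
    if "finite F" "F \<subseteq> mors L n" for F
    using that
  proof (induction F rule: finite_induct)
    case (insert b F)
    have eq: "?r F = (\<lambda>l. 1 * ?r (insert b F) l + x b * dirac b l)"
      using insert.hyps by (auto simp: dirac_def fun_eq_iff)
    have "S (?r F) h = 1 *\<^sub>C S (?r (insert b F)) h + x b *\<^sub>C S (dirac b) h"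
      unfolding eq by (rule lin[OF E_restrict[OF x] dirac_E]) (use insert.prems in auto)
    then show ?case using insert by (simp add: algebra_simps)
  qed simp
  show ?thesis
    unfolding has_sum_def
  proof (rule tendstoI)
    fix \<epsilon> :: real assume \<epsilon>: "\<epsilon> > 0"
    \<comment> \<open>Chosen to make \<open>sqrt e * norm h\<close> smaller than the tolerance; the
      added 1 covers \<open>h = 0\<close>.\<close>
    define e where "e = (\<epsilon> / (norm h + 1))\<^sup>2"
    have h1: "norm h + 1 > 0" by (simp add: add_nonneg_pos)
    have e: "e > 0" using \<epsilon> h1 by (simp add: e_def)
    have sq: "sqrt e = \<epsilon> / (norm h + 1)" using \<epsilon> h1 by (simp add: e_def)
    obtain F0 where F0: "finite F0" "F0 \<subseteq> mors L n"
      and trunc: "\<forall>F. finite F \<longrightarrow> F0 \<subseteq> F \<longrightarrow> ?r F \<in> E L n \<and> (\<forall>a. esum L n (?r F) a \<le> e)"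
      using E_truncate[OF x e] by (elim exE conjE) (rule that)
    have tail: "esum L n (?r F) a \<le> e" if "finite F" "F0 \<subseteq> F" for F a
      by (rule trunc[rule_format, OF that, THEN conjunct2, THEN spec])
    have "dist (\<Sum>l\<in>F. x l *\<^sub>C S (dirac l) h) (S x h) < \<epsilon>"
      if F: "finite F" "F0 \<subseteq> F" "F \<subseteq> mors L n" for F
    proof -
      have "dist (\<Sum>l\<in>F. x l *\<^sub>C S (dirac l) h) (S x h) = norm (S (?r F) h)"
        by (simp add: split[OF F(1,3)] dist_norm)
      also have "\<dots> \<le> sqrt e * norm h" by (rule bound[OF E_restrict[OF x] e tail[OF F(1,2)]])
      also have "\<dots> < \<epsilon>" using \<epsilon> h1 by (simp add: sq divide_simps)
      finally show ?thesis .
    qed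
    then show "\<forall>\<^sub>F F in finite_subsets_at_top (mors L n).
        dist (\<Sum>l\<in>F. x l *\<^sub>C S (dirac l) h) (S x h) < \<epsilon>"
      using F0 by (auto simp: eventually_finite_subsets_at_top intro!: exI[of _ F0])
  qed
qed

lemma star_hom_E_linear: "star_hom L \<sigma> \<Longrightarrow> E_linear L 0 \<sigma>"
  by (simp add: star_hom_def E_linear_def A0_eq_E)

text \<open>With \<open>g = 1 - sqrt (1 - \<bar>f\<bar>\<^sup>2)\<close>, which vanishes at infinity, \<open>1 - \<sigma> (\<bar>f\<bar>\<^sup>2)\<close> is the square of the
  self-adjoint operator \<open>1 - \<sigma> g\<close>.\<close>

lemma star_hom_contractive:
  fixes \<sigma> :: "('l \<Rightarrow> complex) \<Rightarrow> ('h::chilbert_space \<Rightarrow>\<^sub>L 'h)"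
  assumes \<sigma>: "star_hom L \<sigma>" and f: "f \<in> A0 L" and f1: "\<And>a. cmod (f a) \<le> 1"
  shows "norm (\<sigma> f h) \<le> norm h"
proof -
  have BH: "\<sigma> u \<in> BH" if "u \<in> A0 L" for u using \<sigma> that by (auto simp: star_hom_def)
  have lin: "blinfun_apply (\<sigma> (\<lambda>a. b * u a + c * v a)) h = b *\<^sub>C \<sigma> u h + c *\<^sub>C \<sigma> v h"
    if "u \<in> A0 L" "v \<in> A0 L" for u v b c h using \<sigma> that by (simp add: star_hom_def)
  have mult: "\<sigma> (\<lambda>a. u a * v a) = \<sigma> u o\<^sub>L \<sigma> v" if "u \<in> A0 L" "v \<in> A0 L" for u v
    using \<sigma> that by (simp add: star_hom_def)
  have star: "cinner (\<sigma> u h) k = cinner h (blinfun_apply (\<sigma> (\<lambda>a. cnj (u a))) k)"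
    if "u \<in> A0 L" for u h k
    using \<sigma> that cinner_cadj_right[OF BH[OF that]] by (simp add: star_hom_def)
  define g where "g a = complex_of_real (1 - sqrt (1 - (cmod (f a))\<^sup>2))" for a
  have g: "g \<in> A0 L"
  proof -
    have "((\<lambda>a. 1 - sqrt (1 - (cmod (f a))\<^sup>2)) \<longlongrightarrow> 1 - sqrt (1 - 0\<^sup>2)) cofinite"
      using f by (intro tendsto_intros tendsto_norm_zero) (auto simp: A0_def)
    then have "(g \<longlongrightarrow> 0) cofinite"
      unfolding g_def using tendsto_of_real[where 'a = complex] by fastforce
    then show ?thesis using f by (auto simp: A0_def g_def)
  qed
  have cnj_f: "(\<lambda>a. cnj (f a)) \<in> A0 L"
    using f tendsto_cnj[of f 0] by (auto simp: A0_def)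
  have cnj_g: "(\<lambda>a. cnj (g a)) = g" by (simp add: g_def fun_eq_iff)
  \<comment> \<open>This is the identity of 1 minus the squared modulus of \<open>f\<close> with the
    square of \<open>1 - g\<close>, with the constant 1 cancelled, as constants need not lie in
    \<open>A0 L\<close>.\<close>
  have gf: "(\<lambda>a. cnj (f a) * f a) = (\<lambda>a. 2 * g a + (- 1) * (g a * g a))"
  proof
    fix a
    have s: "(sqrt (1 - (cmod (f a))\<^sup>2))\<^sup>2 = 1 - (cmod (f a))\<^sup>2"
      using f1[of a] by (simp add: power_le_one)
    have "cnj (f a) * f a = of_real ((cmod (f a))\<^sup>2)" by (simp add: complex_norm_square mult.commute del: of_real_power)
    also have "(cmod (f a))\<^sup>2 = 2 * (1 - sqrt (1 - (cmod (f a))\<^sup>2)) + (- 1) * ((1 - sqrt (1 - (cmod (f a))\<^sup>2)) * (1 - sqrt (1 - (cmod (f a))\<^sup>2)))"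
      using s by (simp add: algebra_simps power2_eq_square)
    also have "complex_of_real \<dots> = 2 * g a + (- 1) * (g a * g a)" unfolding g_def by simp
    finally show "cnj (f a) * f a = 2 * g a + (- 1) * (g a * g a)" .
  qed
  let ?g = "\<sigma> g h"
  have "complex_of_real ((norm (\<sigma> f h))\<^sup>2) = cinner h (blinfun_apply (\<sigma> (\<lambda>a. cnj (f a) * f a)) h)"
    unfolding cinner_self[symmetric] star[OF f] mult[OF cnj_f f] by simp
  also have "\<dots> = 2 * cinner h ?g - cinner h (\<sigma> g ?g)"
    unfolding gf lin[OF g A0_mult[OF g g]] mult[OF g g]
    by (simp add: cinner_add_right cinner_scaleC_right)
  also have "cinner h (\<sigma> g ?g) = of_real ((norm ?g)\<^sup>2)"
    using star[OF g, of h ?g] unfolding cnj_g by (simp add: cinner_self)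
  finally have "(norm (\<sigma> f h))\<^sup>2 = 2 * Re (cinner h ?g) - (norm ?g)\<^sup>2"
    by (simp add: complex_eq_iff)
  also have "\<dots> \<le> (norm h)\<^sup>2"
    using norm_diff_square[of h ?g] zero_le_power2[of "norm (h - ?g)"] by linarith
  finally show ?thesis by (rule power2_le_imp_le) simp
qed

text \<open>In degree zero \<open>esum\<close> is the squared modulus, so division by
  \<open>sqrt e\<close> reduces to \<open>star_hom_contractive\<close>.\<close>

lemma star_hom_bound:
  assumes \<sigma>: "star_hom L \<sigma>" and f: "f \<in> E L 0" and e: "0 < e" "\<And>a. esum L 0 f a \<le> e"
  shows "norm (\<sigma> f h) \<le> sqrt e * norm h"
proof -
  have f0: "f \<in> A0 L" using f by (simp add: A0_eq_E)
  define u where "u a = of_real (1 / sqrt e) * f a" for a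
  have u: "u \<in> A0 L" using E_scale[OF f, of "of_real (1 / sqrt e)"] by (simp add: u_def[abs_def] A0_eq_E)
  have "cmod (u a) \<le> 1" for a
  proof (cases "a \<in> obj L")
    case True
    then have "(cmod (f a))\<^sup>2 \<le> e" using e(2)[of a] by (simp add: esum_def mors_from_zero)
    then have "cmod (f a) \<le> sqrt e" by (rule real_le_rsqrt)
    then show ?thesis using e(1) by (simp add: u_def norm_mult norm_divide)
  qed (use u in \<open>simp add: A0_def\<close>)
  from star_hom_contractive[OF \<sigma> u this] have le: "norm (\<sigma> u h) \<le> norm h" .
  have "f = (\<lambda>a. of_real (sqrt e) * u a + 0 * u a)" using e(1) by (simp add: u_def fun_eq_iff flip: of_real_mult)
  moreover have "blinfun_apply (\<sigma> (\<lambda>a. b * u a + c * u a)) h = b *\<^sub>C \<sigma> u h + c *\<^sub>C \<sigma> u h" for b c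
    using \<sigma> u by (simp add: star_hom_def)
  ultimately have "\<sigma> f h = of_real (sqrt e) *\<^sub>C \<sigma> u h + 0 *\<^sub>C \<sigma> u h"
    by metis
  then show ?thesis using le e(1) by (simp add: norm_scaleC scaleC.zero_left mult_left_mono)
qed

text \<open>The case of 1 x 1 matrices, in the form asked for by
  \<open>linear_bounded_has_sum\<close>.\<close>

lemma contractive_bound:
  fixes T :: "('l \<Rightarrow> complex) \<Rightarrow> ('h::chilbert_space \<Rightarrow>\<^sub>L 'h)"
  assumes T: "completely_contractive L n T" and x: "x \<in> E L n" and e: "0 < e" "\<And>a. esum L n x a \<le> e"
  shows "norm (T x h) \<le> sqrt e * norm h"
proof -
  let ?m = "matrix_opnorm 1 (\<lambda>i k. blinfun_apply (T x))"
  have "?m \<le> E_matrix_norm L n 1 (\<lambda>i k. x)"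
    using T[unfolded completely_contractive_def, rule_format, of 1 "\<lambda>i k. x"] x by simp
  also have "\<dots> \<le> sqrt e"
    unfolding E_matrix_norm_def real_sqrt_le_iff
  proof (rule cSup_least)
    fix s assume "s \<in> insert 0 ((\<lambda>a. matrix_opnorm 1 (\<lambda>i k z. (\<Sum>l<(1::nat). E_inner L n x x a) * z)) ` obj L)"
    then show "s \<le> e"
    proof (elim insertE imageE)
      fix a assume s: "s = matrix_opnorm 1 (\<lambda>i k z. (\<Sum>l<(1::nat). E_inner L n x x a) * z)"
      show "s \<le> e"
        unfolding s
        by (rule order.trans[OF matrix_opnorm_le_sum]) (use e(2)[of a] in \<open>simp add: E_inner_self[OF x]\<close>)
    qed (use e in simp)
  qed simp
  finally have m: "?m \<le> sqrt e" .
  have "norm (T x h) \<le> ?m * norm h"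
    using matrix_opnorm_bound[of 1 "\<lambda>i k. blinfun_apply (T x)" "\<lambda>k. h", OF blinfun.bounded_linear_right]
    by (simp add: L2_set_def)
  also have "\<dots> \<le> sqrt e * norm h" by (intro mult_right_mono m) simp
  finally show ?thesis .
qed

lemma E_inner_dirac:
  assumes l: "l \<in> mors L n" and k: "k \<in> mors L n"
  shows "E_inner L n (dirac l) (dirac k) a = (if l = k \<and> src L l = a then 1 else 0)"
proof (cases "a \<in> obj L")
  case True
  have "((\<lambda>m. cnj (dirac l m) * dirac k m) has_sum (if l = k \<and> src L l = a then 1 else 0)) (mors_from L n a)"
    using l k by (intro has_sum_finite_neutralI[of "{l} \<inter> {k} \<inter> mors_from L n a"])
      (auto simp: dirac_def mors_from_def)
  then show ?thesis
    using E_inner_has_sum[OF dirac_E[OF l] dirac_E[OF k] True] has_sum_unique by blast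
qed (use src_mors[OF l] in \<open>auto simp: E_inner_def\<close>)

lemma E_inner_zero_left: "E_inner L n (\<lambda>l. 0) y a = 0"
  by (simp add: E_inner_def)

text \<open>Complete contractivity speaks of square matrices, so the Dirac functions are put in row
  0 and padded by zero rows. Their Gram matrix at any object is diagonal with entries 0 and 1, hence
  of norm at most 1.\<close>

lemma contractive_row:
  fixes T :: "('l \<Rightarrow> complex) \<Rightarrow> ('h::chilbert_space \<Rightarrow>\<^sub>L 'h)"
  assumes T: "completely_contractive L n T" and BH: "\<And>x. x \<in> E L n \<Longrightarrow> T x \<in> BH"
  shows "row_contraction (mors L n) (\<lambda>l. T (dirac l))"
  unfolding row_contraction_def
proof (intro conjI ballI allI impI)
  show "T (dirac l) \<in> BH" if "l \<in> mors L n" for l using BH dirac_E that by blast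
  fix F and h :: "'l \<Rightarrow> 'h" assume F: "finite F" "F \<subseteq> mors L n"
  obtain b where b: "bij_betw b {..<card F} F" using ex_bij_betw_nat_finite[OF F(1)] by (auto simp: atLeast0LessThan)
  define N where "N = card F"
  have b_mem: "b k \<in> mors L n" if "k < N" for k
    using bij_betwE[OF b] F that by (auto simp: N_def)
  have b_inj: "b i = b k \<longleftrightarrow> i = k" if "i < N" "k < N" for i k
    using bij_betw_imp_inj_on[OF b] that by (auto simp: N_def inj_on_eq_iff)
  define x where "x i k = (if i = 0 then dirac (b k) else (\<lambda>l. 0 :: complex))" for i k :: nat
  have x: "x i k \<in> E L n" if "k < N" for i k using b_mem[OF that] by (simp add: x_def dirac_E E_zero)
  show "norm (\<Sum>l\<in>F. T (dirac l) (h l)) \<le> L2_set (\<lambda>l. norm (h l)) F"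
  proof (cases "N = 0")
    case True
    then show ?thesis using F by (simp add: N_def)
  next
    case False
    let ?m = "matrix_opnorm N (\<lambda>i k. blinfun_apply (T (x i k)))"
    have "?m \<le> E_matrix_norm L n N x"
      using T[unfolded completely_contractive_def, rule_format, of N x] x by simp
    also have "\<dots> \<le> sqrt 1"
      unfolding E_matrix_norm_def real_sqrt_le_iff
    proof (rule cSup_least)
      fix s assume "s \<in> insert 0 ((\<lambda>a. matrix_opnorm N (\<lambda>i k z. (\<Sum>l<N. E_inner L n (x l i) (x l k) a) * z)) ` obj L)"
      then show "s \<le> 1"
      proof (elim insertE imageE)
        fix a assume s: "s = matrix_opnorm N (\<lambda>i k z. (\<Sum>l<N. E_inner L n (x l i) (x l k) a) * z)"
        have gram: "(\<Sum>l<N. E_inner L n (x l i) (x l k) a) = (if i = k \<and> src L (b i) = a then 1 else 0)"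
          if ik: "i < N" "k < N" for i k
        proof -
          have "(\<Sum>l<N. E_inner L n (x l i) (x l k) a) = (\<Sum>l<N. if l = 0 then (if i = k \<and> src L (b i) = a then 1 else 0) else 0)"
            using ik by (intro sum.cong refl) (simp add: x_def E_inner_zero_left E_inner_dirac b_mem b_inj)
          then show ?thesis using False by simp
        qed
        show "s \<le> 1"
          unfolding s
        proof (rule matrix_opnorm_le)
          fix z :: "nat \<Rightarrow> complex" assume z: "L2_set (\<lambda>k. norm (z k)) {..<N} \<le> 1"
          have "(\<Sum>k<N. (\<Sum>l<N. E_inner L n (x l i) (x l k) a) * z k) = (if src L (b i) = a then z i else 0)"
            if "i < N" for i
          proof -
            have "(\<Sum>k<N. (\<Sum>l<N. E_inner L n (x l i) (x l k) a) * z k) =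
                (\<Sum>k<N. if k = i then (if src L (b i) = a then z i else 0) else 0)"
              using that by (intro sum.cong refl) (simp add: gram)
            then show ?thesis using that by simp
          qed
          then have "L2_set (\<lambda>i. norm (\<Sum>k<N. (\<Sum>l<N. E_inner L n (x l i) (x l k) a) * z k)) {..<N} \<le>
              L2_set (\<lambda>k. norm (z k)) {..<N}"
            by (intro L2_set_mono) auto
          then show "L2_set (\<lambda>i. norm (\<Sum>k<N. (\<Sum>l<N. E_inner L n (x l i) (x l k) a) * z k)) {..<N} \<le> 1"
            using z by linarith
        qed
      qed simp
    qed simp
    finally have m: "?m \<le> 1" by simp
    have "(\<Sum>l\<in>F. T (dirac l) (h l)) = (\<Sum>k<N. T (x 0 k) (h (b k)))"
      unfolding N_def by (subst sum.reindex_bij_betw[OF b, symmetric]) (simp add: x_def)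
    also have "norm \<dots> \<le> L2_set (\<lambda>i. norm (\<Sum>k<N. T (x i k) (h (b k)))) {..<N}"
      by (rule member_le_L2_set[of "{..<N}" 0 "\<lambda>i. norm (\<Sum>k<N. T (x i k) (h (b k)))"]) (use False in auto)
    also have "\<dots> \<le> ?m * L2_set (\<lambda>k. norm (h (b k))) {..<N}"
      by (intro matrix_opnorm_bound blinfun.bounded_linear_right)
    also have "\<dots> \<le> 1 * L2_set (\<lambda>k. norm (h (b k))) {..<N}" by (intro mult_right_mono m) simp
    also have "\<dots> = L2_set (\<lambda>l. norm (h l)) F"
      unfolding L2_set_def N_def by (subst sum.reindex_bij_betw[OF b, symmetric]) simp
    finally show ?thesis .
  qed
qed

lemma rep_has_sum:
  assumes rep: "product_system_rep L \<sigma> T"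
  shows "f \<in> A0 L \<Longrightarrow> ((\<lambda>a. f a *\<^sub>C \<sigma> (dirac a) h) has_sum \<sigma> f h) (obj L)"
    and "x \<in> E L (unit_deg j) \<Longrightarrow>
      ((\<lambda>l. x l *\<^sub>C T j (dirac l) h) has_sum T j x h) (mors L (unit_deg j))"
proof -
  have \<sigma>: "star_hom L \<sigma>" using rep by (simp add: product_system_rep_def)
  show "((\<lambda>a. f a *\<^sub>C \<sigma> (dirac a) h) has_sum \<sigma> f h) (obj L)" if "f \<in> A0 L"
    using linear_bounded_has_sum[OF star_hom_E_linear[OF \<sigma>] star_hom_bound[OF \<sigma>], of f h] that
    unfolding mors_zero A0_eq_E by blast
  have T: "E_linear L (unit_deg j) (T j)" "completely_contractive L (unit_deg j) (T j)"
    using rep by (auto simp: product_system_rep_def)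
  show "((\<lambda>l. x l *\<^sub>C T j (dirac l) h) has_sum T j x h) (mors L (unit_deg j))"
    if "x \<in> E L (unit_deg j)"
    by (rule linear_bounded_has_sum[OF T(1) contractive_bound[OF T(2)] that])
qed

lemma rep_eqI:
  assumes rep: "product_system_rep L \<sigma> T" and rep': "product_system_rep L \<sigma>' T'"
    and obj: "\<And>a. a \<in> obj L \<Longrightarrow> \<sigma> (dirac a) = \<sigma>' (dirac a)"
    and edge: "\<And>j l. l \<in> mors L (unit_deg j) \<Longrightarrow> T j (dirac l) = T' j (dirac l)"
  shows "\<sigma> = \<sigma>'" "T = T'"
proof -
  show "\<sigma> = \<sigma>'"
  proof (rule extensionalityI[of _ "A0 L"])
    show "\<sigma> \<in> extensional (A0 L)" "\<sigma>' \<in> extensional (A0 L)"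
      using rep rep' by (auto simp: product_system_rep_def star_hom_def PiE_def)
    fix f assume f: "f \<in> A0 L"
    show "\<sigma> f = \<sigma>' f"
      by (rule blinfun_eqI) (simp add: obj infsumI[OF rep_has_sum(1)[OF rep f], symmetric]
          infsumI[OF rep_has_sum(1)[OF rep' f], symmetric] cong: infsum_cong)
  qed
  show "T = T'"
  proof
    fix j
    show "T j = T' j"
    proof (rule extensionalityI[of _ "E L (unit_deg j)"])
      show "T j \<in> extensional (E L (unit_deg j))" "T' j \<in> extensional (E L (unit_deg j))"
        using rep rep' by (auto simp: product_system_rep_def E_linear_def PiE_def)
      fix x assume x: "x \<in> E L (unit_deg j)"
      have "(\<Sum>\<^sub>\<infinity>l\<in>mors L (unit_deg j). x l *\<^sub>C T j (dirac l) h) = (\<Sum>\<^sub>\<infinity>l\<in>mors L (unit_deg j). x l *\<^sub>C T' j (dirac l) h)" for h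
        by (rule infsum_cong) (simp add: edge)
      then show "T j x = T' j x"
        unfolding infsumI[OF rep_has_sum(2)[OF rep x]] infsumI[OF rep_has_sum(2)[OF rep' x]] by (rule blinfun_eqI)
    qed
  qed
qed

lemma contraction_exists:
  fixes \<sigma> :: "('l \<Rightarrow> complex) \<Rightarrow> ('h::chilbert_space \<Rightarrow>\<^sub>L 'h)"
  assumes rep: "product_system_rep L \<sigma> T"
  shows "\<exists>V. graph_contraction L V \<and> (\<forall>a\<in>obj L. \<sigma> (dirac a) = V a) \<and>
    (\<forall>j. \<forall>l\<in>mors L (unit_deg j). T j (dirac l) = V l)"
proof -
  define P where "P a = \<sigma> (dirac a)" for a
  define W where "W j l = T j (dirac l)" for j l
  have \<sigma>: "star_hom L \<sigma>" using rep by (simp add: product_system_rep_def)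
  have \<sigma>_BH: "\<sigma> f \<in> BH" if "f \<in> A0 L" for f using \<sigma> that by (auto simp: star_hom_def)
  have \<sigma>_lin: "blinfun_apply (\<sigma> (\<lambda>a. b * f a + c * g a)) h = b *\<^sub>C \<sigma> f h + c *\<^sub>C \<sigma> g h"
    if "f \<in> A0 L" "g \<in> A0 L" for f g b c h
    using \<sigma> that by (simp add: star_hom_def)
  have \<sigma>_mult: "\<sigma> f o\<^sub>L \<sigma> g = \<sigma> (\<lambda>a. f a * g a)" if "f \<in> A0 L" "g \<in> A0 L" for f g
    using \<sigma> that by (simp add: star_hom_def)
  have T: "E_linear L (unit_deg j) (T j)" "completely_contractive L (unit_deg j) (T j)" for j
    using rep by (auto simp: product_system_rep_def)
  have T_BH: "T j x \<in> BH" if "x \<in> E L (unit_deg j)" for j x using T(1)[of j] that by (auto simp: E_linear_def)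
  interpret graph_projections L P
  proof
    fix a h k assume a: "a \<in> obj L"
    note da = dirac_A0[OF a]
    show BH: "P a \<in> BH" unfolding P_def by (rule \<sigma>_BH[OF da])
    have "(\<lambda>b. dirac a b * dirac a b) = dirac a" by (auto simp: dirac_def)
    then have "P a o\<^sub>L P a = P a" using \<sigma>_mult[OF da da] by (simp add: P_def)
    then show "P a (P a h) = P a h"
      by (metis blinfun_apply_blinfun_compose)
    have "(\<lambda>b. cnj (dirac a b)) = dirac a" by (auto simp: dirac_def)
    then have "cadj (P a) = P a" using \<sigma> da unfolding star_hom_def P_def by metis
    then show "cinner (P a h) k = cinner h (P a k)"
      using cinner_cadj_right[OF BH] by metis
    fix b assume b: "b \<in> obj L" "a \<noteq> b"
    \<comment> \<open>Linearity of \<open>\<sigma>\<close> is stated for combinations of two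
      elements, so the zero function is written as a combination with zero coefficients.\<close>
    have "(\<lambda>c. dirac a c * dirac b c) = (\<lambda>c. 0 * dirac a c + 0 * dirac a c)" using b by (auto simp: dirac_def)
    then have "P a o\<^sub>L P b = \<sigma> (\<lambda>c. 0 * dirac a c + 0 * dirac a c)"
      using \<sigma>_mult[OF da dirac_A0[OF b(1)]] by (simp add: P_def)
    then have "blinfun_apply (P a o\<^sub>L P b) h = 0 *\<^sub>C P a h + 0 *\<^sub>C P a h"
      using \<sigma>_lin[OF da da, of 0 0 h] by (simp only: P_def)
    then show "P a (P b h) = 0" by (simp add: scaleC.zero_left)
  qed
  have W_eq: "P (rng L l) o\<^sub>L W j l o\<^sub>L P (src L l) = W j l" if l: "l \<in> mors L (unit_deg j)" for j l
  proof -
    have "right_act L (left_act L (dirac (rng L l)) (dirac l)) (dirac (src L l)) = (dirac l :: 'l \<Rightarrow> complex)"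
      by (auto simp: right_act_def left_act_def dirac_def)
    then show ?thesis
      using rep dirac_A0[OF rng_mors[OF l]] dirac_A0[OF src_mors[OF l]] dirac_E[OF l]
      unfolding product_system_rep_def P_def W_def by metis
  qed
  have W_apply: "P (rng L l) (W j l (P (src L l) h)) = W j l h"
    if "l \<in> mors L (unit_deg j)" for j l h
    using arg_cong[OF W_eq[OF that], of "\<lambda>A. blinfun_apply A h"] by simp
  have row: "module_row (unit_deg j) (W j)" for j
    unfolding module_row_def
  proof (intro conjI ballI allI)
    show "row_contraction (mors L (unit_deg j)) (W j)"
      unfolding W_def using contractive_row[OF T(2) T_BH] .
    show "W j l (P (src L l) h) = W j l h"
      if l: "l \<in> mors L (unit_deg j)" for l h
      using W_apply[OF l, of h] W_apply[OF l, of "P (src L l) h"] P_idem[OF src_mors[OF l]] by simp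
  qed
  have range: "range_row (unit_deg j) (W j)" for j
    unfolding range_row_def
  proof (intro ballI allI)
    fix l a h assume l: "l \<in> mors L (unit_deg j)" and a: "a \<in> obj L"
    show "P a (W j l h) = (if rng L l = a then W j l h else 0)"
      using W_apply[OF l, of h] P_idem[OF a] P_orth[OF a rng_mors[OF l]] by metis
  qed
  have im_\<sigma>: "implements 0 P \<sigma>"
    using rep_has_sum(1)[OF rep] \<sigma>_BH
    by (intro implementsI[OF module_row_P]) (simp_all add: P_def mors_zero A0_eq_E)
  have im_T: "implements (unit_deg j) (W j) (T j)" for j
    using rep_has_sum(2)[OF rep] T_BH by (intro implementsI[OF row]) (simp_all add: W_def)
  interpret edge_rows L P W
  proof
    show "module_row (unit_deg j) (W j)" "range_row (unit_deg j) (W j)" for j by (fact row range)+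
    fix i j v
    have "\<forall>C\<in>kcompletion (gens2 L (unit_deg i) (unit_deg j)) (ker2 L \<sigma> (unit_deg i) (unit_deg j)).
        T_tilde (T i) (id_tensor_T_tilde L \<sigma> (unit_deg i) (T j) C) =
        T_tilde (T j) (id_tensor_T_tilde L \<sigma> (unit_deg j) (T i) (flip_tensor_id L \<sigma> (unit_deg i) (unit_deg j) C))"
      using rep by (simp add: product_system_rep_def)
    then show "v \<in> mors L (unit_deg i + unit_deg j) \<Longrightarrow>
        comp_row (unit_deg i) (unit_deg j) (W i) (W j) v = comp_row (unit_deg j) (unit_deg i) (W j) (W i) v"
      unfolding commutation_iff[OF row range row range im_\<sigma> im_T im_T] by blast
  qed
  show ?thesis
    using graph_contraction_ext ext_object ext_edge by (intro exI[of _ ext]) (simp add: P_def W_def)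
qed

end

section \<open>The bijection and its description on generators\<close>

theorem lemma4p5:
  fixes L :: "('l, 'r::finite) hrgraph"
  assumes "higher_rank_graph L"
  shows "\<exists>\<Phi> :: (('l \<Rightarrow> complex) \<Rightarrow> ('h::chilbert_space \<Rightarrow>\<^sub>L 'h)) \<times>
                  ('r \<Rightarrow> ('l \<Rightarrow> complex) \<Rightarrow> ('h \<Rightarrow>\<^sub>L 'h)) \<Rightarrow> ('l \<Rightarrow> ('h \<Rightarrow>\<^sub>L 'h)).
           bij_betw \<Phi> {(\<sigma>, T). product_system_rep L \<sigma> T} {V. graph_contraction L V} \<and>
           (\<forall>\<sigma> T V. product_system_rep L \<sigma> T \<longrightarrow> graph_contraction L V \<longrightarrow>
              (\<Phi> (\<sigma>, T) = V \<longleftrightarrow>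
                 (\<forall>a\<in>obj L. \<sigma> (dirac a) = V a) \<and>
                 (\<forall>j. \<forall>l\<in>mors L (unit_deg j). T j (dirac l) = V l)))"
proof -
  interpret higher_rank_graph L by fact
  define M where "M \<sigma> T V \<longleftrightarrow> (\<forall>a\<in>obj L. \<sigma> (dirac a) = V a) \<and>
      (\<forall>j. \<forall>l\<in>mors L (unit_deg j). T j (dirac l) = V l)"
    for \<sigma> :: "('l \<Rightarrow> complex) \<Rightarrow> ('h \<Rightarrow>\<^sub>L 'h)" and T :: "'r \<Rightarrow> ('l \<Rightarrow> complex) \<Rightarrow> ('h \<Rightarrow>\<^sub>L 'h)"
      and V :: "'l \<Rightarrow> ('h \<Rightarrow>\<^sub>L 'h)"
  \<comment> \<open>\<open>contraction_exists\<close> and \<open>graph_contraction_eqI\<close> make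
    this description definite on representations. Surjectivity will come from
    \<open>representation_exists\<close>, injectivity from \<open>rep_eqI\<close>.\<close>
  define \<Phi> where "\<Phi> = (\<lambda>(\<sigma>, T). THE V. graph_contraction L V \<and> M \<sigma> T V)"
  have uniq: "V = V'" if "graph_contraction L V" "graph_contraction L V'" "M \<sigma> T V" "M \<sigma> T V'" for \<sigma> T V V'
    using that by (intro graph_contraction_eqI) (auto simp: M_def)
  have uniq': "\<sigma> = \<sigma>' \<and> T = T'"
    if "product_system_rep L \<sigma> T" "product_system_rep L \<sigma>' T'" "M \<sigma> T V" "M \<sigma>' T' V" for \<sigma> T \<sigma>' T' V
    using rep_eqI[OF that(1,2)] that(3,4) by (simp add: M_def)
  have \<Phi>: "graph_contraction L (\<Phi> (\<sigma>, T)) \<and> M \<sigma> T (\<Phi> (\<sigma>, T))" if "product_system_rep L \<sigma> T" for \<sigma> T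
  proof -
    have "\<exists>!V. graph_contraction L V \<and> M \<sigma> T V"
      using contraction_exists[OF that] uniq unfolding M_def[symmetric] by blast
    from theI'[OF this] show ?thesis by (simp add: \<Phi>_def)
  qed
  have char: "\<Phi> (\<sigma>, T) = V \<longleftrightarrow> M \<sigma> T V" if "product_system_rep L \<sigma> T" "graph_contraction L V" for \<sigma> T V
    using \<Phi>[OF that(1)] uniq that by blast
  have "bij_betw \<Phi> {(\<sigma>, T). product_system_rep L \<sigma> T} {V. graph_contraction L V}"
  proof (rule bij_betw_imageI)
    show "inj_on \<Phi> {(\<sigma>, T). product_system_rep L \<sigma> T}"
    proof (rule inj_onI)
      fix p q assume pq: "p \<in> {(\<sigma>, T). product_system_rep L \<sigma> T}" "q \<in> {(\<sigma>, T). product_system_rep L \<sigma> T}" "\<Phi> p = \<Phi> q"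
      obtain \<sigma> T \<sigma>' T' where "p = (\<sigma>, T)" "q = (\<sigma>', T')" by (metis surj_pair)
      then show "p = q" using pq \<Phi> uniq' by (metis (mono_tags, lifting) case_prodD mem_Collect_eq)
    qed
    show "\<Phi> ` {(\<sigma>, T). product_system_rep L \<sigma> T} = {V. graph_contraction L V}"
    proof
      show "\<Phi> ` {(\<sigma>, T). product_system_rep L \<sigma> T} \<subseteq> {V. graph_contraction L V}" using \<Phi> by auto
      show "{V. graph_contraction L V} \<subseteq> \<Phi> ` {(\<sigma>, T). product_system_rep L \<sigma> T}"
      proof
        fix V :: "'l \<Rightarrow> ('h \<Rightarrow>\<^sub>L 'h)" assume "V \<in> {V. graph_contraction L V}"
        then have V: "graph_contraction L V" by simp
        then obtain \<sigma> T where "product_system_rep L \<sigma> T" "M \<sigma> T V"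
          using representation_exists[OF V] unfolding M_def[symmetric] by blast
        then show "V \<in> \<Phi> ` {(\<sigma>, T). product_system_rep L \<sigma> T}"
          using char[OF _ V] by (auto intro!: image_eqI[of _ _ "(\<sigma>, T)"])
      qed
    qed
  qed
  then show ?thesis using char unfolding M_def by blast
qed

end
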